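(* For a compact abelian group $G$, the equality $G=\mathbb G(\mathbb C[G])$ holds if and only if $G$ is totally disconnected (i.e. profinite).
   Context: Compact groups are Hausdorff. A complex topological vector space is weakly complete if it is isomorphic to $\mathbb C^J$ for some set $J$; a weakly complete algebra is an associative unital algebra on a weakly complete vector space with continuous multiplication, and $A^{-1}$ is its topological group of units. $\mathbb C[G]$ is the weakly complete complex group algebra of $G$: there is a continuous homomorphism $\eta_G\colon G\to\mathbb C[G]^{-1}$ such that each continuous homomorphism $f\colon G\to A^{-1}$ into the units of a weakly complete complex algebra $A$ extends uniquely to a continuous unital algebra homomorphism $f'\colon\mathbb C[G]\to A$ with $f=f'\circ\eta_G$. For compact $G$ the map $\eta_G$ is an embedding and $G$ is identified with its image. $\mathbb C[G]$ has a comultiplication $c\colon\mathbb C[G]\to\mathbb C[G]\otimes_{\mathcal W}\mathbb C[G]$ and coidentity $k\colon\mathbb C[G]\to\mathbb C$, the morphisms of weakly complete algebras determined by $c(g)=g\otimes g$ and $k(g)=1$ for $g\in G$ (here $\otimes_{\mathcal W}$ is the tensor product of weakly complete vector spaces, $\mathbb C^I\otimes_{\mathcal W}\mathbb C^J\cong\mathbb C^{I\times J}$). $\mathbb G(\mathbb C[G])$ is the group of grouplike elements, i.e. those $a$ with $c(a)=a\otimes a$ and $k(a)=1$; it contains $G$. *)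

theory Defs
  imports
    "HOL-Analysis.Analysis"
    "HOL-Algebra.Module"
    "HOL-Algebra.Algebraic_Closure_Type"
begin

section \<open>Compact groups\<close>

definition topological_group :: "('g, 'm) monoid_scheme \<Rightarrow> 'g topology \<Rightarrow> bool" where
  "topological_group G T \<longleftrightarrow>
     group G \<and> topspace T = carrier G \<and>
     continuous_map (prod_topology T T) T (\<lambda>(x, y). x \<otimes>\<^bsub>G\<^esub> y) \<and>
     continuous_map T T (\<lambda>x. inv\<^bsub>G\<^esub> x)"

definition compact_group :: "('g, 'm) monoid_scheme \<Rightarrow> 'g topology \<Rightarrow> bool" where
  "compact_group G T \<longleftrightarrow> topological_group G T \<and> compact_space T \<and> Hausdorff_space T"

definition totally_disconnected :: "'x topology \<Rightarrow> bool" where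
  "totally_disconnected T \<longleftrightarrow> (\<forall>C \<in> connected_components_of T. \<exists>x. C = {x})"


section \<open>Weakly complete vector spaces and algebras\<close>

abbreviation complex_field :: "complex ring" where
  "complex_field \<equiv> ring_of_type_algebra"

text \<open>Module records extend ring records. Where such a record stands for a mere vector space,
  its fields \<^term>\<open>monoid.mult\<close> and \<^term>\<open>one\<close> are ignored.\<close>

record 'a topological_module = "(complex, 'a) module" +
  topo :: "'a topology"

definition linear_map ::
    "(complex, 'a, 'm) module_scheme \<Rightarrow> (complex, 'b, 'n) module_scheme \<Rightarrow> ('a \<Rightarrow> 'b) \<Rightarrow> bool" where
  "linear_map V W f \<longleftrightarrow>
     f \<in> carrier V \<rightarrow> carrier W \<and>
     (\<forall>x\<in>carrier V. \<forall>y\<in>carrier V. f (x \<oplus>\<^bsub>V\<^esub> y) = f x \<oplus>\<^bsub>W\<^esub> f y) \<and>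
     (\<forall>a. \<forall>x\<in>carrier V. f (a \<odot>\<^bsub>V\<^esub> x) = a \<odot>\<^bsub>W\<^esub> f x)"

definition bilinear_map ::
    "(complex, 'a, 'm) module_scheme \<Rightarrow> (complex, 'b, 'n) module_scheme \<Rightarrow>
     (complex, 'c, 'k) module_scheme \<Rightarrow> ('a \<times> 'b \<Rightarrow> 'c) \<Rightarrow> bool" where
  "bilinear_map U V W f \<longleftrightarrow>
     (\<forall>x\<in>carrier U. linear_map V W (\<lambda>y. f (x, y))) \<and>
     (\<forall>y\<in>carrier V. linear_map U W (\<lambda>x. f (x, y)))"

definition topological_vector_space :: "'a topological_module \<Rightarrow> bool" where
  "topological_vector_space V \<longleftrightarrow>
     Module.module complex_field V \<and> topspace (topo V) = carrier V \<and>
     continuous_map (prod_topology (topo V) (topo V)) (topo V) (\<lambda>(x, y). x \<oplus>\<^bsub>V\<^esub> y) \<and>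
     continuous_map (prod_topology euclidean (topo V)) (topo V) (\<lambda>(a, x). a \<odot>\<^bsub>V\<^esub> x)"

definition complex_power :: "'j set \<Rightarrow> ('j \<Rightarrow> complex) topological_module" where
  "complex_power J =
     \<lparr>carrier = (\<Pi>\<^sub>E j\<in>J. UNIV), monoid.mult = (\<lambda>x y. \<lambda>j\<in>J. x j * y j), one = (\<lambda>j\<in>J. 1),
      zero = (\<lambda>j\<in>J. 0), add = (\<lambda>x y. \<lambda>j\<in>J. x j + y j),
      smult = (\<lambda>a x. \<lambda>j\<in>J. a * x j),
      topo = product_topology (\<lambda>j. euclidean) J\<rparr>"

text \<open>The unit vectors of the power indexed by \<^term>\<open>J\<close> inject \<^term>\<open>J\<close> into it, so
  every possible index set has a copy inside the type \<^typ>\<open>'a\<close> of the vectors.\<close>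

definition weakly_complete :: "'a topological_module \<Rightarrow> bool" where
  "weakly_complete V \<longleftrightarrow>
     topological_vector_space V \<and>
     (\<exists>(J :: 'a set) f. linear_map V (complex_power J) f \<and>
        homeomorphic_map (topo V) (topo (complex_power J)) f)"

definition weakly_complete_algebra :: "'a topological_module \<Rightarrow> bool" where
  "weakly_complete_algebra A \<longleftrightarrow>
     weakly_complete A \<and> ring A \<and> bilinear_map A A A (\<lambda>(x, y). x \<otimes>\<^bsub>A\<^esub> y) \<and>
     continuous_map (prod_topology (topo A) (topo A)) (topo A) (\<lambda>(x, y). x \<otimes>\<^bsub>A\<^esub> y)"

definition algebra_morphism ::
    "'a topological_module \<Rightarrow> 'b topological_module \<Rightarrow> ('a \<Rightarrow> 'b) \<Rightarrow> bool" where
  "algebra_morphism A B f \<longleftrightarrow>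
     f \<in> ring_hom A B \<and> linear_map A B f \<and> continuous_map (topo A) (topo B) f"

definition complex_algebra :: "complex topological_module" where
  "complex_algebra =
     \<lparr>carrier = UNIV, monoid.mult = (*), one = 1, zero = 0, add = (+), smult = (*),
      topo = euclidean\<rparr>"


section \<open>The weakly complete group algebra\<close>

definition unit_group_morphism ::
    "('g, 'm) monoid_scheme \<Rightarrow> 'g topology \<Rightarrow> 'a topological_module \<Rightarrow> ('g \<Rightarrow> 'a) \<Rightarrow> bool" where
  "unit_group_morphism G T A f \<longleftrightarrow>
     f \<in> hom G (units_of A) \<and> continuous_map T (subtopology (topo A) (Units A)) f"

type_synonym 'g group_algebra_universe = "('g \<Rightarrow> complex) \<Rightarrow> complex"

text \<open>
  A HOL predicate cannot quantify over all types, so the test algebras \<^term>\<open>B\<close> of the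
  universal property range over all weakly complete algebras carried by subsets of one large type.
  This loses nothing: every weakly complete algebra is the projective limit of its
  finite-dimensional quotient algebras, and all finite-dimensional algebras have copies in this
  type. Extensions to the finite-dimensional quotients exist and are unique, hence are compatible,
  and they induce exactly one extension to the limit. So the property below entails the universal
  property for test algebras on arbitrary types. (The type is also large enough to carry the
  group algebra itself: its topological dual embeds into \<^typ>\<open>'g \<Rightarrow> complex\<close> by
  restricting functionals to the group.)
\<close>

definition group_algebra ::
    "('g, 'm) monoid_scheme \<Rightarrow> 'g topology \<Rightarrow> 'a topological_module \<Rightarrow> ('g \<Rightarrow> 'a) \<Rightarrow> bool" where
  "group_algebra G T A \<eta> \<longleftrightarrow>
     weakly_complete_algebra A \<and> unit_group_morphism G T A \<eta> \<and>
     (\<forall>(B :: 'g group_algebra_universe topological_module) f.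
        weakly_complete_algebra B \<and> unit_group_morphism G T B f \<longrightarrow>
        (\<exists>!f'. f' \<in> extensional (carrier A) \<and> algebra_morphism A B f' \<and>
               (\<forall>g\<in>carrier G. f' (\<eta> g) = f g)))"


section \<open>The tensor product of weakly complete algebras\<close>

definition dual_space :: "'a topological_module \<Rightarrow> (complex, 'a \<Rightarrow> complex) module" where
  "dual_space V =
     \<lparr>carrier = {\<phi> \<in> extensional (carrier V).
                  linear_map V complex_algebra \<phi> \<and> continuous_map (topo V) euclidean \<phi>},
      monoid.mult = undefined, one = undefined,
      zero = (\<lambda>x\<in>carrier V. 0),
      add = (\<lambda>\<phi> \<psi>. \<lambda>x\<in>carrier V. \<phi> x + \<psi> x),
      smult = (\<lambda>a \<phi>. \<lambda>x\<in>carrier V. a * \<phi> x)\<rparr>"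

type_synonym ('a, 'b) tensor = "('a \<Rightarrow> complex) \<times> ('b \<Rightarrow> complex) \<Rightarrow> complex"

text \<open>
  By the duality between weakly complete vector spaces and plain vector spaces, the tensor product
  of \<^term>\<open>V\<close> and \<^term>\<open>W\<close> is the full algebraic dual, with the topology of pointwise
  convergence, of the algebraic tensor product of their topological duals; that is, the space of
  all bilinear forms on the product of the duals. For \<^term>\<open>V = complex_power I\<close> and
  \<^term>\<open>W = complex_power J\<close> the topological duals have bases indexed by \<^term>\<open>I\<close> and
  \<^term>\<open>J\<close>, and evaluation at pairs of basis elements identifies it with
  \<^term>\<open>complex_power (I \<times> J)\<close>.
\<close>

definition tensor_space ::
    "'a topological_module \<Rightarrow> 'b topological_module \<Rightarrow> ('a, 'b) tensor topological_module" where
  "tensor_space V W =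
     (let D = carrier (dual_space V) \<times> carrier (dual_space W);
          C = {\<beta> \<in> extensional D. bilinear_map (dual_space V) (dual_space W) complex_algebra \<beta>}
      in \<lparr>carrier = C, monoid.mult = undefined, one = undefined,
          zero = (\<lambda>d\<in>D. 0),
          add = (\<lambda>\<beta> \<gamma>. \<lambda>d\<in>D. \<beta> d + \<gamma> d),
          smult = (\<lambda>a \<beta>. \<lambda>d\<in>D. a * \<beta> d),
          topo = subtopology (product_topology (\<lambda>d. euclidean) D) C\<rparr>)"

definition elementary_tensor ::
    "'a topological_module \<Rightarrow> 'b topological_module \<Rightarrow> 'a \<Rightarrow> 'b \<Rightarrow> ('a, 'b) tensor" where
  "elementary_tensor V W v w =
     (\<lambda>(\<phi>, \<psi>) \<in> carrier (dual_space V) \<times> carrier (dual_space W). \<phi> v * \<psi> w)"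

text \<open>The elementary tensors span a dense subspace, so there is at most one continuous bilinear
  multiplication with the prescribed values on them; in coordinates it is seen to exist.\<close>

definition tensor_mult ::
    "'a topological_module \<Rightarrow> 'b topological_module \<Rightarrow>
     ('a, 'b) tensor \<times> ('a, 'b) tensor \<Rightarrow> ('a, 'b) tensor" where
  "tensor_mult A B =
     (let S = tensor_space A B in
      THE m. m \<in> extensional (carrier S \<times> carrier S) \<and> bilinear_map S S S m \<and>
        continuous_map (prod_topology (topo S) (topo S)) (topo S) m \<and>
        (\<forall>a\<in>carrier A. \<forall>a'\<in>carrier A. \<forall>b\<in>carrier B. \<forall>b'\<in>carrier B.
           m (elementary_tensor A B a b, elementary_tensor A B a' b') =
           elementary_tensor A B (a \<otimes>\<^bsub>A\<^esub> a') (b \<otimes>\<^bsub>B\<^esub> b')))"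

definition tensor_algebra ::
    "'a topological_module \<Rightarrow> 'b topological_module \<Rightarrow> ('a, 'b) tensor topological_module" where
  "tensor_algebra A B =
     (tensor_space A B)
       \<lparr>monoid.mult := (\<lambda>s t. tensor_mult A B (s, t)),
        one := elementary_tensor A B \<one>\<^bsub>A\<^esub> \<one>\<^bsub>B\<^esub>\<rparr>"


section \<open>Grouplike elements\<close>

definition comultiplication ::
    "('g, 'm) monoid_scheme \<Rightarrow> 'a topological_module \<Rightarrow> ('g \<Rightarrow> 'a) \<Rightarrow> ('a \<Rightarrow> ('a, 'a) tensor) \<Rightarrow> bool"
  where
  "comultiplication G A \<eta> c \<longleftrightarrow>
     algebra_morphism A (tensor_algebra A A) c \<and>
     (\<forall>g\<in>carrier G. c (\<eta> g) = elementary_tensor A A (\<eta> g) (\<eta> g))"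

definition coidentity ::
    "('g, 'm) monoid_scheme \<Rightarrow> 'a topological_module \<Rightarrow> ('g \<Rightarrow> 'a) \<Rightarrow> ('a \<Rightarrow> complex) \<Rightarrow> bool" where
  "coidentity G A \<eta> k \<longleftrightarrow>
     algebra_morphism A complex_algebra k \<and> (\<forall>g\<in>carrier G. k (\<eta> g) = 1)"

definition grouplikes ::
    "'a topological_module \<Rightarrow> ('a \<Rightarrow> ('a, 'a) tensor) \<Rightarrow> ('a \<Rightarrow> complex) \<Rightarrow> 'a set" where
  "grouplikes A c k = {a \<in> carrier A. c a = elementary_tensor A A a a \<and> k a = 1}"

end

theory Submission
  imports Defs
begin

text \<open>
  The topological dual of \<^term>\<open>A\<close>, restricted to \<^term>\<open>G\<close>, consists of the linear combinations of
  continuous characters: a functional is a matrix coefficient of a finite-dimensional representation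
  of \<^term>\<open>A\<close>, and the Fourier coefficients of such a representation are pairwise orthogonal
  idempotents. Hence the grouplike elements correspond to the homomorphisms from the character group
  to the nonzero complex numbers, and the elements of \<^term>\<open>G\<close> give unitary ones.

  If \<^term>\<open>G\<close> is totally disconnected, characters have finite order. For a grouplike element
  and finitely many characters, products of sums of roots of unity give a functional that is nonzero
  at the element but vanishes at every point of \<^term>\<open>G\<close> where one of the characters has a different
  value, so there is a point where all the values agree. Compactness yields one point for all characters.

  If \<^term>\<open>G\<close> is not totally disconnected, a character separating two points of a connected set has
  infinite order, and divisibility of the reals gives a nonzero homomorphism from the character group
  to the reals. Its exponential comes from a grouplike element outside \<^term>\<open>G\<close>.

  That the characters separate points is proved without Haar measure: a finitely additive invariant
  mean defines convolution operators and an inner product on the continuous functions, and extreme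
  normalised positive definite functions in an eigenspace of a compact convolution operator are characters.
\<close>

section \<open>Invariant means\<close>

text \<open>The universal property speaks of algebra morphisms, while the dual of \<open>A\<close>
  consists of mere functionals. Matrix representations bridge the gap: they are morphisms into
  matrix algebras, so two of them that agree on \<open>G\<close> agree on \<open>A\<close>. This is
  how identities between functionals pass from \<open>G\<close> to \<open>A\<close>. Then
  \<open>k\<close> and the functionals \<open>\<lambda>a. c a (\<phi>, \<psi>)\<close> are known
  from their restrictions to \<open>G\<close>, the constant 1 and pointwise products, and being
  grouplike means being multiplicative on characters.

  An invariant mean is only finitely additive, and the continuous functions with its inner product
  need not be complete. Compactness of \<open>G\<close> replaces what is missing. A continuous
  function of two variables is uniformly close to one that sees its first argument only through
  finitely many points, which gives Fubini. Eigenfunctions arise as minimisers on equicontinuous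
  families, compact by Tychonoff, instead of in a Hilbert space.

  Since the characters form a basis of the dual, every function on the set of characters is given by
  an element of \<open>A\<close>; nonunitary homomorphisms therefore do come from elements.\<close>

locale mean =
  fixes S :: "'g set" and m :: "('g \<Rightarrow> complex) \<Rightarrow> complex"
  assumes add: "bounded (f ` S) \<Longrightarrow> bounded (h ` S) \<Longrightarrow> m (\<lambda>x. f x + h x) = m f + m h"
    and scale: "bounded (f ` S) \<Longrightarrow> m (\<lambda>x. c * f x) = c * m f"
    and Re_nonneg: "bounded (f ` S) \<Longrightarrow> (\<And>x. x \<in> S \<Longrightarrow> 0 \<le> Re (f x)) \<Longrightarrow> 0 \<le> Re (m f)"
    and one: "m (\<lambda>x. 1) = 1"

lemma bounded_image_iff: "bounded (f ` S) \<longleftrightarrow> (\<exists>B. \<forall>x\<in>S. norm (f x) \<le> B)"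
  by (auto simp: bounded_iff)

lemma bounded_image_const [intro, simp]: "bounded ((\<lambda>x. c) ` S)"
  by (rule bounded_subset[of "{c}"]) auto

lemma bounded_image_scale [intro]:
  fixes f :: "'a \<Rightarrow> 'b::real_normed_algebra"
  assumes "bounded (f ` S)" shows "bounded ((\<lambda>x. c * f x) ` S)"
proof -
  obtain B where "\<And>x. x \<in> S \<Longrightarrow> norm (f x) \<le> B"
    using assms unfolding bounded_image_iff by meson
  then have "norm (c * f x) \<le> norm c * B" if "x \<in> S" for x
    using that by (meson mult_left_mono norm_ge_zero norm_mult_ineq order_trans)
  then show ?thesis unfolding bounded_image_iff by blast
qed

lemma bounded_image_add [intro]:
  fixes f h :: "'a \<Rightarrow> 'b::real_normed_vector"
  assumes "bounded (f ` S)" "bounded (h ` S)" shows "bounded ((\<lambda>x. f x + h x) ` S)"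
  using assms by (rule bounded_plus_comp)

lemma bounded_image_minus [intro]:
  fixes f h :: "'a \<Rightarrow> 'b::real_normed_vector"
  assumes "bounded (f ` S)" "bounded (h ` S)" shows "bounded ((\<lambda>x. f x - h x) ` S)"
  using assms by (rule bounded_minus_comp)

lemma bounded_image_mult [intro]:
  fixes f h :: "'a \<Rightarrow> 'b::real_normed_algebra"
  assumes "bounded (f ` S)" "bounded (h ` S)" shows "bounded ((\<lambda>x. f x * h x) ` S)"
proof -
  obtain B C where "\<And>x. x \<in> S \<Longrightarrow> norm (f x) \<le> B" "\<And>x. x \<in> S \<Longrightarrow> norm (h x) \<le> C"
    using assms unfolding bounded_image_iff by meson
  then have "norm (f x * h x) \<le> B * C" if "x \<in> S" for x
    using that by (metis mult_mono norm_ge_zero norm_mult_ineq order_trans)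
  then show ?thesis unfolding bounded_image_iff by blast
qed

lemma bounded_image_Re [intro]:
  "bounded (f ` S) \<Longrightarrow> bounded ((\<lambda>x. complex_of_real (Re (f x))) ` S)"
  unfolding bounded_image_iff by (metis abs_Re_le_cmod norm_of_real order_trans)

lemma bounded_image_Im [intro]:
  "bounded (f ` S) \<Longrightarrow> bounded ((\<lambda>x. complex_of_real (Im (f x))) ` S)"
  unfolding bounded_image_iff by (metis abs_Im_le_cmod norm_of_real order_trans)

lemma bounded_image_norm [intro]:
  "bounded (f ` S) \<Longrightarrow> bounded ((\<lambda>x. complex_of_real (norm (f x))) ` S)"
  unfolding bounded_image_iff by simp

lemma bounded_image_sum [intro]:
  fixes f :: "'i \<Rightarrow> 'a \<Rightarrow> 'b::real_normed_vector"
  assumes "\<And>i. i \<in> I \<Longrightarrow> bounded (f i ` S)"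
  shows "bounded ((\<lambda>x. \<Sum>i\<in>I. f i x) ` S)"
  using assms by (induction I rule: infinite_finite_induct) auto

context mean
begin

lemma diff:
  assumes "bounded (f ` S)" "bounded (h ` S)" shows "m (\<lambda>x. f x - h x) = m f - m h"
proof -
  have "m (\<lambda>x. f x + (-1) * h x) = m f + (-1) * m h"
    using assms by (subst add) (auto simp only: scale)
  then show ?thesis by simp
qed

lemma const [simp]: "m (\<lambda>x. c) = c"
  using scale[of "\<lambda>x. 1" c] one by simp

lemma Re_mono:
  assumes "bounded (f ` S)" "bounded (h ` S)" "\<And>x. x \<in> S \<Longrightarrow> Re (f x) \<le> Re (h x)"
  shows "Re (m f) \<le> Re (m h)"
proof -
  have "0 \<le> Re (m (\<lambda>x. h x - f x))"
    using assms by (intro Re_nonneg) auto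
  then show ?thesis using assms by (simp add: diff)
qed

text \<open>A unimodular factor \<open>c\<close> rotates \<open>m f\<close> to its modulus, and then
  positivity, which only speaks of real parts, gives the bound.\<close>

lemma norm_le_mean:
  assumes bf: "bounded (f ` S)" and "bounded ((\<lambda>x. complex_of_real (g x)) ` S)"
    and le: "\<And>x. x \<in> S \<Longrightarrow> norm (f x) \<le> g x"
  shows "norm (m f) \<le> Re (m (\<lambda>x. complex_of_real (g x)))"
proof -
  obtain c where c: "norm c = 1" "c * m f = norm (m f)"
  proof (cases "m f = 0")
    case True then show ?thesis using that[of 1] by simp
  next
    case False
    let ?c = "cnj (m f) / norm (m f)"
    have "?c * m f = (norm (m f))\<^sup>2 / norm (m f)"
      using complex_norm_square[of "m f"] by (simp add: mult.commute)
    then show ?thesis using that[of ?c] False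
      by (simp add: norm_divide power2_eq_square)
  qed
  have "Re (m (\<lambda>x. c * f x)) \<le> Re (m (\<lambda>x. complex_of_real (g x)))"
  proof (rule Re_mono)
    show "bounded ((\<lambda>x. c * f x) ` S)" using bf by auto
    fix x assume "x \<in> S"
    then have "norm (c * f x) \<le> g x" using le c by (simp add: norm_mult)
    then show "Re (c * f x) \<le> Re (complex_of_real (g x))"
      using complex_Re_le_cmod[of "c * f x"] by simp
  qed (rule assms)
  then show ?thesis using bf c by (simp add: scale)
qed

lemma norm_le:
  assumes "\<And>x. x \<in> S \<Longrightarrow> norm (f x) \<le> B"
  shows "norm (m f) \<le> B"
proof -
  have "bounded (f ` S)" using assms unfolding bounded_image_iff by blast
  from norm_le_mean[OF this, of "\<lambda>x. B"] assms show ?thesis by simp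
qed

text \<open>The axioms do not say that \<open>m\<close> ignores values outside \<open>S\<close>; the
  norm bound 0 for the difference forces it.\<close>

lemma cong:
  assumes "\<And>x. x \<in> S \<Longrightarrow> f x = h x" "bounded (f ` S)"
  shows "m f = m h"
proof -
  have bh: "bounded (h ` S)" using assms unfolding bounded_image_iff by simp
  have "norm (m (\<lambda>x. f x - h x)) \<le> 0"
    by (rule norm_le) (simp add: assms)
  then show ?thesis using diff[OF assms(2) bh] by simp
qed

lemma norm_diff_le:
  assumes "bounded (f ` S)" "bounded (h ` S)" "\<And>x. x \<in> S \<Longrightarrow> norm (f x - h x) \<le> B"
  shows "norm (m f - m h) \<le> B"
  using norm_le[of "\<lambda>x. f x - h x" B] assms by (simp add: diff)

text \<open>Positivity is applied to \<open>f\<close> times \<open>\<i>\<close> and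
  \<open>-\<i>\<close>, whose real parts vanish on \<open>S\<close>.\<close>

lemma real_valued:
  assumes "bounded (f ` S)" "\<And>x. x \<in> S \<Longrightarrow> Im (f x) = 0"
  shows "Im (m f) = 0"
proof -
  have "0 \<le> Re (m (\<lambda>x. \<i> * f x))" "0 \<le> Re (m (\<lambda>x. (-\<i>) * f x))"
    using assms by (auto intro!: Re_nonneg)
  then show ?thesis using assms(1) by (simp only: scale) simp
qed

lemma cnj:
  assumes "bounded (f ` S)"
  shows "m (\<lambda>x. cnj (f x)) = cnj (m f)"
proof -
  let ?r = "\<lambda>x. complex_of_real (Re (f x))" and ?i = "\<lambda>x. complex_of_real (Im (f x))"
  have b: "bounded (?r ` S)" "bounded (?i ` S)" using assms by auto
  have "m (\<lambda>x. ?r x + \<i> * ?i x) = m ?r + \<i> * m ?i"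
    using b by (subst add) (auto simp only: scale)
  moreover have "m (\<lambda>x. ?r x + (-\<i>) * ?i x) = m ?r + (-\<i>) * m ?i"
    using b by (subst add) (auto simp only: scale)
  moreover have "(\<lambda>x. ?r x + \<i> * ?i x) = f" by (simp add: complex_eq flip: complex_eq)
  moreover have "(\<lambda>x. ?r x + (-\<i>) * ?i x) = (\<lambda>x. cnj (f x))" by (auto simp: complex_eq_iff)
  moreover have "Im (m ?r) = 0" "Im (m ?i) = 0" using b by (auto intro: real_valued)
  ultimately show ?thesis by (simp add: complex_eq_iff)
qed

lemma scale_right: "bounded (f ` S) \<Longrightarrow> m (\<lambda>x. f x * c) = m f * c"
  using scale[of f c] by (simp add: mult.commute)

lemma sum:
  assumes "\<And>i. i \<in> I \<Longrightarrow> bounded (f i ` S)"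
  shows "m (\<lambda>x. \<Sum>i\<in>I. f i x) = (\<Sum>i\<in>I. m (f i))"
  using assms
proof (induction I rule: infinite_finite_induct)
  case (insert i I)
  then have "m (\<lambda>x. f i x + (\<Sum>i\<in>I. f i x)) = m (f i) + m (\<lambda>x. \<Sum>i\<in>I. f i x)"
    by (intro add) auto
  with insert show ?case by simp
qed auto

end

text \<open>Induction on \<open>F\<close>. Averaging \<open>m\<close> over translations by the first
  \<open>n\<close> powers of the new element \<open>g\<close> makes it almost invariant under
  \<open>g\<close> by telescoping. Commutativity lets the averaging commute with the translations
  from \<open>F\<close>, so the invariance already obtained survives.\<close>

lemma (in comm_group) ex_almost_invariant_mean:
  fixes e :: real
  assumes "finite F" "F \<subseteq> carrier G" "e > 0"
  shows "\<exists>m. mean (carrier G) m \<and> (\<forall>f B. (\<forall>x\<in>carrier G. norm (f x) \<le> B) \<longrightarrow>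
           (\<forall>a\<in>F. norm (m (\<lambda>x. f (a \<otimes> x)) - m f) \<le> e * B))"
  using assms
proof (induction F rule: finite_induct)
  case empty
  have "mean (carrier G) (\<lambda>f. f \<one>)" by unfold_locales auto
  then show ?case by blast
next
  case (insert g F)
  then have g: "g \<in> carrier G" by auto
  have "F \<subseteq> carrier G" using insert by simp
  from insert.IH[OF this \<open>e > 0\<close>] obtain m where m: "mean (carrier G) m" and
    inv: "\<And>f B a. (\<And>x. x \<in> carrier G \<Longrightarrow> norm (f x) \<le> B) \<Longrightarrow> a \<in> F \<Longrightarrow>
            norm (m (\<lambda>x. f (a \<otimes> x)) - m f) \<le> e * B"
    by metis
  interpret m: mean "carrier G" m by (rule m)
  \<comment> \<open>Telescoping leaves two terms of norm at most \<open>B\<close>, divided by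
    \<open>n\<close>; hence the constant 2.\<close>
  obtain n :: nat where n: "n > 0" "2 / n \<le> e"
  proof -
    obtain n :: nat where "2 / e < n" using reals_Archimedean2 by blast
    with \<open>e > 0\<close> have "n > 0" "2 / n \<le> e"
      by (auto intro: gr0I) (simp add: divide_less_eq divide_le_eq mult.commute)
    then show ?thesis using that by blast
  qed
  define tr where "tr = (\<lambda>k f x. f (g [^] (k::nat) \<otimes> x) :: complex)"
  define m' where "m' = (\<lambda>f. (\<Sum>k<n. m (tr k f)) / n)"
  have btr: "bounded (tr k f ` carrier G)" if "bounded (f ` carrier G)" for k f
    using that g unfolding bounded_image_iff tr_def by (meson m_closed nat_pow_closed)
  have "mean (carrier G) m'"
  proof
    fix f h :: "'a \<Rightarrow> complex"
    assume "bounded (f ` carrier G)" "bounded (h ` carrier G)"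
    then have "m (tr k (\<lambda>x. f x + h x)) = m (tr k f) + m (tr k h)" for k
      using m.add[OF btr btr] by (simp add: tr_def)
    then show "m' (\<lambda>x. f x + h x) = m' f + m' h"
      by (simp add: m'_def sum.distrib add_divide_distrib)
  next
    fix f :: "'a \<Rightarrow> complex" and c
    assume "bounded (f ` carrier G)"
    then have "m (tr k (\<lambda>x. c * f x)) = c * m (tr k f)" for k
      using m.scale[OF btr] by (simp add: tr_def)
    then show "m' (\<lambda>x. c * f x) = c * m' f"
      by (simp add: m'_def sum_distrib_left)
  next
    fix f :: "'a \<Rightarrow> complex"
    assume b: "bounded (f ` carrier G)" and "\<And>x. x \<in> carrier G \<Longrightarrow> 0 \<le> Re (f x)"
    then have "0 \<le> Re (m (tr k f))" for k
      using g by (intro m.Re_nonneg btr) (auto simp: tr_def)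
    then show "0 \<le> Re (m' f)"
      by (simp add: m'_def sum_nonneg)
  next
    show "m' (\<lambda>x. 1) = 1" using n by (simp add: m'_def tr_def)
  qed
  moreover have "norm (m' (\<lambda>x. f (a \<otimes> x)) - m' f) \<le> e * B"
    if B: "\<And>x. x \<in> carrier G \<Longrightarrow> norm (f x) \<le> B" and a: "a \<in> insert g F" for f B a
  proof (cases "a \<in> F")
    case True
    then have aG: "a \<in> carrier G" using insert by auto
    have "norm (m (tr k (\<lambda>x. f (a \<otimes> x))) - m (tr k f)) \<le> e * B" for k
    proof -
      have "m (tr k (\<lambda>x. f (a \<otimes> x))) = m (\<lambda>x. tr k f (a \<otimes> x))"
      proof (rule m.cong)
        fix x assume "x \<in> carrier G"
        then show "tr k (\<lambda>x. f (a \<otimes> x)) x = tr k f (a \<otimes> x)"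
          using g aG by (simp add: tr_def m_lcomm)
      next
        have "bounded ((\<lambda>x. f (a \<otimes> x)) ` carrier G)"
          using B aG unfolding bounded_image_iff by (meson m_closed)
        then show "bounded (tr k (\<lambda>x. f (a \<otimes> x)) ` carrier G)" by (rule btr)
      qed
      moreover have "norm (m (\<lambda>x. tr k f (a \<otimes> x)) - m (tr k f)) \<le> e * B"
        using True B g by (intro inv) (auto simp: tr_def)
      ultimately show ?thesis by simp
    qed
    then have "norm (\<Sum>k<n. m (tr k (\<lambda>x. f (a \<otimes> x))) - m (tr k f)) \<le> n * (e * B)"
      using sum_norm_bound[of "{..<n}" "\<lambda>k. m (tr k (\<lambda>x. f (a \<otimes> x))) - m (tr k f)" "e * B"] by simp
    then show ?thesis using n
      by (simp add: m'_def sum_subtractf norm_divide divide_le_eq mult_ac flip: diff_divide_distrib)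
  next
    case False
    then have "a = g" using a by auto
    have bf: "bounded (f ` carrier G)" using B unfolding bounded_image_iff by blast
    have "m (tr k (\<lambda>x. f (g \<otimes> x))) = m (tr (Suc k) f)" for k
    proof (rule m.cong)
      have "bounded ((\<lambda>x. f (g \<otimes> x)) ` carrier G)"
        using B g unfolding bounded_image_iff by (meson m_closed)
      then show "bounded (tr k (\<lambda>x. f (g \<otimes> x)) ` carrier G)" by (rule btr)
      fix x assume "x \<in> carrier G"
      then show "tr k (\<lambda>x. f (g \<otimes> x)) x = tr (Suc k) f x"
        using g by (simp add: tr_def m_ac)
    qed
    then have "m' (\<lambda>x. f (a \<otimes> x)) - m' f = (\<Sum>k<n. m (tr (Suc k) f) - m (tr k f)) / n"
      by (simp add: m'_def sum_subtractf \<open>a = g\<close> diff_divide_distrib)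
    also have "\<dots> = (m (tr n f) - m (tr 0 f)) / n"
      using sum_lessThan_telescope[of "\<lambda>k. m (tr k f)" n] by simp
    finally have "norm (m' (\<lambda>x. f (a \<otimes> x)) - m' f) = norm (m (tr n f) - m (tr 0 f)) / n"
      by (simp add: norm_divide)
    moreover have "norm (m (tr k f)) \<le> B" for k
      using B g by (intro m.norm_le) (auto simp: tr_def)
    then have "norm (m (tr n f) - m (tr 0 f)) \<le> B + B"
      by (intro order_trans[OF norm_triangle_ineq4] add_mono) auto
    ultimately have "norm (m' (\<lambda>x. f (a \<otimes> x)) - m' f) \<le> (B + B) / n"
      using n by (simp add: divide_right_mono)
    also have "\<dots> = 2 / n * B" by simp
    also have "\<dots> \<le> e * B"
    proof (rule mult_right_mono)
      show "0 \<le> B" using B[OF one_closed] norm_ge_zero order_trans by blast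
    qed (use n in auto)
    finally show ?thesis .
  qed
  ultimately show ?case by blast
qed

section \<open>Existence of an invariant mean by Tychonoff\<close>

lemma compact_product_sets:
  fixes K :: "'i \<Rightarrow> 'b::topological_space set"
  assumes "\<And>i. compact (K i)"
  shows "compact {f. \<forall>i. f i \<in> K i}"
proof -
  have "compactin (product_topology (\<lambda>i. euclidean) UNIV) (Pi\<^sub>E UNIV K)"
    using assms by (simp add: compactin_PiE)
  then show ?thesis
    by (simp add: euclidean_product_topology PiE_UNIV_domain Pi_def)
qed

text \<open>Each instance of an axiom involves only finitely many values of \<open>m\<close>, so it
  survives pointwise limits.\<close>

lemma closed_mean: "closed {m. mean S m}"
proof -
  have "{m. mean S m} =
      {m. \<forall>f h. bounded (f ` S) \<and> bounded (h ` S) \<longrightarrow> m (\<lambda>x. f x + h x) = m f + m h} \<inter>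
      {m. \<forall>f c. bounded (f ` S) \<longrightarrow> m (\<lambda>x. c * f x) = c * m f} \<inter>
      {m. \<forall>f. bounded (f ` S) \<and> (\<forall>x\<in>S. 0 \<le> Re (f x)) \<longrightarrow> 0 \<le> Re (m f)} \<inter>
      {m. m (\<lambda>x. 1) = 1}"
    by (auto simp: mean_def)
  moreover have "closed \<dots>"
    by (intro closed_Int closed_Collect_all closed_Collect_imp closed_Collect_eq closed_Collect_le
        open_Collect_const continuous_intros continuous_on_product_coordinates)
  ultimately show ?thesis by simp
qed

text \<open>The set \<open>C (a, e)\<close> of means invariant under \<open>a\<close> up to
  \<open>e\<close> is closed, and finitely many of these sets meet by the averaging lemma for the
  least \<open>e\<close>. A common point in the compact product \<open>Q\<close> of discs is
  invariant because \<open>e\<close> is arbitrary.\<close>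

theorem (in comm_group) ex_invariant_mean:
  "\<exists>m. mean (carrier G) m \<and>
     (\<forall>f a. bounded (f ` carrier G) \<longrightarrow> a \<in> carrier G \<longrightarrow> m (\<lambda>x. f (a \<otimes> x)) = m f)"
proof -
  let ?bd = "\<lambda>f. bounded (f ` carrier G)"
  define bnd :: "('a \<Rightarrow> complex) \<Rightarrow> real" where
    "bnd = (\<lambda>f. if ?bd f then (SUP x\<in>carrier G. norm (f x)) else 0)"
  have bnd: "norm (f x) \<le> bnd f" if "?bd f" "x \<in> carrier G" for f x
    using that unfolding bnd_def
    by (auto intro!: cSUP_upper simp: bounded_image_iff bdd_above_def)
  define Q where "Q = {m. \<forall>f. m f \<in> cball (0::complex) (bnd f)}"
  have Q: "compact Q" unfolding Q_def by (rule compact_product_sets) simp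
  define C where "C = (\<lambda>(a, e). {m. mean (carrier G) m \<and> (\<forall>f B. (\<forall>x\<in>carrier G. norm (f x) \<le> B) \<longrightarrow>
           norm (m (\<lambda>x. f (a \<otimes> x)) - m f) \<le> e * B)})"
  have "Q \<inter> (\<Inter>p\<in>carrier G \<times> {0<..}. C p) \<noteq> {}"
  proof (rule compact_imp_fip_image[OF Q])
    fix p :: "'a \<times> real"
    obtain a e where p: "p = (a, e)" by (cases p)
    have "closed ({m. mean (carrier G) m} \<inter> {m. \<forall>f B. (\<forall>x\<in>carrier G. norm (f x) \<le> B) \<longrightarrow>
           norm (m (\<lambda>x. f (a \<otimes> x)) - m f) \<le> e * B})"
      by (intro closed_Int closed_mean closed_Collect_all closed_Collect_imp closed_Collect_le
        open_Collect_const continuous_intros continuous_on_product_coordinates)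
    then show "closed (C p)" by (simp add: C_def p Collect_conj_eq)
  next
    fix P :: "('a \<times> real) set" assume P: "finite P" "P \<subseteq> carrier G \<times> {0<..}"
    \<comment> \<open>The 1 covers the empty \<open>P\<close>.\<close>
    define e where "e = Min (insert 1 (snd ` P))"
    have e: "e > 0" "\<And>p. p \<in> P \<Longrightarrow> e \<le> snd p"
      unfolding e_def using P by (auto simp: Min_gr_iff intro!: Min_le image_eqI)
    have "finite (fst ` P)" "fst ` P \<subseteq> carrier G" using P by auto
    from ex_almost_invariant_mean[OF this e(1)]
    obtain m where m: "mean (carrier G) m" and inv: "\<And>f B a. (\<forall>x\<in>carrier G. norm (f x) \<le> B) \<Longrightarrow>
           a \<in> fst ` P \<Longrightarrow> norm (m (\<lambda>x. f (a \<otimes> x)) - m f) \<le> e * B"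
      by metis
    interpret m: mean "carrier G" m by (rule m)
    \<comment> \<open>The axioms leave the values at unbounded functions free; the value 0 there
      puts the mean into \<open>Q\<close>.\<close>
    define m' where "m' = (\<lambda>f. if ?bd f then m f else 0)"
    have m': "m' f = m f" if "?bd f" for f using that by (simp add: m'_def)
    have "mean (carrier G) m'"
      by unfold_locales (auto simp: m' m.add m.scale bounded_image_add bounded_image_mult intro!: m.Re_nonneg)
    moreover have "m' \<in> Q"
    proof -
      have "norm (m' f) \<le> bnd f" for f
        using bnd m.norm_le[of f] by (auto simp: m'_def bnd_def)
      then show ?thesis by (simp add: Q_def)
    qed
    moreover have "norm (m' (\<lambda>x. f (a \<otimes> x)) - m' f) \<le> d * B"
      if p: "(a, d) \<in> P" and B: "\<forall>x\<in>carrier G. norm (f x) \<le> B" for a d f B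
    proof -
      have a: "a \<in> carrier G" "a \<in> fst ` P" using p P by force+
      have "norm (m (\<lambda>x. f (a \<otimes> x)) - m f) \<le> e * B" by (rule inv[OF B a(2)])
      moreover have "?bd f" "?bd (\<lambda>x. f (a \<otimes> x))"
        using B a unfolding bounded_image_iff by (meson m_closed)+
      moreover have "0 \<le> B" using B one_closed norm_ge_zero order_trans by metis
      ultimately show ?thesis using e(2)[OF p] mult_right_mono[of e d B] by (simp add: m')
    qed
    ultimately have "m' \<in> Q \<inter> (\<Inter>p\<in>P. C p)" by (auto simp: C_def)
    then show "Q \<inter> (\<Inter>p\<in>P. C p) \<noteq> {}" by blast
  qed
  then obtain m where m: "\<And>a e. a \<in> carrier G \<Longrightarrow> e > 0 \<Longrightarrow> m \<in> C (a, e)" by fastforce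
  have "mean (carrier G) m" using m[OF one_closed, of 1] by (simp add: C_def)
  moreover have "m (\<lambda>x. f (a \<otimes> x)) = m f" if bf: "?bd f" and a: "a \<in> carrier G" for f a
  proof -
    \<comment> \<open>The summand 1 keeps the factor positive, so that \<open>e\<close> can be
      chosen as a quotient by it.\<close>
    have le: "norm (m (\<lambda>x. f (a \<otimes> x)) - m f) \<le> e * (bnd f + 1)" if "e > 0" for e
    proof -
      have "\<forall>x\<in>carrier G. norm (f x) \<le> bnd f + 1"
        using bnd[OF bf] by (simp add: add_increasing2)
      then show ?thesis using m[OF a that] by (simp add: C_def)
    qed
    have "0 \<le> bnd f" using bnd[OF bf one_closed] norm_ge_zero order_trans by blast
    then have "norm (m (\<lambda>x. f (a \<otimes> x)) - m f) \<le> 0 + d" if "d > 0" for d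
      using le[of "d / (bnd f + 1)"] that by simp
    then have "norm (m (\<lambda>x. f (a \<otimes> x)) - m f) \<le> 0" by (rule field_le_epsilon)
    then show ?thesis by simp
  qed
  ultimately show ?thesis by blast
qed

section \<open>Harmonic analysis on a compact abelian group\<close>

lemma continuous_map_euclideanI:
  fixes f :: "'a \<Rightarrow> 'b::metric_space"
  assumes "\<And>x e. x \<in> topspace Z \<Longrightarrow> e > 0 \<Longrightarrow> \<exists>U. openin Z U \<and> x \<in> U \<and> (\<forall>y\<in>U. dist (f y) (f x) < e)"
  shows "continuous_map Z euclidean f"
proof -
  have "\<exists>U. openin Z U \<and> x \<in> U \<and> (\<forall>y\<in>U. f y \<in> V)"
    if "open V" and x: "x \<in> topspace Z" "f x \<in> V" for x V
  proof -
    obtain e where "e > 0" "\<forall>z. dist z (f x) < e \<longrightarrow> z \<in> V"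
      using \<open>open V\<close> x(2) unfolding open_dist by metis
    then show ?thesis using assms[OF x(1), of e] by metis
  qed
  then show ?thesis by (simp add: continuous_map_eq_topcontinuous_at topcontinuous_at_def)
qed

lemma continuous_map_open_ball:
  fixes f :: "'a \<Rightarrow> 'b::metric_space"
  assumes "continuous_map Z euclidean f"
  shows "openin Z {x \<in> topspace Z. dist (f x) c < e}"
proof -
  have "openin Z {x \<in> topspace Z. f x \<in> ball c e}"
    by (rule openin_continuous_map_preimage[OF assms]) simp
  then show ?thesis by (simp add: dist_commute)
qed

lemma continuous_map_mult_complex:
  fixes f h :: "'a \<Rightarrow> complex"
  assumes "continuous_map Z euclidean f" "continuous_map Z euclidean h"
  shows "continuous_map Z euclidean (\<lambda>x. f x * h x)"
  using assms by (simp add: continuous_map_atin tendsto_mult)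

lemma continuous_map_comp_euclidean:
  fixes f :: "'a \<Rightarrow> 'b::topological_space" and h :: "'b \<Rightarrow> 'c::topological_space"
  assumes "continuous_map Z euclidean f" "continuous_on UNIV h"
  shows "continuous_map Z euclidean (\<lambda>x. h (f x))"
  using continuous_map_compose[OF assms(1), of euclidean h] assms(2) by (simp add: o_def)

lemma continuous_map_cnj:
  "continuous_map Z euclidean f \<Longrightarrow> continuous_map Z euclidean (\<lambda>x. cnj (f x))"
  by (erule continuous_map_comp_euclidean) (intro continuous_intros)

locale compact_comm_group = comm_group G for G :: "('g, 'm) monoid_scheme" (structure) +
  fixes T :: "'g topology"
  assumes compact_group: "compact_group G T"
begin

abbreviation cont :: "('g \<Rightarrow> complex) \<Rightarrow> bool" where
  "cont f \<equiv> continuous_map T euclidean f"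

abbreviation cont2 :: "('g \<Rightarrow> 'g \<Rightarrow> complex) \<Rightarrow> bool" where
  "cont2 F \<equiv> continuous_map (prod_topology T T) euclidean (\<lambda>p. F (fst p) (snd p))"

lemma topspace [simp]: "topspace T = carrier G"
  and compact: "compact_space T" and Hausdorff: "Hausdorff_space T"
  using compact_group by (auto simp: compact_group_def topological_group_def)

lemma finite_subcover:
  assumes "\<And>x. x \<in> carrier G \<Longrightarrow> openin T (U x)" "carrier G \<subseteq> \<Union>(U ` carrier G)"
  shows "\<exists>D. finite D \<and> D \<subseteq> carrier G \<and> carrier G \<subseteq> \<Union>(U ` D)"
proof -
  have "\<exists>\<F>. finite \<F> \<and> \<F> \<subseteq> U ` carrier G \<and> carrier G \<subseteq> \<Union>\<F>"
    using compact assms unfolding compact_space_alt topspace by (metis (no_types, lifting) imageE)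
  then show ?thesis by (metis finite_subset_image)
qed

lemma continuous_map_times:
  assumes "continuous_map Z T f" "continuous_map Z T h"
  shows "continuous_map Z T (\<lambda>x. f x \<otimes> h x)"
proof -
  have "continuous_map (prod_topology T T) T (\<lambda>(x, y). x \<otimes> y)"
    using compact_group by (auto simp: compact_group_def topological_group_def)
  from continuous_map_compose[OF continuous_map_pairedI[OF assms] this]
  show ?thesis by (simp add: o_def)
qed

lemma continuous_map_inverse:
  assumes "continuous_map Z T f" shows "continuous_map Z T (\<lambda>x. inv (f x))"
proof -
  have "continuous_map T T (\<lambda>x. inv x)"
    using compact_group by (auto simp: compact_group_def topological_group_def)
  from continuous_map_compose[OF assms this] show ?thesis by (simp add: o_def)
qed

lemma cont_comp: "cont u \<Longrightarrow> continuous_map Z T f \<Longrightarrow> continuous_map Z euclidean (\<lambda>x. u (f x))"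
  using continuous_map_compose[of Z T f euclidean u] by (simp add: o_def)

lemma continuous_map_ident: "continuous_map T T (\<lambda>x. x)"
  using continuous_map_id[of T] by (simp add: id_def)

lemma continuous_map_point: "a \<in> carrier G \<Longrightarrow> continuous_map Z T (\<lambda>x. a)"
  by simp

lemmas ctsI = continuous_map_mult_complex continuous_map_cnj
  continuous_map_add continuous_map_diff continuous_map_sum
  continuous_map_times continuous_map_inverse continuous_map_ident continuous_map_point
  continuous_map_fst continuous_map_snd

lemma cont_bounded [intro]: assumes "cont f" shows "bounded (f ` carrier G)"
proof -
  have "compactin euclidean (f ` topspace T)"
    using compact assms image_compactin unfolding compact_space_def by blast
  then show ?thesis by (simp add: compact_imp_bounded)
qed

text \<open>By the tube lemma, closeness of \<open>F x\<close> to \<open>F x0\<close> near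
  \<open>x0\<close> is uniform in the second variable; finitely many such neighbourhoods cover the
  group. This finitary uniform continuity is the tool for all approximations of means below.\<close>

lemma ex_discretisation:
  assumes F: "cont2 F" and "e > 0"
  shows "\<exists>s. finite (s ` carrier G) \<and> s ` carrier G \<subseteq> carrier G \<and>
           (\<forall>x\<in>carrier G. \<forall>y\<in>carrier G. norm (F x y - F (s x) y) < e)"
proof -
  have "\<exists>U. openin T U \<and> x0 \<in> U \<and> (\<forall>x\<in>U. \<forall>y\<in>carrier G. norm (F x y - F x0 y) < e)"
    if x0: "x0 \<in> carrier G" for x0
  proof -
    define H where "H = (\<lambda>p. F (fst p) (snd p) - F x0 (snd p))"
    have "continuous_map (prod_topology T T) euclidean (\<lambda>p. F x0 (snd p))"
      using continuous_map_compose[of "prod_topology T T" "prod_topology T T" "\<lambda>p. (x0, snd p)", OF _ F] x0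
      by (simp add: o_def continuous_map_pairedI continuous_map_snd)
    then have "continuous_map (prod_topology T T) euclidean H"
      unfolding H_def using F by (intro ctsI)
    from continuous_map_open_ball[OF this, of 0 e]
    have op: "openin (prod_topology T T) {p \<in> carrier G \<times> carrier G. norm (H p) < e}" by simp
    have sub: "{x0} \<times> carrier G \<subseteq> {p \<in> carrier G \<times> carrier G. norm (H p) < e}"
      using x0 \<open>e > 0\<close> by (auto simp: H_def)
    have "compactin T (carrier G)" "x0 \<in> topspace T"
      using compact x0 by (auto simp: compact_space_def)
    from tube_lemma_right[OF op this sub]
    obtain U V where "openin T U" "x0 \<in> U" "carrier G \<subseteq> V"
      "U \<times> V \<subseteq> {p \<in> carrier G \<times> carrier G. norm (H p) < e}"
      by (elim exE conjE)
    then show ?thesis unfolding H_def by fastforce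
  qed
  then obtain U where U: "\<And>x. x \<in> carrier G \<Longrightarrow> openin T (U x)" "\<And>x. x \<in> carrier G \<Longrightarrow> x \<in> U x"
    and le: "\<And>x0 x y. x0 \<in> carrier G \<Longrightarrow> x \<in> U x0 \<Longrightarrow> y \<in> carrier G \<Longrightarrow> norm (F x y - F x0 y) < e"
    by metis
  obtain D where D: "finite D" "D \<subseteq> carrier G" "carrier G \<subseteq> \<Union>(U ` D)"
    using finite_subcover[of U] U by blast
  then obtain s where "\<And>x. x \<in> carrier G \<Longrightarrow> s x \<in> D \<and> x \<in> U (s x)" by (metis UN_E subsetD)
  moreover have "norm (F x y - F (s x) y) < e" if "x \<in> carrier G" "y \<in> carrier G" for x y
    using calculation[OF that(1)] D that by (intro le) auto
  ultimately show ?thesis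
    using D by (intro exI[of _ s]) (auto intro: finite_subset[of _ D])
qed

section \<open>Fubini and faithfulness of the invariant mean\<close>

definition \<mu> :: "('g \<Rightarrow> complex) \<Rightarrow> complex" where
  "\<mu> = (SOME m. mean (carrier G) m \<and>
     (\<forall>f a. bounded (f ` carrier G) \<longrightarrow> a \<in> carrier G \<longrightarrow> m (\<lambda>x. f (a \<otimes> x)) = m f))"

lemma \<mu>: "mean (carrier G) \<mu>"
  "bounded (f ` carrier G) \<Longrightarrow> a \<in> carrier G \<Longrightarrow> \<mu> (\<lambda>x. f (a \<otimes> x)) = \<mu> f"
  using someI_ex[OF ex_invariant_mean, folded \<mu>_def] by auto

sublocale \<mu>: mean "carrier G" \<mu> by (rule \<mu>)

lemma cont2_swap: "cont2 F \<Longrightarrow> cont2 (\<lambda>x y. F y x)"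
  using continuous_map_compose[of "prod_topology T T" "prod_topology T T" "\<lambda>p. (snd p, fst p)"]
  by (fastforce simp: o_def intro!: continuous_map_pairedI continuous_map_snd continuous_map_fst)

lemma cont2_left: "cont2 F \<Longrightarrow> y \<in> carrier G \<Longrightarrow> cont (\<lambda>x. F x y)"
  using continuous_map_compose[of T "prod_topology T T" "\<lambda>x. (x, y)" euclidean "\<lambda>p. F (fst p) (snd p)"]
  by (fastforce simp: o_def intro!: continuous_map_pairedI continuous_map_ident)

lemma cont2_right: "cont2 F \<Longrightarrow> x \<in> carrier G \<Longrightarrow> cont (\<lambda>y. F x y)"
  using cont2_left[OF cont2_swap[of F]] by blast

text \<open>Discretising the second variable reduces closeness for all \<open>y\<close> to closeness
  at finitely many points, which is an open condition on \<open>x\<close>. Three errors of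
  \<open>e/4\<close> stay below \<open>e\<close>.\<close>

lemma cont_mean:
  assumes F: "cont2 F" shows "cont (\<lambda>x. \<mu> (\<lambda>y. F x y))"
proof (rule continuous_map_euclideanI)
  fix x0 and e :: real assume "x0 \<in> topspace T" "e > 0"
  then have x0: "x0 \<in> carrier G" by simp
  from ex_discretisation[OF F, of "e/4"] \<open>e > 0\<close>
  obtain s where s: "finite (s ` carrier G)" "s ` carrier G \<subseteq> carrier G"
    "\<And>x y. x \<in> carrier G \<Longrightarrow> y \<in> carrier G \<Longrightarrow> norm (F x y - F (s x) y) < e/4" by auto
  from ex_discretisation[OF cont2_swap[OF F], of "e/4"] \<open>e > 0\<close>
  obtain t where t: "finite (t ` carrier G)" "t ` carrier G \<subseteq> carrier G"
    "\<And>x y. x \<in> carrier G \<Longrightarrow> y \<in> carrier G \<Longrightarrow> norm (F x y - F x (t y)) < e/4" by auto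
  define U where "U = (\<Inter>y\<in>t ` carrier G. {x \<in> topspace T. dist (F x y) (F x0 y) < e/4})"
  have "openin T U" unfolding U_def
    using t one_closed
    by (intro openin_INT2 continuous_map_open_ball cont2_left[OF F]) auto
  moreover have "x0 \<in> U" using x0 \<open>e > 0\<close> by (simp add: U_def)
  moreover have "dist (\<mu> (F x)) (\<mu> (F x0)) < e" if "x \<in> U" for x
  proof -
    have x: "x \<in> carrier G" using that one_closed by (auto simp: U_def)
    have "norm (F x y - F x0 y) \<le> 3 * (e/4)" if y: "y \<in> carrier G" for y
    proof -
      have "norm (F x (t y) - F x0 (t y)) < e/4"
        using \<open>x \<in> U\<close> y by (auto simp: U_def dist_norm)
      moreover have "F x y - F x0 y = (F x y - F x (t y)) + (F x (t y) - F x0 (t y)) + (F x0 (t y) - F x0 y)"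
        by simp
      ultimately show ?thesis
        using t(3)[OF x y] t(3)[OF x0 y]
        by (smt (verit) norm_minus_commute norm_triangle_ineq)
    qed
    then have "norm (\<mu> (F x) - \<mu> (F x0)) \<le> 3 * (e/4)"
      using x x0 F by (intro \<mu>.norm_diff_le cont_bounded cont2_right)
    then show ?thesis using \<open>e > 0\<close> by (simp add: dist_norm)
  qed
  ultimately show "\<exists>U. openin T U \<and> x0 \<in> U \<and> (\<forall>x\<in>U. dist (\<mu> (F x)) (\<mu> (F x0)) < e)" by blast
qed

text \<open>Once \<open>x\<close> is replaced by \<open>s x\<close> with finite range, the mean over
  \<open>x\<close> is a finite weighted sum and the interchange is linearity. On either side the
  replacement costs at most \<open>e/2\<close>.\<close>

lemma mean_swap:
  assumes F: "cont2 F"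
  shows "\<mu> (\<lambda>x. \<mu> (\<lambda>y. F x y)) = \<mu> (\<lambda>y. \<mu> (\<lambda>x. F x y))"
proof -
  have "norm (\<mu> (\<lambda>x. \<mu> (\<lambda>y. F x y)) - \<mu> (\<lambda>y. \<mu> (\<lambda>x. F x y))) \<le> 0 + e" if "e > 0" for e
  proof -
    from ex_discretisation[OF F, of "e/2"] \<open>e > 0\<close>
    obtain s where s: "finite (s ` carrier G)" "s ` carrier G \<subseteq> carrier G"
      and le: "\<And>x y. x \<in> carrier G \<Longrightarrow> y \<in> carrier G \<Longrightarrow> norm (F x y - F (s x) y) < e/2" by auto
    let ?D = "s ` carrier G"
    \<comment> \<open>The indicators of the fibres of \<open>s\<close> are bounded but in general
      discontinuous, so the mean has to be available for all bounded functions.\<close>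
    define w where "w = (\<lambda>d x. complex_of_real (of_bool (s x = d)))"
    have bw: "bounded (w d ` carrier G)" for d
      unfolding bounded_image_iff by (intro exI[of _ 1]) (auto simp: w_def)
    have bF: "bounded (F x ` carrier G)" if "x \<in> carrier G" for x
      using cont2_right[OF F that] by blast
    have bF': "bounded ((\<lambda>x. F x y) ` carrier G)" if "y \<in> carrier G" for y
      using cont2_left[OF F that] by blast
    have expand: "h (s x) = (\<Sum>d\<in>?D. w d x * h d)" if "x \<in> carrier G" for x and h :: "'g \<Rightarrow> complex"
    proof -
      have "w d x * h d = (if d = s x then h d else 0)" for d by (auto simp: w_def)
      then show ?thesis using s that by (simp add: sum.delta)
    qed
    have fin: "bounded ((\<lambda>x. \<Sum>d\<in>?D. w d x * h d) ` carrier G)" for h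
      by (intro bounded_image_sum bounded_image_mult bw bounded_image_const)
    have step: "\<mu> (\<lambda>x. h (s x)) = (\<Sum>d\<in>?D. \<mu> (w d) * h d)" for h
    proof -
      have "\<mu> (\<lambda>x. h (s x)) = \<mu> (\<lambda>x. \<Sum>d\<in>?D. w d x * h d)"
        by (rule \<mu>.cong[symmetric]) (use expand fin in auto)
      also have "\<dots> = (\<Sum>d\<in>?D. \<mu> (\<lambda>x. w d x * h d))"
        by (intro \<mu>.sum bounded_image_mult bw bounded_image_const)
      finally show ?thesis using bw by (simp add: \<mu>.scale_right)
    qed
    have bs: "bounded ((\<lambda>x. h (s x)) ` carrier G)" for h :: "'g \<Rightarrow> complex"
      using finite_imageI[OF s(1), of h] by (simp add: image_image finite_imp_bounded)
    have "\<mu> (\<lambda>y. \<mu> (\<lambda>x. F (s x) y)) = \<mu> (\<lambda>y. \<Sum>d\<in>?D. \<mu> (w d) * F d y)"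
      by (simp add: step[of "\<lambda>z. F z y" for y])
    also have "\<dots> = (\<Sum>d\<in>?D. \<mu> (w d) * \<mu> (F d))"
      using s by (subst \<mu>.sum) (auto intro!: sum.cong \<mu>.scale bounded_image_scale bF)
    also have "\<dots> = \<mu> (\<lambda>x. \<mu> (F (s x)))" by (simp add: step[of "\<lambda>z. \<mu> (F z)"])
    finally have eq: "\<mu> (\<lambda>y. \<mu> (\<lambda>x. F (s x) y)) = \<mu> (\<lambda>x. \<mu> (F (s x)))" .
    have "norm (\<mu> (\<lambda>x. \<mu> (F x)) - \<mu> (\<lambda>x. \<mu> (F (s x)))) \<le> e/2"
    proof (rule \<mu>.norm_diff_le)
      show "bounded ((\<lambda>x. \<mu> (F x)) ` carrier G)" using cont_mean[OF F] by blast
      show "norm (\<mu> (F x) - \<mu> (F (s x))) \<le> e/2" if "x \<in> carrier G" for x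
        using that s le[OF that] by (intro \<mu>.norm_diff_le bF) (auto intro: less_imp_le)
    qed (rule bs)
    moreover have "norm (\<mu> (\<lambda>y. \<mu> (\<lambda>x. F x y)) - \<mu> (\<lambda>y. \<mu> (\<lambda>x. F (s x) y))) \<le> e/2"
    proof (rule \<mu>.norm_diff_le)
      show "bounded ((\<lambda>y. \<mu> (\<lambda>x. F x y)) ` carrier G)" using cont_mean[OF cont2_swap[OF F]] by blast
      have "bounded ((\<lambda>y. \<Sum>d\<in>?D. \<mu> (w d) * F d y) ` carrier G)"
        using s by (intro bounded_image_sum bounded_image_scale bF) auto
      then show "bounded ((\<lambda>y. \<mu> (\<lambda>x. F (s x) y)) ` carrier G)"
        by (simp add: step[of "\<lambda>z. F z y" for y])
      show "norm (\<mu> (\<lambda>x. F x y) - \<mu> (\<lambda>x. F (s x) y)) \<le> e/2" if "y \<in> carrier G" for y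
        using that le bF' by (intro \<mu>.norm_diff_le bs) (auto intro: less_imp_le)
    qed
    ultimately have "dist (\<mu> (\<lambda>x. \<mu> (F x))) (\<mu> (\<lambda>y. \<mu> (\<lambda>x. F x y))) \<le> e/2 + e/2"
      using dist_triangle_le[of "\<mu> (\<lambda>x. \<mu> (F x))" "\<mu> (\<lambda>x. \<mu> (F (s x)))" "\<mu> (\<lambda>y. \<mu> (\<lambda>x. F x y))" "e"]
      unfolding eq dist_norm by (smt (verit) norm_minus_commute field_sum_of_halves)
    then show ?thesis by (simp add: dist_norm)
  qed
  then have "norm (\<mu> (\<lambda>x. \<mu> (\<lambda>y. F x y)) - \<mu> (\<lambda>y. \<mu> (\<lambda>x. F x y))) \<le> 0"
    by (rule field_le_epsilon)
  then show ?thesis by simp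
qed

text \<open>The square of the L2 norm that belongs to the mean.\<close>

definition \<nu> :: "('g \<Rightarrow> complex) \<Rightarrow> real" where
  "\<nu> f = Re (\<mu> (\<lambda>x. f x * cnj (f x)))"

lemma mean_norm_square:
  assumes "cont f" shows "\<mu> (\<lambda>x. f x * cnj (f x)) = complex_of_real (\<nu> f)"
proof -
  have "Im (\<mu> (\<lambda>x. f x * cnj (f x))) = 0"
    by (rule \<mu>.real_valued) (use assms in \<open>auto intro!: cont_bounded ctsI\<close>)
  then show ?thesis unfolding \<nu>_def by (simp add: complex_eq_iff)
qed

lemma \<nu>_nonneg: "cont f \<Longrightarrow> 0 \<le> \<nu> f"
  unfolding \<nu>_def by (rule \<mu>.Re_nonneg) (auto intro!: cont_bounded ctsI)

text \<open>If \<open>f x\<close> were nonzero, finitely many translates of the open set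
  \<open>U\<close>, on which the modulus of \<open>f\<close> exceeds \<open>r\<close>, would cover
  the group. The corresponding sum of translates of the squared modulus is at least
  \<open>r\<^sup>2\<close>, yet by invariance each of its terms has mean 0.\<close>

lemma \<nu>_eq_0:
  assumes f: "cont f" and 0: "\<nu> f = 0" and x: "x \<in> carrier G"
  shows "f x = 0"
proof (rule ccontr)
  assume nz: "f x \<noteq> 0"
  define r where "r = norm (f x) / 2"
  have r: "r > 0" using nz by (simp add: r_def)
  define U where "U = {y \<in> topspace T. dist (f y) (f x) < r}"
  have U: "openin T U" unfolding U_def by (rule continuous_map_open_ball[OF f])
  have "norm (f y) > r" if "y \<in> U" for y
    using that norm_triangle_ineq2[of "f x" "f y"]
    by (simp add: U_def r_def dist_norm norm_minus_commute) 
  define V where "V = (\<lambda>a. {y \<in> topspace T. inv a \<otimes> y \<in> U})"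
  have V: "openin T (V a)" if "a \<in> carrier G" for a
    unfolding V_def using that U by (intro openin_continuous_map_preimage[of T T] ctsI) auto
  have "y \<in> V (y \<otimes> inv x)" if "y \<in> carrier G" for y
  proof -
    have "inv (y \<otimes> inv x) \<otimes> y = x" using that x by (simp add: inv_mult_group m_assoc)
    then show ?thesis using that x r by (simp add: V_def U_def)
  qed
  then have "\<exists>a\<in>carrier G. y \<in> V a" if "y \<in> carrier G" for y
    using that x by (intro bexI[of _ "y \<otimes> inv x"]) auto
  then have cover: "carrier G \<subseteq> \<Union>(V ` carrier G)" by auto
  obtain D where D: "finite D" "D \<subseteq> carrier G" "carrier G \<subseteq> \<Union>(V ` D)"
  proof -
    show ?thesis using finite_subcover[OF V cover] that by blast
  qed
  let ?h = "\<lambda>a y. f (inv a \<otimes> y) * cnj (f (inv a \<otimes> y))"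
  have cont_h: "cont (?h a)" if "a \<in> carrier G" for a
    using that f by (intro ctsI cont_comp[OF f]) auto
  have "Re (\<mu> (\<lambda>y. complex_of_real (r\<^sup>2))) \<le> Re (\<mu> (\<lambda>y. \<Sum>a\<in>D. ?h a y))"
  proof (rule \<mu>.Re_mono)
    show "bounded ((\<lambda>y. \<Sum>a\<in>D. ?h a y) ` carrier G)" using D by (intro bounded_image_sum cont_bounded cont_h) blast
    fix y assume "y \<in> carrier G"
    then obtain a where a: "a \<in> D" "y \<in> V a" using D by blast
    then have "r < norm (f (inv a \<otimes> y))"
      using \<open>\<And>y. y \<in> U \<Longrightarrow> norm (f y) > r\<close> by (auto simp: V_def)
    then have "r\<^sup>2 \<le> (norm (f (inv a \<otimes> y)))\<^sup>2" using r by simp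
    then have "r\<^sup>2 \<le> Re (?h a y)" by (simp flip: complex_norm_square)
    also have "\<dots> \<le> (\<Sum>a\<in>D. Re (?h a y))" using D a by (intro member_le_sum) (auto simp flip: complex_norm_square)
    finally show "Re (complex_of_real (r\<^sup>2)) \<le> Re (\<Sum>a\<in>D. ?h a y)" by simp
  qed simp
  also have "\<mu> (\<lambda>y. \<Sum>a\<in>D. ?h a y) = (\<Sum>a\<in>D. \<mu> (?h a))"
    using D by (intro \<mu>.sum cont_bounded cont_h) blast
  also have "Re (\<mu> (?h a)) = 0" if "a \<in> D" for a
  proof -
    have "bounded ((\<lambda>x. f x * cnj (f x)) ` carrier G)" using f by (intro cont_bounded ctsI)
    moreover have "inv a \<in> carrier G" using D that by auto
    ultimately show ?thesis using \<mu>(2)[of "\<lambda>x. f x * cnj (f x)" "inv a"] 0 by (simp add: \<nu>_def)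
  qed
  then have "Re (\<Sum>a\<in>D. \<mu> (?h a)) = 0" by simp
  finally show False using r by simp
qed

end

lemma sum_lessThan_add:
  fixes f :: "nat \<Rightarrow> 'a::comm_monoid_add"
  shows "(\<Sum>i<n + m. f i) = (\<Sum>i<n. f i) + (\<Sum>i<m. f (n + i))"
  by (induction m) (auto simp: add.assoc)

section \<open>The L1 norm, convolution and the inner product\<close>

context compact_comm_group
begin

lemma mean_translate: "cont f \<Longrightarrow> a \<in> carrier G \<Longrightarrow> \<mu> (\<lambda>x. f (a \<otimes> x)) = \<mu> f"
  by (intro \<mu>(2) cont_bounded)

definition ell1 :: "('g \<Rightarrow> complex) \<Rightarrow> real" where
  "ell1 h = Re (\<mu> (\<lambda>x. complex_of_real (norm (h x))))"

lemma norm_mean_mult_le: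
  assumes "cont \<kappa>" "cont h" "\<And>y. y \<in> carrier G \<Longrightarrow> norm (\<kappa> y) \<le> b"
  shows "norm (\<mu> (\<lambda>y. \<kappa> y * h y)) \<le> b * ell1 h"
proof -
  have bn: "bounded ((\<lambda>x. complex_of_real (norm (h x))) ` carrier G)"
    using assms(2) by (intro bounded_image_norm cont_bounded)
  have "norm (\<mu> (\<lambda>y. \<kappa> y * h y)) \<le> Re (\<mu> (\<lambda>y. complex_of_real (b * norm (h y))))"
  proof (rule \<mu>.norm_le_mean)
    show "bounded ((\<lambda>y. \<kappa> y * h y) ` carrier G)"
      using assms by (intro bounded_image_mult cont_bounded)
    show "bounded ((\<lambda>x. complex_of_real (b * norm (h x))) ` carrier G)"
      using bounded_image_scale[OF bn, of "complex_of_real b"] by simp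
    show "norm (\<kappa> y * h y) \<le> b * norm (h y)" if "y \<in> carrier G" for y
      using assms(3)[OF that] by (simp add: norm_mult mult_right_mono)
  qed
  also have "\<dots> = b * ell1 h"
    using \<mu>.scale[OF bn, of "complex_of_real b"] by (simp add: ell1_def)
  finally show ?thesis .
qed

lemma ell1_le:
  assumes "\<And>x. x \<in> carrier G \<Longrightarrow> norm (h x) \<le> C"
  shows "ell1 h \<le> C"
proof -
  have "norm (\<mu> (\<lambda>x. complex_of_real (norm (h x)))) \<le> C"
    using assms by (intro \<mu>.norm_le) simp
  then show ?thesis unfolding ell1_def using complex_Re_le_cmod order_trans by blast
qed

text \<open>From \<open>2 * r \<le> 1 + r\<^sup>2\<close> pointwise, in place of the Cauchy-Schwarz
  inequality.\<close>

lemma ell1_le_1: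
  assumes h: "cont h" "\<nu> h \<le> 1" shows "ell1 h \<le> 1"
proof -
  have b: "bounded ((\<lambda>x. h x * cnj (h x)) ` carrier G)" using h by (intro cont_bounded ctsI)
  have "ell1 h \<le> Re (\<mu> (\<lambda>x. (1/2) * (1 + h x * cnj (h x))))"
    unfolding ell1_def
  proof (rule \<mu>.Re_mono)
    show "bounded ((\<lambda>x. complex_of_real (norm (h x))) ` carrier G)"
      using h by (intro bounded_image_norm cont_bounded)
    show "bounded ((\<lambda>x. (1/2) * (1 + h x * cnj (h x))) ` carrier G)"
      using b by (intro bounded_image_scale bounded_image_add bounded_image_const)
    fix x
    have "0 \<le> (norm (h x) - 1)\<^sup>2" by simp
    then have "norm (h x) \<le> (1/2) * (1 + (norm (h x))\<^sup>2)" by (simp add: power2_diff)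
    then show "Re (complex_of_real (norm (h x))) \<le> Re ((1/2) * (1 + h x * cnj (h x)))"
      by (simp flip: complex_norm_square)
  qed
  also have "\<mu> (\<lambda>x. (1/2) * (1 + h x * cnj (h x))) = (1/2) * (1 + \<mu> (\<lambda>x. h x * cnj (h x)))"
    using b by (simp only: \<mu>.scale \<mu>.add bounded_image_add bounded_image_const \<mu>.one)
  also have "Re \<dots> = (1 + \<nu> h) / 2" by (simp add: \<nu>_def)
  finally show ?thesis using h by simp
qed

definition conv :: "('g \<Rightarrow> complex) \<Rightarrow> ('g \<Rightarrow> complex) \<Rightarrow> 'g \<Rightarrow> complex" where
  "conv k h x = \<mu> (\<lambda>y. k (x \<otimes> inv y) * h y)"

text \<open>The kernel whose convolution operator is adjoint, for \<open>ip\<close>, to convolution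
  by \<open>k\<close>.\<close>

definition adj :: "('g \<Rightarrow> complex) \<Rightarrow> 'g \<Rightarrow> complex" where
  "adj k z = cnj (k (inv z))"

definition ip :: "('g \<Rightarrow> complex) \<Rightarrow> ('g \<Rightarrow> complex) \<Rightarrow> complex" where
  "ip f h = \<mu> (\<lambda>x. f x * cnj (h x))"

lemma cont_adj: assumes k: "cont k" shows "cont (adj k)"
  unfolding adj_def[abs_def] by (intro ctsI cont_comp[OF k])

lemma cont_translate:
  assumes f: "cont f" and a: "a \<in> carrier G" shows "cont (\<lambda>x. f (a \<otimes> x))"
  by (intro cont_comp[OF f] ctsI a)

lemma cont2_conv:
  assumes k: "cont k" and h: "cont h" shows "cont2 (\<lambda>x y. k (x \<otimes> inv y) * h y)"
  by (intro ctsI cont_comp[OF k] cont_comp[OF h])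

lemma cont_conv: "cont k \<Longrightarrow> cont h \<Longrightarrow> cont (conv k h)"
  unfolding conv_def[abs_def] by (intro cont_mean cont2_conv)

lemma cont_kernel:
  assumes k: "cont k" and x: "x \<in> carrier G" shows "cont (\<lambda>y. k (x \<otimes> inv y))"
  by (intro ctsI cont_comp[OF k] x)

lemma conv_cong:
  assumes "cont k" "cont f" "x \<in> carrier G" "\<And>y. y \<in> carrier G \<Longrightarrow> f y = h y"
  shows "conv k f x = conv k h x"
  unfolding conv_def using assms by (intro \<mu>.cong cont_bounded ctsI cont_kernel) auto

lemma conv_diff:
  assumes "cont k" "cont f" "cont h" "x \<in> carrier G"
  shows "conv k (\<lambda>y. f y - h y) x = conv k f x - conv k h x"
  unfolding conv_def right_diff_distrib using assms by (intro \<mu>.diff cont_bounded ctsI cont_kernel)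

lemma conv_add:
  assumes "cont k" "cont f" "cont h" "x \<in> carrier G"
  shows "conv k (\<lambda>y. f y + h y) x = conv k f x + conv k h x"
  unfolding conv_def distrib_left using assms by (intro \<mu>.add cont_bounded ctsI cont_kernel)

lemma conv_scale:
  assumes "cont k" "cont h" "x \<in> carrier G"
  shows "conv k (\<lambda>y. c * h y) x = c * conv k h x"
proof -
  have "\<mu> (\<lambda>y. c * (k (x \<otimes> inv y) * h y)) = c * \<mu> (\<lambda>y. k (x \<otimes> inv y) * h y)"
    using assms by (intro \<mu>.scale cont_bounded ctsI cont_kernel)
  then show ?thesis by (simp add: conv_def mult.left_commute)
qed

lemma norm_conv_le:
  assumes "cont k" "cont h" "x \<in> carrier G" "\<And>y. y \<in> carrier G \<Longrightarrow> norm (k y) \<le> b"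
  shows "norm (conv k h x) \<le> b * ell1 h"
  unfolding conv_def using assms by (intro norm_mean_mult_le cont_kernel) auto

lemma norm_conv_diff_le:
  assumes "cont k" "cont h" "x \<in> carrier G" "y \<in> carrier G"
    "\<And>z. z \<in> carrier G \<Longrightarrow> norm (k (x \<otimes> inv z) - k (y \<otimes> inv z)) \<le> e"
  shows "norm (conv k h x - conv k h y) \<le> e * ell1 h"
proof -
  have "conv k h x - conv k h y = \<mu> (\<lambda>z. (k (x \<otimes> inv z) - k (y \<otimes> inv z)) * h z)"
    unfolding conv_def left_diff_distrib using assms
    by (intro \<mu>.diff[symmetric] cont_bounded ctsI cont_kernel)
  also have "norm \<dots> \<le> e * ell1 h"
    using assms by (intro norm_mean_mult_le ctsI cont_kernel)
  finally show ?thesis .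
qed

text \<open>Fubini for \<open>?F\<close>: integrating over \<open>y\<close> first gives the left
  side, over \<open>x\<close> first the right side.\<close>

lemma ip_conv:
  assumes k: "cont k" and h: "cont h" and f: "cont f"
  shows "ip (conv k h) f = ip h (conv (adj k) f)"
proof -
  let ?F = "\<lambda>x y. k (x \<otimes> inv y) * h y * cnj (f x)"
  have F: "cont2 ?F" by (intro ctsI cont_comp[OF k] cont_comp[OF h] cont_comp[OF f])
  have "ip (conv k h) f = \<mu> (\<lambda>x. \<mu> (\<lambda>y. ?F x y))"
    unfolding ip_def
  proof (rule \<mu>.cong)
    show "bounded ((\<lambda>x. conv k h x * cnj (f x)) ` carrier G)"
      using assms by (intro cont_bounded ctsI cont_conv)
    fix x assume "x \<in> carrier G"
    then show "conv k h x * cnj (f x) = \<mu> (\<lambda>y. ?F x y)"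
      unfolding conv_def using assms
      by (intro \<mu>.scale_right[symmetric] cont_bounded ctsI cont_kernel)
  qed
  also have "\<dots> = \<mu> (\<lambda>y. \<mu> (\<lambda>x. ?F x y))" by (rule mean_swap[OF F])
  also have "\<dots> = ip h (conv (adj k) f)"
    unfolding ip_def
  proof (rule \<mu>.cong)
    show "bounded ((\<lambda>y. \<mu> (\<lambda>x. ?F x y)) ` carrier G)"
      by (intro cont_bounded cont_mean[of "\<lambda>y x. ?F x y"] cont2_swap[of ?F] F)
    fix y assume y: "y \<in> carrier G"
    let ?g = "\<lambda>x. adj k (y \<otimes> inv x) * f x"
    have g: "cont ?g" using assms y by (intro ctsI cont_kernel cont_adj)
    have "\<mu> (\<lambda>x. ?F x y) = \<mu> (\<lambda>x. h y * cnj (?g x))"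
    proof (rule \<mu>.cong)
      show "bounded ((\<lambda>x. ?F x y) ` carrier G)" by (rule cont_bounded[OF cont2_left[OF F y]])
      fix x assume "x \<in> carrier G"
      then have "inv (y \<otimes> inv x) = x \<otimes> inv y" using y by (simp add: inv_mult_group)
      then show "?F x y = h y * cnj (?g x)" by (simp add: adj_def mult_ac)
    qed
    also have "\<dots> = h y * \<mu> (\<lambda>x. cnj (?g x))"
      by (intro \<mu>.scale cont_bounded continuous_map_cnj g)
    also have "\<mu> (\<lambda>x. cnj (?g x)) = cnj (\<mu> ?g)" using g by (intro \<mu>.cnj cont_bounded)
    finally show "\<mu> (\<lambda>x. ?F x y) = h y * cnj (conv (adj k) f y)" by (simp add: conv_def)
  qed
  finally show ?thesis .
qed

lemma ip_self: "cont f \<Longrightarrow> ip f f = complex_of_real (\<nu> f)"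
  unfolding ip_def by (rule mean_norm_square)

lemma Re_ip_commute:
  assumes "cont f" "cont h" shows "Re (ip f h) = Re (ip h f)"
proof -
  have "\<mu> (\<lambda>x. cnj (f x * cnj (h x))) = cnj (\<mu> (\<lambda>x. f x * cnj (h x)))"
    using assms by (intro \<mu>.cnj cont_bounded ctsI)
  then show ?thesis by (simp add: ip_def mult.commute)
qed

lemma \<nu>_cong: "cont f \<Longrightarrow> (\<And>x. x \<in> carrier G \<Longrightarrow> f x = h x) \<Longrightarrow> \<nu> f = \<nu> h"
  unfolding \<nu>_def by (intro arg_cong[of _ _ Re] \<mu>.cong cont_bounded ctsI) auto

lemma \<nu>_scale:
  assumes "cont f" shows "\<nu> (\<lambda>x. c * f x) = (norm c)\<^sup>2 * \<nu> f"
proof -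
  have "\<mu> (\<lambda>x. complex_of_real ((norm c)\<^sup>2) * (f x * cnj (f x))) = complex_of_real ((norm c)\<^sup>2) * \<mu> (\<lambda>x. f x * cnj (f x))"
    using assms by (intro \<mu>.scale cont_bounded ctsI)
  moreover have "c * f x * cnj (c * f x) = complex_of_real ((norm c)\<^sup>2) * (f x * cnj (f x))" for x
    unfolding complex_norm_square by (simp add: mult_ac)
  ultimately show ?thesis unfolding \<nu>_def by (simp only: Re_complex_of_real times_complex.sel Im_complex_of_real)
qed

lemma \<nu>_diff_scale:
  assumes f: "cont f" and h: "cont h"
  shows "\<nu> (\<lambda>x. f x - complex_of_real c * h x) = \<nu> f - 2 * c * Re (ip f h) + c\<^sup>2 * \<nu> h"
proof -
  let ?c = "complex_of_real c"
  have "(f x - ?c * h x) * cnj (f x - ?c * h x) =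
      f x * cnj (f x) - ?c * (f x * cnj (h x)) - ?c * (h x * cnj (f x)) + ?c\<^sup>2 * (h x * cnj (h x))" for x
    by (simp add: algebra_simps power2_eq_square)
  moreover have "\<mu> (\<lambda>x. f x * cnj (f x) - ?c * (f x * cnj (h x)) - ?c * (h x * cnj (f x)) + ?c\<^sup>2 * (h x * cnj (h x)))
      = \<mu> (\<lambda>x. f x * cnj (f x)) - ?c * ip f h - ?c * ip h f + ?c\<^sup>2 * \<mu> (\<lambda>x. h x * cnj (h x))"
  proof -
    have b: "bounded ((\<lambda>x. f x * cnj (f x)) ` carrier G)" "bounded ((\<lambda>x. f x * cnj (h x)) ` carrier G)"
      "bounded ((\<lambda>x. h x * cnj (f x)) ` carrier G)" "bounded ((\<lambda>x. h x * cnj (h x)) ` carrier G)"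
      by - (intro cont_bounded ctsI assms)+
    show ?thesis unfolding ip_def
      by (simp only: \<mu>.add \<mu>.diff \<mu>.scale b bounded_image_add bounded_image_minus bounded_image_scale)
  qed
  ultimately have "\<nu> (\<lambda>x. f x - ?c * h x) = Re (\<mu> (\<lambda>x. f x * cnj (f x)) - ?c * ip f h - ?c * ip h f + ?c\<^sup>2 * \<mu> (\<lambda>x. h x * cnj (h x)))"
    by (simp add: \<nu>_def)
  also have "\<dots> = \<nu> f - 2 * c * Re (ip f h) + c\<^sup>2 * \<nu> h"
    using Re_ip_commute[OF assms] by (simp add: \<nu>_def flip: of_real_power)
  finally show ?thesis .
qed

lemma \<nu>_lipschitz:
  assumes "cont f" "cont h" "\<And>x. x \<in> carrier G \<Longrightarrow> norm (f x) \<le> B" "\<And>x. x \<in> carrier G \<Longrightarrow> norm (h x) \<le> B"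
    "\<And>x. x \<in> carrier G \<Longrightarrow> norm (f x - h x) \<le> d"
  shows "\<bar>\<nu> f - \<nu> h\<bar> \<le> 2 * B * d"
proof -
  have "norm (\<mu> (\<lambda>x. f x * cnj (f x)) - \<mu> (\<lambda>x. h x * cnj (h x))) \<le> 2 * B * d"
  proof (rule \<mu>.norm_diff_le)
    fix x assume x: "x \<in> carrier G"
    have "f x * cnj (f x) - h x * cnj (h x) = f x * cnj (f x - h x) + (f x - h x) * cnj (h x)"
      by (simp add: algebra_simps)
    also have "norm \<dots> \<le> norm (f x) * norm (f x - h x) + norm (f x - h x) * norm (h x)"
      by (metis complex_mod_cnj norm_mult norm_triangle_ineq)
    also have "\<dots> \<le> B * d + d * B"
      using assms(3-5)[OF x] norm_ge_zero[of "f x"] norm_ge_zero[of "h x"] norm_ge_zero[of "f x - h x"]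
      by (intro add_mono mult_mono) linarith+
    finally show "norm (f x * cnj (f x) - h x * cnj (h x)) \<le> 2 * B * d" by (simp add: mult_ac)
  qed (intro cont_bounded ctsI assms)+
  then show ?thesis unfolding \<nu>_def
    using abs_Re_le_cmod[of "\<mu> (\<lambda>x. f x * cnj (f x)) - \<mu> (\<lambda>x. h x * cnj (h x))"] by simp
qed

text \<open>Invariance of the mean replaces \<open>y\<close> by \<open>a \<otimes> y\<close>, and by
  commutativity \<open>a\<close> cancels in the kernel. Hence eigenspaces of convolution operators
  are invariant under translations.\<close>

lemma conv_translate:
  assumes k: "cont k" and f: "cont f" and a: "a \<in> carrier G" and x: "x \<in> carrier G"
  shows "conv k (\<lambda>y. f (a \<otimes> y)) x = conv k f (a \<otimes> x)"
proof -
  have "conv k f (a \<otimes> x) = \<mu> (\<lambda>y. k (a \<otimes> x \<otimes> inv (a \<otimes> y)) * f (a \<otimes> y))"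
    unfolding conv_def using assms mean_translate[of "\<lambda>y. k (a \<otimes> x \<otimes> inv y) * f y" a]
    by (simp add: ctsI cont_kernel)
  also have "\<dots> = \<mu> (\<lambda>y. k (x \<otimes> inv y) * f (a \<otimes> y))"
  proof (rule \<mu>.cong[symmetric])
    show "bounded ((\<lambda>y. k (x \<otimes> inv y) * f (a \<otimes> y)) ` carrier G)"
      using assms by (intro cont_bounded ctsI cont_kernel cont_translate)
    fix y assume y: "y \<in> carrier G"
    have "a \<otimes> x \<otimes> inv (a \<otimes> y) = (a \<otimes> inv a) \<otimes> (x \<otimes> inv y)"
      using a x y by (simp only: inv_mult_group m_ac m_closed inv_closed)
    then show "k (x \<otimes> inv y) * f (a \<otimes> y) = k (a \<otimes> x \<otimes> inv (a \<otimes> y)) * f (a \<otimes> y)"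
      using a x y by simp
  qed
  finally show ?thesis by (simp add: conv_def)
qed

text \<open>A pointwise closed, uniformly equicontinuous family: its moduli of continuity are dominated by
  \<^term>\<open>C\<close> times that of the translates of \<^term>\<open>u\<close>. On it, pointwise and uniform
  convergence agree.\<close>

definition equi :: "('g \<Rightarrow> complex) \<Rightarrow> real \<Rightarrow> real \<Rightarrow> ('g \<Rightarrow> complex) set" where
  "equi u C B = {f. (\<forall>x. x \<notin> carrier G \<longrightarrow> f x = 0) \<and> (\<forall>x. x \<in> carrier G \<longrightarrow> norm (f x) \<le> B) \<and>
     (\<forall>x y e. x \<in> carrier G \<and> y \<in> carrier G \<and>
        (\<forall>z\<in>carrier G. norm (u (x \<otimes> inv z) - u (y \<otimes> inv z)) \<le> e) \<longrightarrow> norm (f x - f y) \<le> C * e)}"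

lemma closed_equi: "closed (equi u C B)"
  unfolding equi_def
  by (intro closed_Collect_conj closed_Collect_all closed_Collect_imp closed_Collect_eq closed_Collect_le
      open_Collect_const continuous_intros continuous_on_product_coordinates)

lemma compact_equi: "compact (equi u C B)"
proof -
  \<comment> \<open>The values outside the group are 0, and \<open>B\<close> has no sign; hence
    \<open>max B 0\<close>.\<close>
  have "equi u C B \<subseteq> {f. \<forall>x. f x \<in> cball 0 (max B 0)}" 
    by (auto simp: equi_def le_max_iff_disj)
  moreover have "compact {f. \<forall>x. f x \<in> cball (0::complex) (max B 0)}"
    by (rule compact_product_sets) simp
  ultimately show ?thesis using closed_equi by (metis closed_Int_compact inf.absorb_iff1)
qed

text \<open>\<open>D\<close> discretises the translates of \<open>u\<close>, so every member of the
  family moves by at most \<open>C * e\<close> between \<open>x\<close> and its representative in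
  \<open>D\<close>. Going there, comparing, and coming back costs
  \<open>C * e + e + C * e\<close>.\<close>

lemma equi_discretisation:
  assumes u: "cont u" and "e > 0" "C \<ge> 0"
  obtains D where "finite D" "D \<subseteq> carrier G"
    "\<And>f h x. f \<in> equi u C B \<Longrightarrow> h \<in> equi u C B \<Longrightarrow> (\<And>d. d \<in> D \<Longrightarrow> norm (h d - f d) \<le> e) \<Longrightarrow>
       x \<in> carrier G \<Longrightarrow> norm (h x - f x) \<le> (2 * C + 1) * e"
proof -
  have "cont2 (\<lambda>x z. u (x \<otimes> inv z))" by (intro cont_comp[OF u] ctsI)
  from ex_discretisation[OF this \<open>e > 0\<close>] obtain s where s: "finite (s ` carrier G)" "s ` carrier G \<subseteq> carrier G"
    "\<And>x z. x \<in> carrier G \<Longrightarrow> z \<in> carrier G \<Longrightarrow> norm (u (x \<otimes> inv z) - u (s x \<otimes> inv z)) < e" by auto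
  have close: "norm (f x - f (s x)) \<le> C * e" if f: "f \<in> equi u C B" and x: "x \<in> carrier G" for f x
  proof -
    have "s x \<in> carrier G" "\<forall>z\<in>carrier G. norm (u (x \<otimes> inv z) - u (s x \<otimes> inv z)) \<le> e"
      using s x by (auto intro: less_imp_le)
    then show ?thesis using f x unfolding equi_def by blast
  qed
  show ?thesis
  proof (rule that[OF s(1,2)])
    fix f h x
    assume f: "f \<in> equi u C B" and h: "h \<in> equi u C B" and x: "x \<in> carrier G"
      and le: "\<And>d. d \<in> s ` carrier G \<Longrightarrow> norm (h d - f d) \<le> e"
    have "h x - f x = (h x - h (s x)) + (h (s x) - f (s x)) - (f x - f (s x))" by simp
    also have "norm \<dots> \<le> norm (h x - h (s x)) + norm (h (s x) - f (s x)) + norm (f x - f (s x))"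
      by (meson add_mono norm_triangle_ineq norm_triangle_ineq4 order_refl order_trans)
    also have "\<dots> \<le> C * e + e + C * e"
      using close[OF f x] close[OF h x] le[of "s x"] x by (intro add_mono) auto
    finally show "norm (h x - f x) \<le> (2 * C + 1) * e" by (simp add: algebra_simps)
  qed
qed

text \<open>On the family, closeness at finitely many points implies uniform closeness, so a
  functional that is Lipschitz for the uniform norm is continuous for the pointwise
  topology.\<close>

lemma continuous_on_equi:
  fixes \<Psi> :: "('g \<Rightarrow> complex) \<Rightarrow> real"
  assumes u: "cont u" and C: "C \<ge> 0" and L: "L \<ge> 0"
    and lip: "\<And>f h d. f \<in> equi u C B \<Longrightarrow> h \<in> equi u C B \<Longrightarrow>
      (\<And>x. x \<in> carrier G \<Longrightarrow> norm (h x - f x) \<le> d) \<Longrightarrow> \<bar>\<Psi> h - \<Psi> f\<bar> \<le> L * d"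
  shows "continuous_on (equi u C B) \<Psi>"
  unfolding continuous_on_topological
proof (intro ballI allI impI)
  fix f and V :: "real set" assume f: "f \<in> equi u C B" and V: "open V" "\<Psi> f \<in> V"
  then obtain \<epsilon> where \<epsilon>: "\<epsilon> > 0" "\<And>r. \<bar>r - \<Psi> f\<bar> < \<epsilon> \<Longrightarrow> r \<in> V"
    unfolding open_dist dist_real_def by metis
  \<comment> \<open>The summand 1 allows \<open>L = 0\<close> and makes the final inequality
    strict.\<close>
  define e where "e = \<epsilon> / (L * (2 * C + 1) + 1)"
  have pos: "L * (2 * C + 1) + 1 > 0" using C L by (simp add: add_nonneg_pos)
  then have e: "e > 0" "L * ((2 * C + 1) * e) < \<epsilon>"
    using \<epsilon>(1) by (auto simp: e_def field_simps)
  obtain D where D: "finite D" "D \<subseteq> carrier G"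
    "\<And>f h x. f \<in> equi u C B \<Longrightarrow> h \<in> equi u C B \<Longrightarrow> (\<And>d. d \<in> D \<Longrightarrow> norm (h d - f d) \<le> e) \<Longrightarrow>
       x \<in> carrier G \<Longrightarrow> norm (h x - f x) \<le> (2 * C + 1) * e"
    using equi_discretisation[OF u e(1) C, of B] by blast
  define A where "A = (\<Inter>d\<in>D. {h. norm (h d - f d) < e})"
  have "open A" unfolding A_def
    by (intro open_INT D(1) ballI open_Collect_less continuous_intros continuous_on_product_coordinates)
  moreover have "f \<in> A" using e by (simp add: A_def)
  moreover have "\<Psi> h \<in> V" if h: "h \<in> equi u C B" "h \<in> A" for h
  proof -
    have "\<bar>\<Psi> h - \<Psi> f\<bar> \<le> L * ((2 * C + 1) * e)"
      using f h by (intro lip D(3)) (auto simp: A_def intro: less_imp_le)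
    then show ?thesis using e(2) by (intro \<epsilon>) simp
  qed
  ultimately show "\<exists>A. open A \<and> f \<in> A \<and> (\<forall>h\<in>equi u C B. h \<in> A \<longrightarrow> \<Psi> h \<in> V)" by blast
qed

lemma cont_equi:
  assumes u: "cont u" and C: "C \<ge> 0" and f: "f \<in> equi u C B"
  shows "cont f"
proof (rule continuous_map_euclideanI)
  fix x and e :: real assume "x \<in> topspace T" "e > 0"
  then have x: "x \<in> carrier G" by simp
  have "cont2 (\<lambda>z x. u (x \<otimes> inv z))" by (intro cont_comp[OF u] ctsI)
  \<comment> \<open>Three errors of this size, multiplied by \<open>C\<close>, stay below
    \<open>e\<close>; \<open>C + 1\<close> avoids a division by 0.\<close>
  from ex_discretisation[OF this, of "e / (4 * (C + 1))"] C \<open>e > 0\<close>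
  obtain s where s: "finite (s ` carrier G)" "s ` carrier G \<subseteq> carrier G"
    "\<And>x z. x \<in> carrier G \<Longrightarrow> z \<in> carrier G \<Longrightarrow> norm (u (x \<otimes> inv z) - u (x \<otimes> inv (s z))) < e / (4 * (C + 1))" by auto
  define U where "U = (\<Inter>z\<in>s ` carrier G. {y \<in> topspace T. dist (u (y \<otimes> inv z)) (u (x \<otimes> inv z)) < e / (4 * (C + 1))})"
  have "openin T U" unfolding U_def
    using s one_closed by (intro openin_INT2 continuous_map_open_ball cont_comp[OF u] ctsI) auto
  moreover have "x \<in> U" using C \<open>e > 0\<close> x by (simp add: U_def)
  moreover have "dist (f y) (f x) < e" if y: "y \<in> U" for y
  proof -
    have yG: "y \<in> carrier G" using y one_closed by (auto simp: U_def)
    have "norm (u (y \<otimes> inv z) - u (x \<otimes> inv z)) \<le> 3 * (e / (4 * (C + 1)))" if z: "z \<in> carrier G" for z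
    proof -
      have "norm (u (y \<otimes> inv (s z)) - u (x \<otimes> inv (s z))) < e / (4 * (C + 1))"
        using y z by (auto simp: U_def dist_norm)
      moreover have "u (y \<otimes> inv z) - u (x \<otimes> inv z) = (u (y \<otimes> inv z) - u (y \<otimes> inv (s z)))
          + (u (y \<otimes> inv (s z)) - u (x \<otimes> inv (s z))) + (u (x \<otimes> inv (s z)) - u (x \<otimes> inv z))" by simp
      ultimately show ?thesis using s(3)[OF x z] s(3)[OF yG z]
        by (smt (verit) norm_minus_commute norm_triangle_ineq)
    qed
    then have "norm (f y - f x) \<le> C * (3 * (e / (4 * (C + 1))))"
      using f x yG unfolding equi_def by blast
    also have "\<dots> < e"
    proof -
      have "0 \<le> C * e" using C \<open>e > 0\<close> by simp
      then have "0 < C * e + e * 4" using \<open>e > 0\<close> by simp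
      then show ?thesis using \<open>e > 0\<close> C by (simp add: field_simps)
    qed
    finally show ?thesis by (simp add: dist_norm)
  qed
  ultimately show "\<exists>U. openin T U \<and> x \<in> U \<and> (\<forall>y\<in>U. dist (f y) (f x) < e)" by blast
qed

text \<open>Members of \<open>equi\<close> vanish outside the group, where \<open>conv\<close> has
  uncontrolled values.\<close>

definition extend0 :: "('g \<Rightarrow> complex) \<Rightarrow> 'g \<Rightarrow> complex" where
  "extend0 f x = (if x \<in> carrier G then f x else 0)"

lemma extend0 [simp]: "x \<in> carrier G \<Longrightarrow> extend0 f x = f x"
  by (simp add: extend0_def)

text \<open>The squared L2 distance between the two sides of the eigenvector equation. It turns the
  search for an eigenvector into the minimisation of a continuous functional on a compact
  family.\<close>

definition defect :: "('g \<Rightarrow> complex) \<Rightarrow> real \<Rightarrow> ('g \<Rightarrow> complex) \<Rightarrow> real" where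
  "defect u \<kappa> f = \<nu> (\<lambda>x. conv u (conv (adj u) f) x - complex_of_real \<kappa> * f x)"

section \<open>A top eigenvector of a convolution operator\<close>

context
  fixes u b assumes u: "cont u" and b: "\<And>x. x \<in> carrier G \<Longrightarrow> norm (u x) \<le> b"
begin

lemma b_nonneg: "b \<ge> 0" using b[OF one_closed] norm_ge_zero order_trans by blast

lemma b_adj: "x \<in> carrier G \<Longrightarrow> norm (adj u x) \<le> b"
  using b by (simp add: adj_def)

lemma norm_conv2_le:
  assumes f: "cont f" and le: "\<And>x. x \<in> carrier G \<Longrightarrow> norm (f x) \<le> B" and x: "x \<in> carrier G"
  shows "norm (conv u (conv (adj u) f) x) \<le> b\<^sup>2 * B"
proof -
  have "norm (conv (adj u) f y) \<le> b * B" if "y \<in> carrier G" for y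
  proof -
    have "norm (conv (adj u) f y) \<le> b * ell1 f"
      using u f that b_adj by (intro norm_conv_le cont_adj)
    also have "\<dots> \<le> b * B" by (intro mult_left_mono ell1_le le b_nonneg)
    finally show ?thesis .
  qed
  then have "ell1 (conv (adj u) f) \<le> b * B" by (rule ell1_le)
  moreover have "norm (conv u (conv (adj u) f) x) \<le> b * ell1 (conv (adj u) f)"
    using u f x b by (intro norm_conv_le cont_conv cont_adj)
  ultimately show ?thesis
    using b_nonneg mult_left_mono[of "ell1 (conv (adj u) f)" "b * B" b] by (simp add: power2_eq_square mult.assoc)
qed

lemma continuous_on_\<nu>:
  assumes "C \<ge> 0" "B \<ge> 0" shows "continuous_on (equi u C B) \<nu>"
proof (rule continuous_on_equi[OF u assms(1), of "2 * B"])
  fix f h d assume fh: "f \<in> equi u C B" "h \<in> equi u C B"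
    and le: "\<And>x. x \<in> carrier G \<Longrightarrow> norm (h x - f x) \<le> d"
  then show "\<bar>\<nu> h - \<nu> f\<bar> \<le> 2 * B * d"
    using cont_equi[OF u assms(1)] by (intro \<nu>_lipschitz) (auto simp: equi_def)
qed (use assms in simp)

text \<open>The operator inside \<open>defect\<close> has uniform norm at most
  \<open>b\<^sup>2 + \<kappa>\<close>, so the Lipschitz estimate for \<open>\<nu>\<close> carries
  over with this factor applied to the bound \<open>B\<close> and to the distance
  \<open>d\<close>.\<close>

lemma continuous_on_defect:
  assumes C: "C \<ge> 0" and B: "B \<ge> 0" and \<kappa>: "\<kappa> \<ge> 0" shows "continuous_on (equi u C B) (defect u \<kappa>)"
proof (rule continuous_on_equi[OF u C])
  let ?S = "\<lambda>f x. conv u (conv (adj u) f) x - complex_of_real \<kappa> * f x"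
  show "2 * ((b\<^sup>2 + \<kappa>) * B) * (b\<^sup>2 + \<kappa>) \<ge> 0" using assms by (intro mult_nonneg_nonneg) auto
  fix f h d assume f: "f \<in> equi u C B" and h: "h \<in> equi u C B"
    and le: "\<And>x. x \<in> carrier G \<Longrightarrow> norm (h x - f x) \<le> d"
  have cf: "cont f" "cont h" using cont_equi[OF u C] f h by blast+
  have bound: "norm (?S f x) \<le> (b\<^sup>2 + \<kappa>) * B"
    if f: "cont f" and B: "\<And>x. x \<in> carrier G \<Longrightarrow> norm (f x) \<le> B" and x: "x \<in> carrier G" for f x B
  proof -
    have "norm (?S f x) \<le> norm (conv u (conv (adj u) f) x) + norm (complex_of_real \<kappa> * f x)"
      by (rule norm_triangle_ineq4)
    also have "\<dots> \<le> b\<^sup>2 * B + \<kappa> * B"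
      using norm_conv2_le[OF f B x] B[OF x] \<kappa> by (intro add_mono) (auto simp: norm_mult mult_left_mono)
    finally show ?thesis by (simp add: algebra_simps)
  qed
  have "\<bar>\<nu> (?S h) - \<nu> (?S f)\<bar> \<le> 2 * ((b\<^sup>2 + \<kappa>) * B) * ((b\<^sup>2 + \<kappa>) * d)"
  proof (rule \<nu>_lipschitz)
    show "cont (?S f)" "cont (?S h)"
      using cf u by (intro ctsI cont_conv cont_adj; simp)+
    fix x assume x: "x \<in> carrier G"
    show "norm (?S f x) \<le> (b\<^sup>2 + \<kappa>) * B" "norm (?S h x) \<le> (b\<^sup>2 + \<kappa>) * B"
      using f h cf x by (auto intro!: bound simp: equi_def)
    have "?S h x - ?S f x = ?S (\<lambda>x. h x - f x) x"
    proof -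
      have "conv u (conv (adj u) (\<lambda>x. h x - f x)) x = conv u (\<lambda>x. conv (adj u) h x - conv (adj u) f x) x"
        using u cf x by (intro conv_cong conv_diff cont_conv cont_adj ctsI)
      also have "\<dots> = conv u (conv (adj u) h) x - conv u (conv (adj u) f) x"
        using u cf x by (intro conv_diff cont_conv cont_adj)
      finally show ?thesis by (simp add: algebra_simps)
    qed
    also have "norm \<dots> \<le> (b\<^sup>2 + \<kappa>) * d" using cf le x by (intro bound ctsI)
    finally show "norm (?S h x - ?S f x) \<le> (b\<^sup>2 + \<kappa>) * d" .
  qed
  then show "\<bar>defect u \<kappa> h - defect u \<kappa> f\<bar> \<le> 2 * ((b\<^sup>2 + \<kappa>) * B) * (b\<^sup>2 + \<kappa>) * d"
    by (simp add: defect_def mult.assoc)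
qed

lemma defect_cong:
  assumes "cont f" "\<And>x. x \<in> carrier G \<Longrightarrow> f x = h x"
  shows "defect u \<kappa> f = defect u \<kappa> h"
proof -
  have h: "cont h" using assms by (intro continuous_map_eq[of T euclidean f h]) auto
  have 1: "conv (adj u) f x = conv (adj u) h x" if "x \<in> carrier G" for x
    using that assms u by (intro conv_cong cont_adj)
  have "conv u (conv (adj u) f) x = conv u (conv (adj u) h) x" if "x \<in> carrier G" for x
    using that assms u 1 by (intro conv_cong cont_conv cont_adj)
  then show ?thesis unfolding defect_def
    using assms u by (intro \<nu>_cong ctsI cont_conv cont_adj) auto
qed

lemma defect_nonneg: "cont f \<Longrightarrow> 0 \<le> defect u \<kappa> f"
  unfolding defect_def using u by (intro \<nu>_nonneg ctsI cont_conv cont_adj) auto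

lemma defect_eq_0:
  assumes "cont f" "defect u \<kappa> f = 0" "x \<in> carrier G"
  shows "conv u (conv (adj u) f) x = complex_of_real \<kappa> * f x"
proof -
  have "conv u (conv (adj u) f) x - complex_of_real \<kappa> * f x = 0"
    using assms(2) unfolding defect_def
    by (rule \<nu>_eq_0[rotated]) (use assms u in \<open>auto intro!: ctsI cont_conv cont_adj\<close>)
  then show ?thesis by simp
qed

text \<open>If \<^term>\<open>\<kappa>\<close> is the squared norm of \<open>U = conv u\<close>, a vector \<open>h\<close> that almost attains the norm is
  almost an eigenvector of \<open>S = U* U\<close>, because \<open>U (h - S h / \<kappa>)\<close> has a nonnegative
  square norm.\<close>

lemma defect_le:
  assumes \<kappa>: "\<kappa> > 0" and bound: "\<And>h. cont h \<Longrightarrow> \<nu> (conv u h) \<le> \<kappa> * \<nu> h"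
    and h: "cont h" "\<nu> h \<le> 1"
  shows "defect u \<kappa> (conv u h) \<le> \<kappa>\<^sup>2 * (\<kappa> - \<nu> (conv u h))"
proof -
  let ?U = "conv u" and ?S = "\<lambda>h. conv (adj u) (conv u h)"
  have c: "cont (?U h)" "cont (?S h)" "cont (?U (?S h))"
    using u h by (auto intro!: cont_conv cont_adj)
  have 1: "ip (?U (?S h)) (?U h) = complex_of_real (\<nu> (?S h))"
    using ip_conv[OF u c(2) c(1)] ip_self[OF c(2)] by simp
  have 2: "ip h (?S h) = complex_of_real (\<nu> (?U h))"
    using ip_conv[OF u h(1) c(1)] ip_self[OF c(1)] by simp
  let ?g = "\<lambda>x. h x - complex_of_real (1/\<kappa>) * ?S h x"
  have cg: "cont ?g" using h c by (intro ctsI) auto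
  have "0 \<le> \<nu> (?U ?g)" by (intro \<nu>_nonneg cont_conv u cg)
  also have "\<nu> (?U ?g) = \<nu> (\<lambda>x. ?U h x - complex_of_real (1/\<kappa>) * ?U (?S h) x)"
  proof (rule \<nu>_cong)
    show "cont (?U ?g)" by (intro cont_conv u cg)
    fix x assume x: "x \<in> carrier G"
    show "?U ?g x = ?U h x - complex_of_real (1/\<kappa>) * ?U (?S h) x"
      using conv_diff[OF u h(1) _ x, of "\<lambda>y. complex_of_real (1/\<kappa>) * ?S h y"]
        conv_scale[OF u c(2) x, of "complex_of_real (1/\<kappa>)"] c(2)
      by (simp only: ctsI continuous_map_const topspace_euclidean UNIV_I simp_thms)
  qed
  also have "\<dots> = \<nu> (?U h) - 2 * (1/\<kappa>) * \<nu> (?S h) + (1/\<kappa>)\<^sup>2 * \<nu> (?U (?S h))"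
    unfolding \<nu>_diff_scale[OF c(1) c(3)] using 1 Re_ip_commute[OF c(1) c(3)] by simp
  also have "\<dots> \<le> \<nu> (?U h) - 2 * (1/\<kappa>) * \<nu> (?S h) + (1/\<kappa>)\<^sup>2 * (\<kappa> * \<nu> (?S h))"
    using bound[OF c(2)] by (intro add_left_mono mult_left_mono) auto
  also have "\<dots> = \<nu> (?U h) - \<nu> (?S h) / \<kappa>"
    using \<kappa> by (simp add: power2_eq_square field_simps)
  finally have S: "\<nu> (?S h) \<le> \<kappa> * \<nu> (?U h)" using \<kappa> by (simp add: field_simps)
  let ?d = "\<lambda>x. ?S h x - complex_of_real \<kappa> * h x"
  have cd: "cont ?d" using c h by (intro ctsI) auto
  have "\<nu> ?d = \<nu> (?S h) - 2 * \<kappa> * \<nu> (?U h) + \<kappa>\<^sup>2 * \<nu> h"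
    using \<nu>_diff_scale[OF c(2) h(1), of \<kappa>] Re_ip_commute[OF c(2) h(1)] 2 by simp
  also have "\<dots> \<le> \<kappa> * \<nu> (?U h) - 2 * \<kappa> * \<nu> (?U h) + \<kappa>\<^sup>2 * 1"
    using S h by (intro add_mono diff_right_mono mult_left_mono) auto
  finally have d: "\<nu> ?d \<le> \<kappa> * (\<kappa> - \<nu> (?U h))" by (simp add: algebra_simps power2_eq_square)
  \<comment> \<open>\<open>?U\<close> intertwines \<open>?S\<close> with the operator inside
    \<open>defect\<close>; applying it to \<open>?d\<close> costs another factor
    \<open>\<kappa>\<close>.\<close>
  have "defect u \<kappa> (?U h) = \<nu> (?U ?d)"
    unfolding defect_def
  proof (rule \<nu>_cong)
    show "cont (\<lambda>x. ?U (?S h) x - complex_of_real \<kappa> * ?U h x)" using c by (intro ctsI) auto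
    fix x assume x: "x \<in> carrier G"
    show "?U (?S h) x - complex_of_real \<kappa> * ?U h x = ?U ?d x"
      using conv_diff[OF u c(2) _ x, of "\<lambda>y. complex_of_real \<kappa> * h y"]
        conv_scale[OF u h(1) x, of "complex_of_real \<kappa>"] h(1)
      by (simp only: ctsI continuous_map_const topspace_euclidean UNIV_I simp_thms)
  qed
  also have "\<dots> \<le> \<kappa> * \<nu> ?d" by (rule bound[OF cd])
  also have "\<dots> \<le> \<kappa> * (\<kappa> * (\<kappa> - \<nu> (?U h)))" using d \<kappa> by (intro mult_left_mono) auto
  finally show ?thesis by (simp add: power2_eq_square mult.assoc)
qed

text \<open>The argument of \<open>conv u h\<close> enters only through \<open>u\<close>, so its
  modulus of continuity is that of the translates of \<open>u\<close> times \<open>ell1 h\<close>.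
  This expresses that convolution by \<open>u\<close> is a compact operator.\<close>

lemma conv_in_equi:
  assumes "cont h" "ell1 h \<le> C" "C \<ge> 0"
  shows "extend0 (conv u h) \<in> equi u C (b * C)"
  unfolding equi_def
proof (intro CollectI conjI allI impI)
  fix x assume "x \<in> carrier G"
  then have "norm (conv u h x) \<le> b * ell1 h" using u assms b by (intro norm_conv_le)
  also have "\<dots> \<le> b * C" using assms b_nonneg by (intro mult_left_mono)
  finally show "norm (extend0 (conv u h) x) \<le> b * C" using \<open>x \<in> carrier G\<close> by simp
next
  fix x y e assume a: "x \<in> carrier G \<and> y \<in> carrier G \<and>
        (\<forall>z\<in>carrier G. norm (u (x \<otimes> inv z) - u (y \<otimes> inv z)) \<le> e)"
  then have "0 \<le> e" using one_closed norm_ge_zero order_trans by blast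
  have "norm (conv u h x - conv u h y) \<le> e * ell1 h" using a u assms by (intro norm_conv_diff_le) auto
  also have "\<dots> \<le> e * C" using assms \<open>0 \<le> e\<close> by (intro mult_left_mono)
  finally show "norm (extend0 (conv u h) x - extend0 (conv u h) y) \<le> C * e"
    using a by (simp add: mult.commute)
qed (simp add: extend0_def)

text \<open>\<open>\<kappa>\<close> is the squared operator norm of \<open>conv u\<close>. Images of
  nearly maximising vectors lie in the compact set \<open>W\<close> and have arbitrarily small
  defect, so the minimum of the defect on \<open>W\<close> is 0. The condition
  \<open>\<kappa> / 2 \<le> \<nu> f\<close> in \<open>W\<close> keeps the minimiser away from
  0.\<close>

lemma ex_eigenvector:
  assumes nz: "x0 \<in> carrier G" "u x0 \<noteq> 0"
  obtains \<kappa> v where "\<kappa> > 0" "cont v" "\<nu> v > 0"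
    "\<And>x. x \<in> carrier G \<Longrightarrow> conv u (conv (adj u) v) x = complex_of_real \<kappa> * v x"
proof -
  define Q where "Q = {\<nu> (conv u h) | h. cont h \<and> \<nu> h \<le> 1}"
  define \<kappa> where "\<kappa> = Sup Q"
  have le_b: "\<nu> (conv u h) \<le> b\<^sup>2" if h: "cont h" "\<nu> h \<le> 1" for h
  proof -
    have "norm (conv u h x) \<le> b" if "x \<in> carrier G" for x
      using norm_conv_le[OF u h(1) that b] mult_left_mono[OF ell1_le_1[OF h] b_nonneg] by simp
    then have "norm (\<mu> (\<lambda>x. conv u h x * cnj (conv u h x))) \<le> b\<^sup>2"
      by (intro \<mu>.norm_le) (simp add: norm_mult power2_eq_square mult_mono b_nonneg)
    then show ?thesis unfolding \<nu>_def using complex_Re_le_cmod order_trans by blast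
  qed
  then have bdd: "bdd_above Q" unfolding Q_def by (auto simp: bdd_above_def)
  have zero: "cont (\<lambda>x. 0)" "\<nu> (\<lambda>x. 0) \<le> 1" by (auto simp: \<nu>_def)
  then have "Q \<noteq> {}" unfolding Q_def by blast
  have upper: "\<nu> (conv u h) \<le> \<kappa>" if "cont h" "\<nu> h \<le> 1" for h
    unfolding \<kappa>_def using that by (intro cSup_upper bdd) (auto simp: Q_def)
  have bound: "\<nu> (conv u h) \<le> \<kappa> * \<nu> h" if h: "cont h" for h
  proof (cases "\<nu> h = 0")
    case True
    then have "conv u h x = 0" if "x \<in> carrier G" for x
      using conv_cong[OF u h that, of "\<lambda>x. 0"] \<nu>_eq_0[OF h] by (simp add: conv_def)
    then have "\<nu> (conv u h) = \<nu> (\<lambda>x. 0)" using u h by (intro \<nu>_cong cont_conv)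
    then show ?thesis using True by (simp add: \<nu>_def)
  next
    case False
    then have pos: "\<nu> h > 0" using \<nu>_nonneg[OF h] by simp
    let ?c = "complex_of_real (1 / sqrt (\<nu> h))"
    have c2: "(norm ?c)\<^sup>2 = 1 / \<nu> h" using pos by (simp add: norm_divide power_divide)
    have "\<nu> (conv u (\<lambda>x. ?c * h x)) = \<nu> (\<lambda>x. ?c * conv u h x)"
      using u h by (intro \<nu>_cong conv_scale cont_conv ctsI) auto
    also have "\<dots> = \<nu> (conv u h) / \<nu> h"
      unfolding \<nu>_scale[OF cont_conv[OF u h]] c2 by simp
    finally have "\<nu> (conv u h) / \<nu> h \<le> \<kappa>"
      using upper[of "\<lambda>x. ?c * h x"] h pos c2 by (simp add: \<nu>_scale ctsI del: of_real_divide)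
    then show ?thesis using pos by (simp add: divide_le_eq)
  qed
  have \<kappa>: "\<kappa> > 0"
  proof (rule ccontr)
    assume "\<not> \<kappa> > 0"
    \<comment> \<open>At the neutral element the convolution of \<open>u\<close> with this function
      is the square norm \<open>\<nu> ?h\<close>, so operator norm 0 would force \<open>u\<close> to
      vanish.\<close>
    let ?h = "\<lambda>y. cnj (u (inv y))"
    have cu: "cont (\<lambda>y. u (inv y))" by (intro cont_comp[OF u] ctsI)
    have h: "cont ?h" using cont_adj[OF u] by (simp add: adj_def[abs_def])
    have "\<nu> (conv u ?h) \<le> 0"
      using bound[OF h] \<nu>_nonneg[OF h] \<open>\<not> \<kappa> > 0\<close> by (smt (verit) mult_nonpos_nonneg)
    then have "\<nu> (conv u ?h) = 0" using \<nu>_nonneg[OF cont_conv[OF u h]] by simp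
    then have "conv u ?h \<one> = 0" using \<nu>_eq_0[OF cont_conv[OF u h] _ one_closed] by simp
    moreover have "conv u ?h \<one> = \<mu> (\<lambda>y. ?h y * cnj (?h y))"
      unfolding conv_def
      by (rule \<mu>.cong) (auto intro!: cont_bounded continuous_map_mult_complex h cu)
    ultimately have "\<nu> ?h = 0" by (simp add: \<nu>_def)
    then have "?h (inv x0) = 0" using nz by (intro \<nu>_eq_0[OF h]) auto
    then show False using nz by simp
  qed
  define W where "W = {f \<in> equi u 1 b. \<kappa> / 2 \<le> \<nu> f}"
  have cW: "cont f" if "f \<in> W" for f using that cont_equi[OF u, of 1 f b] by (simp add: W_def)
  have mem: "extend0 (conv u h) \<in> W" if h: "cont h" "\<nu> h \<le> 1" "\<nu> (conv u h) \<ge> \<kappa> / 2" for h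
  proof -
    have "extend0 (conv u h) \<in> equi u 1 (b * 1)"
      using h ell1_le_1 by (intro conv_in_equi) auto
    moreover have "\<nu> (extend0 (conv u h)) = \<nu> (conv u h)"
      using u h by (intro \<nu>_cong[symmetric] cont_conv) auto
    ultimately show ?thesis using h by (simp add: W_def)
  qed
  have close: "\<exists>h. cont h \<and> \<nu> h \<le> 1 \<and> \<kappa> - \<delta> < \<nu> (conv u h)" if "\<delta> > 0" for \<delta>
  proof -
    have "\<kappa> - \<delta> < Sup Q" using that by (simp add: \<kappa>_def)
    then show ?thesis using \<open>Q \<noteq> {}\<close> bdd by (auto simp: less_cSup_iff Q_def)
  qed
  have "W = equi u 1 b \<inter> \<nu> -` {\<kappa>/2..}" by (auto simp: W_def)
  then have "closed W"
    using continuous_on_\<nu>[of 1 b] b_nonneg closed_equi by (simp add: continuous_closed_preimage)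
  moreover have "W \<subseteq> equi u 1 b" by (auto simp: W_def)
  ultimately have "compact W"
    using compact_equi[of u 1 b] by (metis closed_Int_compact inf.absorb_iff1)
  moreover have "W \<noteq> {}" using close[of "\<kappa>/2"] \<kappa> mem by force
  moreover have "continuous_on W (defect u \<kappa>)"
    using continuous_on_defect[of 1 b \<kappa>] b_nonneg \<kappa> by (rule_tac continuous_on_subset) (auto simp: W_def)
  ultimately obtain v where v: "v \<in> W" and min: "\<And>f. f \<in> W \<Longrightarrow> defect u \<kappa> v \<le> defect u \<kappa> f"
    using continuous_attains_inf[of W "defect u \<kappa>"] by blast
  have "defect u \<kappa> v \<le> 0"
  proof (rule ccontr)
    assume "\<not> defect u \<kappa> v \<le> 0"
    then have pos: "defect u \<kappa> v > 0" by simp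
    \<comment> \<open>The first bound puts the image of \<open>h\<close> into \<open>W\<close>, the
      second makes its defect smaller than the minimum.\<close>
    define \<delta> where "\<delta> = min (\<kappa>/2) (defect u \<kappa> v / \<kappa>\<^sup>2)"
    have "\<delta> > 0" using pos \<kappa> by (simp add: \<delta>_def)
    from close[OF this] obtain h where h: "cont h" "\<nu> h \<le> 1" "\<kappa> - \<delta> < \<nu> (conv u h)" by blast
    have "defect u \<kappa> v \<le> defect u \<kappa> (extend0 (conv u h))"
      using h by (intro min mem) (auto simp: \<delta>_def)
    also have "\<dots> = defect u \<kappa> (conv u h)"
      using u h by (intro defect_cong[symmetric] cont_conv) auto
    also have "\<dots> \<le> \<kappa>\<^sup>2 * (\<kappa> - \<nu> (conv u h))" by (rule defect_le[OF \<kappa> bound h(1,2)])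
    also have "\<dots> < \<kappa>\<^sup>2 * \<delta>" using h \<kappa> by (intro mult_strict_left_mono) auto
    also have "\<dots> \<le> \<kappa>\<^sup>2 * (defect u \<kappa> v / \<kappa>\<^sup>2)" by (intro mult_left_mono) (auto simp: \<delta>_def)
    also have "\<dots> = defect u \<kappa> v" using \<kappa> by simp
    finally show False by simp
  qed
  then have "defect u \<kappa> v = 0" using defect_nonneg[OF cW[OF v], of \<kappa>] by simp
  moreover have "\<nu> v > 0" using v \<kappa> by (auto simp: W_def)
  ultimately show thesis using \<kappa> cW[OF v] defect_eq_0[OF cW[OF v]] that by blast
qed

end

section \<open>Positive definite functions\<close>

definition pd_form :: "('g \<Rightarrow> complex) \<Rightarrow> nat \<Rightarrow> (nat \<Rightarrow> 'g) \<Rightarrow> (nat \<Rightarrow> complex) \<Rightarrow> complex" where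
  "pd_form p n x a = (\<Sum>i<n. \<Sum>j<n. a i * cnj (a j) * p (x i \<otimes> inv (x j)))"

definition pos_def :: "('g \<Rightarrow> complex) \<Rightarrow> bool" where
  "pos_def p \<longleftrightarrow> (\<forall>n x a. (\<forall>i<n. x i \<in> carrier G) \<longrightarrow> Im (pd_form p n x a) = 0 \<and> 0 \<le> Re (pd_form p n x a))"

lemma pos_defD:
  assumes "pos_def p" "\<forall>i<n. x i \<in> carrier G"
  shows "Im (pd_form p n x a) = 0 \<and> 0 \<le> Re (pd_form p n x a)"
  using assms by (simp add: pos_def_def)

lemma pos_def_cong:
  assumes "pos_def p" "\<And>x. x \<in> carrier G \<Longrightarrow> p x = q x" shows "pos_def q"
proof -
  have "pd_form p n x a = pd_form q n x a" if "\<forall>i<n. x i \<in> carrier G" for n x a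
    unfolding pd_form_def using that assms(2) by (intro sum.cong) auto
  then show ?thesis using assms(1) by (simp add: pos_def_def)
qed

lemma pd_form_add: "pd_form (\<lambda>y. p y + q y) n x a = pd_form p n x a + pd_form q n x a"
  by (simp add: pd_form_def distrib_left sum.distrib)

lemma pd_form_scale: "pd_form (\<lambda>y. c * p y) n x a = c * pd_form p n x a"
  by (simp add: pd_form_def sum_distrib_left mult_ac)

lemma pos_def_add: "pos_def p \<Longrightarrow> pos_def q \<Longrightarrow> pos_def (\<lambda>y. p y + q y)"
  by (simp add: pos_def_def pd_form_add)

lemma pos_def_scale: "pos_def p \<Longrightarrow> r \<ge> 0 \<Longrightarrow> pos_def (\<lambda>y. complex_of_real r * p y)"
  by (simp add: pos_def_def pd_form_scale)

text \<open>The form at the two points \<open>x\<close> and \<open>\<one>\<close>; special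
  coefficients then give the symmetry of \<open>p\<close> and its bound by 1.\<close>

lemma pos_def_two:
  assumes p: "pos_def p" and x: "x \<in> carrier G"
  defines "z \<equiv> \<lambda>\<alpha> \<beta>. \<alpha> * cnj \<alpha> * p \<one> + \<alpha> * cnj \<beta> * p x + \<beta> * cnj \<alpha> * p (inv x) + \<beta> * cnj \<beta> * p \<one>"
  shows "Im (z \<alpha> \<beta>) = 0" "0 \<le> Re (z \<alpha> \<beta>)"
proof -
  let ?x = "\<lambda>i::nat. if i = 0 then x else \<one>" and ?a = "\<lambda>i::nat. if i = 0 then \<alpha> else \<beta>"
  have "{..<2::nat} = {0, 1}" by auto
  then have "pd_form p 2 ?x ?a = z \<alpha> \<beta>"
    using x by (simp add: pd_form_def z_def add.assoc)
  moreover have "\<forall>i<2. ?x i \<in> carrier G" using x by simp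
  note pos_defD[OF p this, of ?a]
  ultimately show "Im (z \<alpha> \<beta>) = 0" "0 \<le> Re (z \<alpha> \<beta>)" by simp_all
qed

lemma pos_def_normalised:
  assumes p: "pos_def p" and p1: "p \<one> = 1" and x: "x \<in> carrier G"
  shows "p (inv x) = cnj (p x)" "norm (p x) \<le> 1"
proof -
  have "Im (p x) + Im (p (inv x)) = 0" using pos_def_two(1)[OF p x, of 1 1] p1 by simp
  moreover have "Re (p x) = Re (p (inv x))" using pos_def_two(1)[OF p x, of \<i> 1] p1 by simp
  ultimately show h: "p (inv x) = cnj (p x)" by (simp add: complex_eq_iff)
  \<comment> \<open>The coefficient \<open>- cnj (p x)\<close> minimises the form when the other
    coefficient is 1.\<close>
  have "0 \<le> Re (1 - p x * cnj (p x))"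
    using pos_def_two(2)[OF p x, of "- cnj (p x)" 1] p1 h by (simp add: mult.commute)
  then have "(norm (p x))\<^sup>2 \<le> 1\<^sup>2" by (simp flip: complex_norm_square)
  then show "norm (p x) \<le> 1" by (rule power2_le_imp_le) simp
qed

text \<open>The form is that of \<open>p\<close> for twice as many points: the \<open>x i\<close>
  with coefficients \<open>a i\<close> and the \<open>g \<otimes> x i\<close> with coefficients
  \<open>c * a i\<close>. The two diagonal blocks give \<open>2 * p\<close>, the mixed ones the
  translates. An extreme \<open>p\<close> will be tested against these perturbations.\<close>

lemma pos_def_perturb:
  assumes p: "pos_def p" and g: "g \<in> carrier G" and c: "c * cnj c = 1"
  shows "pos_def (\<lambda>y. 2 * p y + (c * p (g \<otimes> y) + cnj c * p (inv g \<otimes> y)))"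
  unfolding pos_def_def
proof (intro allI impI)
  fix n :: nat and x a assume x: "\<forall>i<n. x i \<in> carrier G"
  define x' where "x' = (\<lambda>i. if i < n then x i else g \<otimes> x (i - n))"
  define a' where "a' = (\<lambda>i. if i < n then a i else c * a (i - n))"
  let ?q = "\<lambda>y. 2 * p y + (c * p (g \<otimes> y) + cnj c * p (inv g \<otimes> y))"
  have eq: "a i * cnj (a j) * ?q (x i \<otimes> inv (x j)) =
      a i * cnj (a j) * p (x i \<otimes> inv (x j)) + a i * cnj (c * a j) * p (x i \<otimes> inv (g \<otimes> x j))
      + (c * a i * cnj (a j) * p (g \<otimes> x i \<otimes> inv (x j)) + c * a i * cnj (c * a j) * p (g \<otimes> x i \<otimes> inv (g \<otimes> x j)))"
    if "i < n" "j < n" for i j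
  proof -
    have xs: "x i \<in> carrier G" "x j \<in> carrier G" using that x by auto
    have "x i \<otimes> inv (g \<otimes> x j) = inv g \<otimes> (x i \<otimes> inv (x j))"
      using xs g by (simp add: inv_mult_group m_ac)
    moreover have "g \<otimes> x i \<otimes> inv (g \<otimes> x j) = (g \<otimes> inv g) \<otimes> (x i \<otimes> inv (x j))"
      using xs g by (simp only: inv_mult_group m_ac m_closed inv_closed)
    then have "g \<otimes> x i \<otimes> inv (g \<otimes> x j) = x i \<otimes> inv (x j)"
      using xs g by simp
    moreover have "g \<otimes> x i \<otimes> inv (x j) = g \<otimes> (x i \<otimes> inv (x j))"
      using xs g by (simp add: m_assoc)
    moreover have "c * a i * cnj (c * a j) = a i * cnj (a j)"
      using c by (simp add: mult_ac)
    ultimately show ?thesis using c by (simp add: algebra_simps)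
  qed
  have "pd_form p (n + n) x' a' = pd_form ?q n x a"
    unfolding pd_form_def sum_lessThan_add sum.distrib[symmetric]
    by (intro sum.cong refl) (simp add: x'_def a'_def eq)
  moreover have "\<forall>i<n + n. x' i \<in> carrier G" using x g by (auto simp: x'_def)
  note pos_defD[OF p this, of a']
  ultimately show "Im (pd_form ?q n x a) = 0 \<and> 0 \<le> Re (pd_form ?q n x a)" by simp
qed

lemma closed_pos_def: "closed {p. pos_def p}"
proof -
  have "{p. pos_def p} = {p. \<forall>n x a. (\<forall>i<n. x i \<in> carrier G) \<longrightarrow> Im (pd_form p n x a) = 0 \<and> 0 \<le> Re (pd_form p n x a)}"
    by (simp add: pos_def_def)
  also have "closed \<dots>"
    unfolding pd_form_def
    by (intro closed_Collect_conj closed_Collect_all closed_Collect_imp closed_Collect_eq closed_Collect_le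
        open_Collect_const continuous_intros continuous_on_product_coordinates)
  finally show ?thesis .
qed

text \<open>The matrix coefficient of the regular representation at \<open>f\<close> and
  \<open>v\<close>.\<close>

definition corr :: "('g \<Rightarrow> complex) \<Rightarrow> ('g \<Rightarrow> complex) \<Rightarrow> 'g \<Rightarrow> complex" where
  "corr f v z = \<mu> (\<lambda>x. f (z \<otimes> x) * cnj (v x))"

lemma cont_corr: assumes f: "cont f" and v: "cont v" shows "cont (corr f v)"
  unfolding corr_def[abs_def] by (intro cont_mean ctsI cont_comp[OF f] cont_comp[OF v])

text \<open>Convolution commutes with the translations in \<open>corr\<close>, up to an interchange
  of means. Hence \<open>corr v v\<close> is an eigenfunction whenever \<open>v\<close> is.\<close>

lemma conv_corr:
  assumes k: "cont k" and f: "cont f" and v: "cont v" and z: "z \<in> carrier G"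
  shows "conv k (corr f v) z = corr (conv k f) v z"
proof -
  let ?F = "\<lambda>y x. k (z \<otimes> inv y) * (f (y \<otimes> x) * cnj (v x))"
  have F: "cont2 ?F" by (intro ctsI cont_comp[OF k] cont_comp[OF f] cont_comp[OF v] z)
  have "conv k (corr f v) z = \<mu> (\<lambda>y. \<mu> (\<lambda>x. ?F y x))"
    unfolding conv_def
  proof (rule \<mu>.cong)
    show "bounded ((\<lambda>y. k (z \<otimes> inv y) * corr f v y) ` carrier G)"
      by (intro cont_bounded continuous_map_mult_complex cont_kernel cont_corr assms)
    fix y assume y: "y \<in> carrier G"
    show "k (z \<otimes> inv y) * corr f v y = \<mu> (\<lambda>x. ?F y x)"
      unfolding corr_def
      by (intro \<mu>.scale[symmetric] cont_bounded ctsI cont_translate f v y)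
  qed
  also have "\<dots> = \<mu> (\<lambda>x. \<mu> (\<lambda>y. ?F y x))" by (rule mean_swap[OF F])
  also have "\<dots> = corr (conv k f) v z"
    unfolding corr_def
  proof (rule \<mu>.cong)
    show "bounded ((\<lambda>x. \<mu> (\<lambda>y. ?F y x)) ` carrier G)"
      by (intro cont_bounded cont_mean[of "\<lambda>x y. ?F y x"] cont2_swap[of ?F] F)
    fix x assume x: "x \<in> carrier G"
    have "\<mu> (\<lambda>y. ?F y x) = \<mu> (\<lambda>y. k (z \<otimes> inv y) * f (x \<otimes> y) * cnj (v x))"
    proof (rule \<mu>.cong)
      show "bounded ((\<lambda>y. ?F y x) ` carrier G)" by (rule cont_bounded[OF cont2_left[OF F x]])
    qed (use x in \<open>simp add: m_comm\<close>)
    also have "\<dots> = conv k (\<lambda>y. f (x \<otimes> y)) z * cnj (v x)"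
      unfolding conv_def
      by (intro \<mu>.scale_right cont_bounded continuous_map_mult_complex cont_kernel cont_translate k f x z)
    also have "\<dots> = conv k f (z \<otimes> x) * cnj (v x)"
      using conv_translate[OF k f x z] x z by (simp add: m_comm)
    finally show "\<mu> (\<lambda>y. ?F y x) = conv k f (z \<otimes> x) * cnj (v x)" .
  qed
  finally show ?thesis .
qed

text \<open>By invariance of the mean the form equals the square norm of the combination
  \<open>?h\<close> of translates of \<open>v\<close>.\<close>

lemma pos_def_corr:
  assumes v: "cont v" shows "pos_def (corr v v)"
  unfolding pos_def_def
proof (intro allI impI)
  fix n :: nat and x a assume x: "\<forall>i<n. x i \<in> carrier G"
  let ?h = "\<lambda>y. \<Sum>i<n. a i * v (x i \<otimes> y)"
  have tv: "cont (\<lambda>y. v (x i \<otimes> y))" if "i < n" for i using x that by (intro cont_translate v) auto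
  have ch: "cont ?h"
    by (intro continuous_map_sum continuous_map_mult_complex tv) auto
  have tr: "corr v v (x i \<otimes> inv (x j)) = \<mu> (\<lambda>y. v (x i \<otimes> y) * cnj (v (x j \<otimes> y)))"
    if "i < n" "j < n" for i j
  proof -
    have xs: "x i \<in> carrier G" "x j \<in> carrier G" using that x by auto
    let ?f = "\<lambda>y. v (x i \<otimes> inv (x j) \<otimes> y) * cnj (v y)"
    have f: "cont ?f"
      by (intro continuous_map_mult_complex continuous_map_cnj cont_translate v m_closed inv_closed xs)
    have "corr v v (x i \<otimes> inv (x j)) = \<mu> (\<lambda>y. ?f (x j \<otimes> y))"
      unfolding corr_def using mean_translate[OF f xs(2)] by simp
    also have "\<dots> = \<mu> (\<lambda>y. v (x i \<otimes> y) * cnj (v (x j \<otimes> y)))"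
    proof (rule \<mu>.cong)
      show "bounded ((\<lambda>y. ?f (x j \<otimes> y)) ` carrier G)" by (intro cont_bounded cont_translate[OF f] xs)
      fix y assume "y \<in> carrier G"
      then have "x i \<otimes> inv (x j) \<otimes> (x j \<otimes> y) = x i \<otimes> (inv (x j) \<otimes> x j) \<otimes> y"
        using xs by (simp only: m_assoc m_closed inv_closed)
      then show "?f (x j \<otimes> y) = v (x i \<otimes> y) * cnj (v (x j \<otimes> y))"
        using xs \<open>y \<in> carrier G\<close> by simp
    qed
    finally show ?thesis .
  qed
  have c: "cont (\<lambda>y. v (x i \<otimes> y) * cnj (v (x j \<otimes> y)))" if "i < n" "j < n" for i j
    by (intro continuous_map_mult_complex continuous_map_cnj tv that)
  have "pd_form (corr v v) n x a = (\<Sum>i<n. \<Sum>j<n. \<mu> (\<lambda>y. a i * cnj (a j) * (v (x i \<otimes> y) * cnj (v (x j \<otimes> y)))))"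
    unfolding pd_form_def using c by (intro sum.cong refl) (simp add: tr \<mu>.scale cont_bounded)
  also have "\<dots> = (\<Sum>i<n. \<mu> (\<lambda>y. \<Sum>j<n. a i * cnj (a j) * (v (x i \<otimes> y) * cnj (v (x j \<otimes> y)))))"
    using c by (intro sum.cong refl \<mu>.sum[symmetric] bounded_image_scale cont_bounded) auto
  also have "\<dots> = \<mu> (\<lambda>y. \<Sum>i<n. \<Sum>j<n. a i * cnj (a j) * (v (x i \<otimes> y) * cnj (v (x j \<otimes> y))))"
    using c by (intro \<mu>.sum[symmetric] bounded_image_sum bounded_image_scale cont_bounded) auto
  also have "\<dots> = \<mu> (\<lambda>y. ?h y * cnj (?h y))"
    by (simp add: sum_product mult_ac)
  also have "\<dots> = complex_of_real (\<nu> ?h)" by (rule mean_norm_square[OF ch])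
  finally show "Im (pd_form (corr v v) n x a) = 0 \<and> 0 \<le> Re (pd_form (corr v v) n x a)"
    using \<nu>_nonneg[OF ch] by simp
qed

text \<open>The last term makes the strict convexity of \<open>\<nu>\<close> quantitative: where a
  maximiser is a proper convex combination of two candidates, it forces their difference to have
  norm 0.\<close>

lemma \<nu>_convex_combination:
  assumes f: "cont f" and h: "cont h"
  shows "\<nu> (\<lambda>x. complex_of_real t * f x + complex_of_real (1 - t) * h x) =
    t * \<nu> f + (1 - t) * \<nu> h - t * (1 - t) * \<nu> (\<lambda>x. f x - h x)"
proof -
  let ?d = "\<lambda>x. f x - h x"
  have d: "cont ?d" using f h by (intro ctsI)
  have "\<nu> h = \<nu> (\<lambda>x. f x - complex_of_real 1 * ?d x)" by simp
  also have "\<dots> = \<nu> f - 2 * Re (ip f ?d) + \<nu> ?d" unfolding \<nu>_diff_scale[OF f d] by simp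
  finally have r: "Re (ip f ?d) = (\<nu> f + \<nu> ?d - \<nu> h) / 2" by simp
  have eq: "(\<lambda>x. complex_of_real t * f x + complex_of_real (1 - t) * h x) = (\<lambda>x. f x - complex_of_real (1 - t) * ?d x)"
    by (simp add: algebra_simps fun_eq_iff)
  show ?thesis unfolding eq \<nu>_diff_scale[OF f d] r by (simp add: algebra_simps power2_eq_square)
qed

section \<open>Characters as extreme positive definite eigenfunctions\<close>

definition eigenfunction :: "('g \<Rightarrow> complex) \<Rightarrow> real \<Rightarrow> ('g \<Rightarrow> complex) \<Rightarrow> bool" where
  "eigenfunction u \<kappa> f \<longleftrightarrow> cont f \<and> (\<forall>x\<in>carrier G. conv u (conv (adj u) f) x = complex_of_real \<kappa> * f x)"

definition pd_eigenfunctions :: "('g \<Rightarrow> complex) \<Rightarrow> real \<Rightarrow> ('g \<Rightarrow> complex) set" where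
  "pd_eigenfunctions u \<kappa> = {f. (\<forall>x. x \<notin> carrier G \<longrightarrow> f x = 0) \<and> eigenfunction u \<kappa> f \<and> pos_def f \<and> f \<one> = 1}"

lemma eigenfunction_cong:
  assumes u: "cont u" and f: "eigenfunction u \<kappa> f" "\<And>x. x \<in> carrier G \<Longrightarrow> f x = h x"
  shows "eigenfunction u \<kappa> h"
proof -
  have cf: "cont f" using f by (simp add: eigenfunction_def)
  then have "cont h" using f(2) by (intro continuous_map_eq[of T euclidean f h]) auto
  moreover have "conv u (conv (adj u) h) x = complex_of_real \<kappa> * h x" if x: "x \<in> carrier G" for x
  proof -
    have "conv (adj u) f y = conv (adj u) h y" if "y \<in> carrier G" for y
      by (intro conv_cong cont_adj u cf that f)
    then have "conv u (conv (adj u) f) x = conv u (conv (adj u) h) x"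
      by (rule conv_cong[OF u cont_conv[OF cont_adj[OF u] cf] x])
    then show ?thesis using f x by (simp add: eigenfunction_def)
  qed
  ultimately show ?thesis by (simp add: eigenfunction_def)
qed

lemma eigenfunction_scale:
  assumes u: "cont u" and f: "eigenfunction u \<kappa> f"
  shows "eigenfunction u \<kappa> (\<lambda>x. c * f x)"
proof -
  have cf: "cont f" using f by (simp add: eigenfunction_def)
  have "conv u (conv (adj u) (\<lambda>x. c * f x)) x = complex_of_real \<kappa> * (c * f x)" if x: "x \<in> carrier G" for x
  proof -
    have cc: "cont (\<lambda>x. c * f x)" using cf by (intro ctsI) auto
    have "conv u (conv (adj u) (\<lambda>x. c * f x)) x = conv u (\<lambda>y. c * conv (adj u) f y) x"
      by (intro conv_cong conv_scale cont_conv cont_adj cc u cf x)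
    also have "\<dots> = c * conv u (conv (adj u) f) x"
      by (intro conv_scale cont_conv cont_adj u cf x)
    finally show ?thesis using f x by (simp add: eigenfunction_def)
  qed
  moreover have "cont (\<lambda>x. c * f x)" using cf by (intro ctsI) auto
  ultimately show ?thesis by (simp add: eigenfunction_def)
qed

lemma eigenfunction_add:
  assumes u: "cont u" and f: "eigenfunction u \<kappa> f" and h: "eigenfunction u \<kappa> h"
  shows "eigenfunction u \<kappa> (\<lambda>x. f x + h x)"
proof -
  have cf: "cont f" "cont h" using f h by (auto simp: eigenfunction_def)
  have "conv u (conv (adj u) (\<lambda>x. f x + h x)) x = complex_of_real \<kappa> * (f x + h x)" if x: "x \<in> carrier G" for x
  proof -
    have "conv u (conv (adj u) (\<lambda>x. f x + h x)) x = conv u (\<lambda>y. conv (adj u) f y + conv (adj u) h y) x"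
      by (intro conv_cong conv_add cont_conv cont_adj ctsI u cf x)
    also have "\<dots> = conv u (conv (adj u) f) x + conv u (conv (adj u) h) x"
      by (intro conv_add cont_conv cont_adj u cf x)
    finally show ?thesis using f h x by (simp add: eigenfunction_def distrib_left)
  qed
  moreover have "cont (\<lambda>x. f x + h x)" using cf by (intro ctsI)
  ultimately show ?thesis by (simp add: eigenfunction_def)
qed

lemma eigenfunction_translate:
  assumes u: "cont u" and f: "eigenfunction u \<kappa> f" and a: "a \<in> carrier G"
  shows "eigenfunction u \<kappa> (\<lambda>x. f (a \<otimes> x))"
proof -
  have cf: "cont f" using f by (simp add: eigenfunction_def)
  have "conv u (conv (adj u) (\<lambda>x. f (a \<otimes> x))) x = complex_of_real \<kappa> * f (a \<otimes> x)" if x: "x \<in> carrier G" for x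
  proof -
    have "conv u (conv (adj u) (\<lambda>x. f (a \<otimes> x))) x = conv u (\<lambda>y. conv (adj u) f (a \<otimes> y)) x"
      by (intro conv_cong conv_translate cont_conv cont_adj cont_translate u cf x a)
    also have "\<dots> = conv u (conv (adj u) f) (a \<otimes> x)"
      by (intro conv_translate cont_conv cont_adj u cf x a)
    finally show ?thesis using f x a by (simp add: eigenfunction_def)
  qed
  moreover have "cont (\<lambda>x. f (a \<otimes> x))" by (intro cont_translate cf a)
  ultimately show ?thesis by (simp add: eigenfunction_def)
qed

lemma pd_eigenfunctionsI:
  assumes u: "cont u" and f: "eigenfunction u \<kappa> f" "pos_def f" and r: "f \<one> = complex_of_real r" "r > 0"
  shows "extend0 (\<lambda>x. complex_of_real (1 / r) * f x) \<in> pd_eigenfunctions u \<kappa>"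
proof -
  let ?h = "\<lambda>x. complex_of_real (1 / r) * f x"
  have "eigenfunction u \<kappa> (extend0 ?h)"
    by (rule eigenfunction_cong[OF u eigenfunction_scale[OF u f(1), of "complex_of_real (1 / r)"]]) simp
  moreover have "pos_def (extend0 ?h)"
    by (rule pos_def_cong[OF pos_def_scale[OF f(2), of "1 / r"]]) (use r in auto)
  ultimately show ?thesis using r by (simp add: pd_eigenfunctions_def) (simp add: extend0_def)
qed

text \<open>The witness is the diagonal coefficient \<open>corr v v\<close>, divided by its value
  \<open>\<nu> v\<close> at the neutral element.\<close>

lemma ex_pd_eigenfunction:
  assumes u: "cont u" and v: "eigenfunction u \<kappa> v" "\<nu> v > 0"
  shows "pd_eigenfunctions u \<kappa> \<noteq> {}"
proof -
  have cv: "cont v" using v by (simp add: eigenfunction_def)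
  have "conv u (conv (adj u) (corr v v)) z = complex_of_real \<kappa> * corr v v z" if z: "z \<in> carrier G" for z
  proof -
    have "conv u (conv (adj u) (corr v v)) z = conv u (corr (conv (adj u) v) v) z"
      by (intro conv_cong cont_conv cont_adj cont_corr conv_corr u cv z)
    also have "\<dots> = corr (conv u (conv (adj u) v)) v z"
      by (intro conv_corr cont_conv cont_adj u cv z)
    also have "\<dots> = \<mu> (\<lambda>x. complex_of_real \<kappa> * (v (z \<otimes> x) * cnj (v x)))"
      unfolding corr_def
    proof (rule \<mu>.cong)
      show "bounded ((\<lambda>x. conv u (conv (adj u) v) (z \<otimes> x) * cnj (v x)) ` carrier G)"
        by (intro cont_bounded continuous_map_mult_complex continuous_map_cnj cont_translate cont_conv cont_adj u cv z)
    qed (use v z in \<open>simp add: eigenfunction_def\<close>)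
    also have "\<dots> = complex_of_real \<kappa> * corr v v z"
      unfolding corr_def
      by (intro \<mu>.scale cont_bounded continuous_map_mult_complex continuous_map_cnj cont_translate cv z)
    finally show ?thesis .
  qed
  then have "eigenfunction u \<kappa> (corr v v)" by (simp add: eigenfunction_def cont_corr cv)
  moreover have "corr v v \<one> = complex_of_real (\<nu> v)"
  proof -
    have "corr v v \<one> = \<mu> (\<lambda>x. v x * cnj (v x))" unfolding corr_def
      by (rule \<mu>.cong[symmetric]) (auto intro!: cont_bounded ctsI cv)
    then show ?thesis by (simp add: mean_norm_square cv)
  qed
  ultimately show ?thesis using pd_eigenfunctionsI[OF u _ pos_def_corr[OF cv] _ v(2)] by blast
qed

text \<open>The eigenvector equation writes \<open>f\<close> as a convolution with kernel
  \<open>u\<close>, divided by \<open>\<kappa>\<close>, so the moduli of continuity are controlled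
  by \<open>b / \<kappa>\<close>. Positive definiteness gives the uniform bound 1.\<close>

lemma compact_pd_eigenfunctions:
  assumes u: "cont u" and \<kappa>: "\<kappa> > 0"
  obtains C where "C \<ge> 0" "pd_eigenfunctions u \<kappa> \<subseteq> equi u C 1" "compact (pd_eigenfunctions u \<kappa>)"
proof -
  obtain b where b: "\<And>x. x \<in> carrier G \<Longrightarrow> norm (u x) \<le> b"
    using cont_bounded[OF u] unfolding bounded_image_iff by blast
  have b0: "b \<ge> 0" using b[OF one_closed] norm_ge_zero order_trans by blast
  define C where "C = b / \<kappa>"
  have C: "C \<ge> 0" using b0 \<kappa> by (simp add: C_def)
  have sub: "pd_eigenfunctions u \<kappa> \<subseteq> equi u C 1"
  proof
    fix f assume f: "f \<in> pd_eigenfunctions u \<kappa>"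
    have cf: "cont f" and pf: "pos_def f" "f \<one> = 1"
      and eig: "\<And>x. x \<in> carrier G \<Longrightarrow> conv u (conv (adj u) f) x = complex_of_real \<kappa> * f x"
      using f by (auto simp: pd_eigenfunctions_def eigenfunction_def)
    have f1: "norm (f x) \<le> 1" if "x \<in> carrier G" for x using pos_def_normalised[OF pf that] by simp
    have "norm (conv (adj u) f x) \<le> b" if "x \<in> carrier G" for x
    proof -
      have "norm (conv (adj u) f x) \<le> b * ell1 f"
        using b by (intro norm_conv_le cont_adj u cf that) (simp add: adj_def)
      also have "\<dots> \<le> b * 1" by (intro mult_left_mono ell1_le f1 b0)
      finally show ?thesis by simp
    qed
    then have l: "ell1 (conv (adj u) f) \<le> b" by (rule ell1_le)
    have "norm (f x - f y) \<le> C * e"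
      if x: "x \<in> carrier G" and y: "y \<in> carrier G"
        and e: "\<forall>z\<in>carrier G. norm (u (x \<otimes> inv z) - u (y \<otimes> inv z)) \<le> e" for x y e
    proof -
      have e0: "0 \<le> e" using e one_closed norm_ge_zero order_trans by blast
      have "norm (complex_of_real \<kappa> * (f x - f y)) = norm (conv u (conv (adj u) f) x - conv u (conv (adj u) f) y)"
        using eig[OF x] eig[OF y] by (simp add: right_diff_distrib)
      also have "\<dots> \<le> e * ell1 (conv (adj u) f)"
        using e by (intro norm_conv_diff_le cont_conv cont_adj u cf x y) auto
      also have "\<dots> \<le> e * b" using l e0 by (intro mult_left_mono)
      finally have "\<kappa> * norm (f x - f y) \<le> e * b"
        using \<kappa> by (simp only: norm_mult norm_of_real abs_of_pos)
      then show ?thesis using \<kappa> by (simp add: C_def field_simps)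
    qed
    then show "f \<in> equi u C 1"
      using f f1 unfolding equi_def pd_eigenfunctions_def by blast
  qed
  \<comment> \<open>Inside \<open>equi\<close> the eigenvector equation is the zero set of the
    continuous functional \<open>defect\<close>, hence a closed condition.\<close>
  have "pd_eigenfunctions u \<kappa> = (equi u C 1 \<inter> defect u \<kappa> -` {0}) \<inter> {p. pos_def p} \<inter> {p. p \<one> = 1}"
  proof (intro equalityI subsetI)
    fix f assume f: "f \<in> pd_eigenfunctions u \<kappa>"
    then have "cont f" and
      "\<And>x. x \<in> carrier G \<Longrightarrow> conv u (conv (adj u) f) x - complex_of_real \<kappa> * f x = 0"
      by (auto simp: pd_eigenfunctions_def eigenfunction_def)
    then have "defect u \<kappa> f = \<nu> (\<lambda>x. 0)"
      unfolding defect_def using u by (intro \<nu>_cong ctsI cont_conv cont_adj) auto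
    then show "f \<in> (equi u C 1 \<inter> defect u \<kappa> -` {0}) \<inter> {p. pos_def p} \<inter> {p. p \<one> = 1}"
      using f sub by (auto simp: \<nu>_def pd_eigenfunctions_def)
  next
    fix f assume f: "f \<in> (equi u C 1 \<inter> defect u \<kappa> -` {0}) \<inter> {p. pos_def p} \<inter> {p. p \<one> = 1}"
    then have cf: "cont f" using cont_equi[OF u C] by blast
    have "eigenfunction u \<kappa> f"
      using f defect_eq_0[OF u b cf] cf by (auto simp: eigenfunction_def)
    then show "f \<in> pd_eigenfunctions u \<kappa>" using f by (auto simp: pd_eigenfunctions_def equi_def)
  qed
  moreover have "closed (equi u C 1 \<inter> defect u \<kappa> -` {0})"
    using continuous_on_defect[OF u b C, of 1 \<kappa>] \<kappa> closed_equi by (simp add: continuous_closed_preimage)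
  moreover have "closed {p. p \<one> = (1::complex)}"
    by (intro closed_Collect_eq continuous_intros continuous_on_product_coordinates)
  ultimately have "closed (pd_eigenfunctions u \<kappa>)" using closed_pos_def by (simp only: closed_Int)
  with sub C show thesis using compact_equi[of u C 1] that by (metis closed_Int_compact inf.absorb_iff1)
qed

text \<open>After normalisation \<open>q\<close> and \<open>r\<close> become members
  \<open>p1\<close> and \<open>p2\<close> of the set, and \<open>p\<close> is their convex
  combination with weights \<open>(1 + \<delta>) / 2\<close> and \<open>(1 - \<delta>) / 2\<close>.
  Maximality of \<open>p\<close> and strict convexity of \<open>\<nu>\<close> make all three
  equal.\<close>

lemma extremal_decomposition:
  assumes u: "cont u" and p: "p \<in> pd_eigenfunctions u \<kappa>"
    and max: "\<And>q. q \<in> pd_eigenfunctions u \<kappa> \<Longrightarrow> \<nu> q \<le> \<nu> p"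
    and q: "eigenfunction u \<kappa> q" "pos_def q" "q \<one> = complex_of_real (1 + \<delta>)"
    and r: "eigenfunction u \<kappa> r" "pos_def r" "r \<one> = complex_of_real (1 - \<delta>)"
    and sum: "\<And>x. x \<in> carrier G \<Longrightarrow> q x + r x = 2 * p x"
    and \<delta>: "\<bar>\<delta>\<bar> < 1" and x: "x \<in> carrier G"
  shows "q x = complex_of_real (1 + \<delta>) * p x"
proof -
  define p1 p2 where "p1 = extend0 (\<lambda>x. complex_of_real (1 / (1 + \<delta>)) * q x)"
    and "p2 = extend0 (\<lambda>x. complex_of_real (1 / (1 - \<delta>)) * r x)"
  have m: "p1 \<in> pd_eigenfunctions u \<kappa>" "p2 \<in> pd_eigenfunctions u \<kappa>"
    using \<delta> unfolding p1_def p2_def by (intro pd_eigenfunctionsI u q r; simp)+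
  have c: "cont p" "cont p1" "cont p2"
    using p m by (auto simp: pd_eigenfunctions_def eigenfunction_def)
  define t where "t = (1 + \<delta>) / 2"
  have t: "0 < t" "t < 1" "1 - t = (1 - \<delta>) / 2" using \<delta> by (auto simp: t_def field_simps)
  have q': "q x = 2 * complex_of_real t * p1 x" and r': "r x = 2 * complex_of_real (1 - t) * p2 x"
    if "x \<in> carrier G" for x
  proof -
    have "complex_of_real (1 + \<delta>) \<noteq> 0" "complex_of_real (1 - \<delta>) \<noteq> 0"
      using \<delta> by (simp_all only: of_real_eq_0_iff)
    then show "q x = 2 * complex_of_real t * p1 x" "r x = 2 * complex_of_real (1 - t) * p2 x"
      using that unfolding t(3) by (simp_all add: t_def p1_def p2_def)
  qed
  have "\<nu> p = \<nu> (\<lambda>x. complex_of_real t * p1 x + complex_of_real (1 - t) * p2 x)"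
  proof (rule \<nu>_cong[OF c(1)])
    fix x assume x: "x \<in> carrier G"
    show "p x = complex_of_real t * p1 x + complex_of_real (1 - t) * p2 x"
    proof -
      have "2 * (complex_of_real t * p1 x + complex_of_real (1 - t) * p2 x) = 2 * p x"
        using sum[OF x] unfolding q'[OF x] r'[OF x] by (simp add: algebra_simps)
      then show ?thesis by (metis mult_left_cancel zero_neq_numeral)
    qed
  qed
  also have "\<dots> = t * \<nu> p1 + (1 - t) * \<nu> p2 - t * (1 - t) * \<nu> (\<lambda>x. p1 x - p2 x)"
    by (rule \<nu>_convex_combination[OF c(2,3)])
  also have "\<dots> \<le> t * \<nu> p + (1 - t) * \<nu> p - t * (1 - t) * \<nu> (\<lambda>x. p1 x - p2 x)"
    using t max m by (intro diff_right_mono add_mono mult_left_mono) auto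
  finally have "t * (1 - t) * \<nu> (\<lambda>x. p1 x - p2 x) \<le> 0" by (simp add: algebra_simps)
  moreover have d: "cont (\<lambda>x. p1 x - p2 x)" using c by (intro ctsI)
  moreover have "t * (1 - t) > 0" using t by simp
  ultimately have "\<nu> (\<lambda>x. p1 x - p2 x) = 0"
    using \<nu>_nonneg[OF d] by (smt (verit) mult_pos_pos)
  then have "p1 x - p2 x = 0" using \<nu>_eq_0[OF d _ x] by simp
  then have "2 * p x = 2 * p1 x"
    using sum[OF x] unfolding q'[OF x] r'[OF x] by (simp add: algebra_simps)
  then show ?thesis using q'[OF x] by (simp add: t_def)
qed

text \<open>\<open>p\<close> is the average of the positive definite eigenfunctions
  \<open>q c\<close> and \<open>q (- c)\<close>, so extremality makes \<open>q c\<close> a multiple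
  of \<open>p\<close>. The cases \<open>c = 1\<close> and \<open>c = \<i>\<close> give two linear
  equations for \<open>p (g \<otimes> y)\<close> and \<open>p (inv g \<otimes> y)\<close>.\<close>

lemma maximal_pd_eigenfunction_multiplicative:
  assumes u: "cont u" and p: "p \<in> pd_eigenfunctions u \<kappa>"
    and max: "\<And>q. q \<in> pd_eigenfunctions u \<kappa> \<Longrightarrow> \<nu> q \<le> \<nu> p"
    and g: "g \<in> carrier G" and y: "y \<in> carrier G"
  shows "p (g \<otimes> y) = p g * p y"
proof -
  have eig: "eigenfunction u \<kappa> p" and pd: "pos_def p" and p1: "p \<one> = 1"
    using p by (auto simp: pd_eigenfunctions_def)
  \<comment> \<open>With the factor 1/4, \<open>q c\<close> is half of \<open>p\<close> plus a
    quarter of the function from \<open>pos_def_perturb\<close>, and its value at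
    \<open>\<one>\<close> differs from 1 by at most 1/2.\<close>
  define q where "q = (\<lambda>c y. p y + (1/4) * (c * p (g \<otimes> y) + cnj c * p (inv g \<otimes> y)))"
  have qe: "eigenfunction u \<kappa> (q c)" for c
    unfolding q_def
    by (intro eigenfunction_add eigenfunction_scale eigenfunction_translate u eig g inv_closed)
  have qp: "pos_def (q c)" if "c * cnj c = 1" for c
  proof -
    have "pos_def (\<lambda>y. complex_of_real (1/2) * p y +
        complex_of_real (1/4) * (2 * p y + (c * p (g \<otimes> y) + cnj c * p (inv g \<otimes> y))))"
      by (intro pos_def_add pos_def_scale pos_def_perturb pd g that) auto
    then show ?thesis by (rule pos_def_cong) (simp add: q_def field_simps)
  qed
  have q1: "q c \<one> = complex_of_real (1 + Re (c * p g) / 2)" for c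
  proof -
    have "c * p g + cnj c * cnj (p g) = complex_of_real (2 * Re (c * p g))"
      by (simp add: complex_eq_iff)
    then show ?thesis using p1 g pos_def_normalised(1)[OF pd p1 g] 
      by (simp add: q_def complex_eq_iff field_simps)
  qed
  have main: "q c y = complex_of_real (1 + Re (c * p g) / 2) * p y" if c: "c * cnj c = 1" for c
  proof (rule extremal_decomposition[OF u p max qe qp[OF c] q1 qe])
    have "norm (c * p g) \<le> 1"
    proof -
      have "(norm c)\<^sup>2 = 1" using c by (metis complex_norm_square of_real_eq_1_iff)
      then have "norm c = 1" by (simp add: power2_eq_1_iff) (metis norm_ge_zero not_one_le_zero neg_0_le_iff_le)
      then show ?thesis using pos_def_normalised(2)[OF pd p1 g] by (simp add: norm_mult)
    qed
    then show "\<bar>Re (c * p g) / 2\<bar> < 1" using abs_Re_le_cmod[of "c * p g"] by linarith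
    show "pos_def (q (- c))" using qp[of "- c"] c by simp
    show "q (- c) \<one> = complex_of_real (1 - Re (c * p g) / 2)" unfolding q1 by simp
    show "q c x + q (- c) x = 2 * p x" for x
      by (simp add: q_def field_simps)
  qed (use y in auto)
  define A B where "A = p (g \<otimes> y)" and "B = p (inv g \<otimes> y)"
  have lin: "z = 4 * r * w" if "w + (1/4) * z = (1 + r) * w" for z r w :: complex
  proof -
    have "(1/4) * z = r * w" using that by (simp only: distrib_right mult_1_left add_left_cancel)
    then have "4 * ((1/4) * z) = 4 * (r * w)" by simp
    then show ?thesis by simp
  qed
  have "p y + (1/4) * (A + B) = (1 + complex_of_real (Re (p g) / 2)) * p y"
    using main[of 1] by (simp add: q_def A_def B_def)
  from lin[OF this] have 1: "A + B = complex_of_real (2 * Re (p g)) * p y" by simp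
  have "p y + (1/4) * (\<i> * (A - B)) = (1 + complex_of_real (- Im (p g) / 2)) * p y"
    using main[of \<i>] by (simp add: q_def A_def B_def right_diff_distrib diff_divide_distrib)
  from lin[OF this] have "\<i> * (A - B) = - complex_of_real (2 * Im (p g)) * p y" by simp
  then have "\<i> * (\<i> * (A - B)) = \<i> * (- complex_of_real (2 * Im (p g)) * p y)" by simp
  then have "- (A - B) = - (\<i> * complex_of_real (2 * Im (p g)) * p y)"
    by (simp only: mult.assoc[symmetric] i_squared) simp
  then have 2: "A - B = \<i> * complex_of_real (2 * Im (p g)) * p y" by (simp only: neg_equal_iff_equal)
  have "2 * A = (A + B) + (A - B)" by simp
  also have "\<dots> = 2 * ((complex_of_real (Re (p g)) + \<i> * complex_of_real (Im (p g))) * p y)"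
    unfolding 1 2 by (simp add: algebra_simps)
  also have "\<dots> = 2 * (p g * p y)" using complex_eq[of "p g"] by simp
  finally show ?thesis by (simp add: A_def)
qed

text \<open>Extensionality makes characters equal once they agree on the group, so that they can
  serve as indices of sums.\<close>

definition characters :: "('g \<Rightarrow> complex) set" where
  "characters = {\<omega> \<in> extensional (carrier G). cont \<omega> \<and> (\<forall>x\<in>carrier G. norm (\<omega> x) = 1) \<and>
     (\<forall>x\<in>carrier G. \<forall>y\<in>carrier G. \<omega> (x \<otimes> y) = \<omega> x * \<omega> y)}"

text \<open>Among the positive definite functions in an eigenspace of the compact positive operator
  \<^term>\<open>\<lambda>f. conv u (conv (adj u) f)\<close> the extreme ones are characters. One maximising the strictly
  convex function \<^term>\<open>\<nu>\<close> is extreme.\<close>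

theorem ex_character_mean_nonzero:
  assumes u: "cont u" and nz: "x0 \<in> carrier G" "u x0 \<noteq> 0"
  obtains \<omega> where "\<omega> \<in> characters" "\<mu> (\<lambda>x. u x * cnj (\<omega> x)) \<noteq> 0"
proof -
  obtain b where b: "\<And>x. x \<in> carrier G \<Longrightarrow> norm (u x) \<le> b"
    using cont_bounded[OF u] unfolding bounded_image_iff by blast
  obtain \<kappa> v where \<kappa>: "\<kappa> > 0" and v: "cont v" "\<nu> v > 0"
    "\<And>x. x \<in> carrier G \<Longrightarrow> conv u (conv (adj u) v) x = complex_of_real \<kappa> * v x"
    using ex_eigenvector[OF u b nz] by metis
  then have "eigenfunction u \<kappa> v" by (simp add: eigenfunction_def)
  then have ne: "pd_eigenfunctions u \<kappa> \<noteq> {}" by (rule ex_pd_eigenfunction[OF u _ v(2)])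
  obtain C where C: "C \<ge> 0" "pd_eigenfunctions u \<kappa> \<subseteq> equi u C 1" "compact (pd_eigenfunctions u \<kappa>)"
    using compact_pd_eigenfunctions[OF u \<kappa>] by blast
  have "continuous_on (pd_eigenfunctions u \<kappa>) \<nu>"
    using continuous_on_subset[OF continuous_on_\<nu>[OF u b C(1), of 1] C(2)] by simp
  from continuous_attains_sup[OF C(3) ne this]
  obtain p where p: "p \<in> pd_eigenfunctions u \<kappa>" and max: "\<And>q. q \<in> pd_eigenfunctions u \<kappa> \<Longrightarrow> \<nu> q \<le> \<nu> p"
    by blast
  note mult = maximal_pd_eigenfunction_multiplicative[OF u p max]
  have eig: "eigenfunction u \<kappa> p" and pd: "pos_def p" and p1: "p \<one> = 1" and cp: "cont p"
    using p by (auto simp: pd_eigenfunctions_def eigenfunction_def)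
  have norm1: "norm (p x) = 1" if x: "x \<in> carrier G" for x
  proof -
    have "p x * p (inv x) = 1" using mult[of x "inv x"] x p1 by simp
    then have "norm (p x) * norm (p x) = 1"
      using pos_def_normalised(1)[OF pd p1 x] by (metis complex_mod_cnj norm_mult norm_one)
    then show ?thesis by (metis abs_norm_cancel abs_square_eq_1 power2_eq_square)
  qed
  define \<omega> where "\<omega> = restrict p (carrier G)"
  have "cont \<omega>" using cp by (rule continuous_map_eq) (simp add: \<omega>_def)
  then have char: "\<omega> \<in> characters"
    using norm1 mult by (auto simp: characters_def \<omega>_def)
  \<comment> \<open>If \<open>u\<close> were orthogonal to \<open>p\<close>, convolution with
    \<open>adj u\<close> would annihilate \<open>p\<close>, against the eigenvector equation at
    \<open>\<one>\<close> with \<open>\<kappa> > 0\<close>.\<close>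
  have "\<mu> (\<lambda>x. u x * cnj (p x)) \<noteq> 0"
  proof
    assume 0: "\<mu> (\<lambda>x. u x * cnj (p x)) = 0"
    have "conv (adj u) p x = 0" if x: "x \<in> carrier G" for x
    proof -
      let ?f = "\<lambda>y. adj u (x \<otimes> inv y) * p y"
      have f: "cont ?f" by (intro continuous_map_mult_complex cont_kernel cont_adj u cp x)
      have "conv (adj u) p x = \<mu> (\<lambda>y. ?f (x \<otimes> y))"
        unfolding conv_def using mean_translate[OF f x] by simp
      also have "\<dots> = \<mu> (\<lambda>y. p x * cnj (u y * cnj (p y)))"
      proof (rule \<mu>.cong)
        show "bounded ((\<lambda>y. ?f (x \<otimes> y)) ` carrier G)" by (intro cont_bounded cont_translate[OF f] x)
        fix y assume y: "y \<in> carrier G"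
        have "inv (x \<otimes> inv (x \<otimes> y)) = (inv x \<otimes> x) \<otimes> y"
          using x y by (simp only: inv_mult_group inv_inv m_ac m_closed inv_closed)
        then show "?f (x \<otimes> y) = p x * cnj (u y * cnj (p y))"
          using x y mult by (simp add: adj_def)
      qed
      also have "\<dots> = p x * cnj (\<mu> (\<lambda>y. u y * cnj (p y)))"
        by (subst \<mu>.scale, intro cont_bounded ctsI u cp, subst \<mu>.cnj) (auto intro!: cont_bounded ctsI u cp)
      finally show ?thesis using 0 by simp
    qed
    then have "conv u (conv (adj u) p) \<one> = conv u (\<lambda>x. 0) \<one>"
      by (intro conv_cong cont_conv cont_adj u cp one_closed)
    then have "complex_of_real \<kappa> * p \<one> = 0" using eig by (simp add: eigenfunction_def conv_def)
    then show False using p1 \<kappa> by simp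
  qed
  moreover have "\<mu> (\<lambda>x. u x * cnj (p x)) = \<mu> (\<lambda>x. u x * cnj (\<omega> x))"
    by (rule \<mu>.cong) (auto simp: \<omega>_def intro!: cont_bounded ctsI u cp)
  ultimately show thesis using char that by simp
qed

end

section \<open>Characters\<close>

text \<open>By divisibility of the reals a maximal partial homomorphism is total.\<close>

lemma (in comm_group) ex_real_hom:
  assumes a: "a \<in> carrier G" and ord: "\<And>n::nat. n > 0 \<Longrightarrow> a [^] n \<noteq> \<one>"
  shows "\<exists>h :: 'a \<Rightarrow> real. (\<forall>x\<in>carrier G. \<forall>y\<in>carrier G. h (x \<otimes> y) = h x + h y) \<and> h a = 1"
proof -
  \<comment> \<open>Partial homomorphisms are represented by their graphs, subgroups of the product
    with the reals, so unions of chains need no gluing. Triviality over \<open>\<one>\<close> makes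
    a graph single-valued.\<close>
  define ok :: "('a \<times> real) set \<Rightarrow> bool" where
    "ok = (\<lambda>R. R \<subseteq> carrier G \<times> UNIV \<and> (\<forall>x s y t. (x, s) \<in> R \<and> (y, t) \<in> R \<longrightarrow> (x \<otimes> y, s + t) \<in> R) \<and>
       (\<forall>x s. (x, s) \<in> R \<longrightarrow> (inv x, - s) \<in> R) \<and> (\<forall>t. (\<one>, t) \<in> R \<longrightarrow> t = 0) \<and> (a, 1) \<in> R)"
  \<comment> \<open>The map sending the \<open>k\<close>-th power of \<open>a\<close> to
    \<open>k\<close> is well defined because \<open>a\<close> has infinite order.\<close>
  have "ok (range (\<lambda>k::int. (a [^] k, real_of_int k)))"
  proof -
    have "k = 0" if "a [^] (k::int) = \<one>" for k
    proof (rule ccontr)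
      assume "k \<noteq> 0"
      then have "nat \<bar>k\<bar> > 0" by simp
      moreover have "a [^] nat \<bar>k\<bar> = \<one>"
      proof (cases "k \<ge> 0")
        case True then show ?thesis using that int_pow_int[of G a "nat k"] by simp
      next
        case False
        then have "a [^] (- k) = \<one>" using that a by (simp add: int_pow_neg)
        then show ?thesis using False int_pow_int[of G a "nat (- k)"] by simp
      qed
      ultimately show False using ord by blast
    qed
    moreover have "\<exists>k::int. (a, 1) = (a [^] k, real_of_int k)" using a by (intro exI[of _ 1]) simp
    ultimately show ?thesis
      unfolding ok_def using a
      by (auto simp: image_iff int_pow_mult[symmetric] int_pow_neg[symmetric] simp flip: of_int_add of_int_minus)
  qed
  then have "{R. ok R} \<noteq> {}" by blast
  moreover have "\<Union>C \<in> {R. ok R}" if C: "C \<noteq> {}" "subset.chain {R. ok R} C" for C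
  proof -
    have okC: "ok R" if "R \<in> C" for R using C(2) that by (auto simp: subset.chain_def)
    have tot: "R \<subseteq> R' \<or> R' \<subseteq> R" if "R \<in> C" "R' \<in> C" for R R'
      using C(2) that by (auto simp: subset.chain_def)
    have "ok (\<Union>C)"
      unfolding ok_def
    proof (intro conjI allI impI)
      show "\<Union>C \<subseteq> carrier G \<times> UNIV" using okC unfolding ok_def by blast
      fix x s y t assume "(x, s) \<in> \<Union>C \<and> (y, t) \<in> \<Union>C"
      then obtain R R' where "R \<in> C" "R' \<in> C" "(x, s) \<in> R" "(y, t) \<in> R'" by blast
      with tot[of R R'] obtain R'' where "R'' \<in> C" "(x, s) \<in> R''" "(y, t) \<in> R''" by blast
      then show "(x \<otimes> y, s + t) \<in> \<Union>C" using okC[of R''] unfolding ok_def by blast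
    next
      fix x s assume "(x, s) \<in> \<Union>C"
      then show "(inv x, - s) \<in> \<Union>C" using okC unfolding ok_def by blast
    next
      fix t assume "(\<one>, t) \<in> \<Union>C"
      then show "t = 0" using okC unfolding ok_def by blast
    next
      show "(a, 1) \<in> \<Union>C" using C(1) okC unfolding ok_def by blast
    qed
    then show ?thesis by simp
  qed
  ultimately obtain M where M: "ok M" and max: "\<And>R. ok R \<Longrightarrow> M \<subseteq> R \<Longrightarrow> R = M"
    using subset_Zorn_nonempty[of "{R. ok R}"] by auto
  have sub: "M \<subseteq> carrier G \<times> UNIV" and plus: "\<And>x s y t. (x, s) \<in> M \<Longrightarrow> (y, t) \<in> M \<Longrightarrow> (x \<otimes> y, s + t) \<in> M"
    and uminus: "\<And>x s. (x, s) \<in> M \<Longrightarrow> (inv x, - s) \<in> M" and zero: "\<And>t. (\<one>, t) \<in> M \<Longrightarrow> t = 0" and a1: "(a, 1) \<in> M"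
    using M unfolding ok_def by blast+
  have one: "(\<one>, 0) \<in> M" using plus[OF a1 uminus[OF a1]] a by simp
  have natpow: "(x [^] n, real n * s) \<in> M" if "(x, s) \<in> M" for x s and n :: nat
  proof (induction n)
    case (Suc n)
    from plus[OF Suc that] show ?case by (simp add: distrib_right add.commute)
  qed (use one in simp)
  have pow: "(x [^] k, real_of_int k * s) \<in> M" if xs: "(x, s) \<in> M" for x s and k :: int
  proof (cases "k \<ge> 0")
    case True then show ?thesis using natpow[OF xs, of "nat k"] int_pow_int[of G x "nat k"] by simp
  next
    case False
    have "x \<in> carrier G" using xs sub by blast
    then show ?thesis using False uminus[OF natpow[OF xs, of "nat (- k)"]] int_pow_neg_int[of x "nat (- k)"]
      by simp
  qed
  have single: "s = t" if "(x, s) \<in> M" "(x, t) \<in> M" for x s t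
  proof -
    have "x \<in> carrier G" using that sub by blast
    then have "s + - t = 0" using plus[OF that(1) uminus[OF that(2)]] by (intro zero) simp
    then show ?thesis by simp
  qed
  have total: "\<exists>t. (x, t) \<in> M" if x: "x \<in> carrier G" for x
  proof -
    \<comment> \<open>\<open>r\<close> is the value to assign to \<open>x\<close>. If a nonzero
      power of \<open>x\<close> already has a value, \<open>r\<close> is forced, and finding it
      requires division by the exponent; otherwise 0 will do.\<close>
    have "\<exists>r. \<forall>k::int. \<forall>t. (x [^] k, t) \<in> M \<longrightarrow> t = real_of_int k * r"
    proof (cases "\<exists>k t. k \<noteq> (0::int) \<and> (x [^] k, t) \<in> M")
      case True
      then obtain k :: int and t where kt: "k \<noteq> 0" "(x [^] k, t) \<in> M" by (elim exE conjE)
      have "t' = real_of_int k' * (t / real_of_int k)" if "(x [^] k', t') \<in> M" for k' t'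
      proof -
        have "(x [^] (k * k'), real_of_int k' * t) \<in> M" "(x [^] (k' * k), real_of_int k * t') \<in> M"
          using pow[OF kt(2), of k'] pow[OF that, of k] x by (simp_all add: int_pow_pow)
        then have "real_of_int k' * t = real_of_int k * t'" by (simp add: mult.commute single)
        then show ?thesis using kt by (simp add: field_simps)
      qed
      then show ?thesis by blast
    next
      case False
      have "t = real_of_int k * 0" if "(x [^] k, t) \<in> M" for k :: int and t
        using False that zero by (cases "k = 0") auto
      then show ?thesis by blast
    qed
    then obtain r where r: "\<And>k::int. \<And>t. (x [^] k, t) \<in> M \<Longrightarrow> t = real_of_int k * r" by blast
    define M' where "M' = {(y \<otimes> x [^] k, s + real_of_int k * r) | y s k. (y, s) \<in> M}"
    have M'I: "(y \<otimes> x [^] k, s + real_of_int k * r) \<in> M'" if "(y, s) \<in> M" for y s k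
      using that unfolding M'_def by blast
    have "ok M'"
      unfolding ok_def
    proof (intro conjI allI impI)
      show "M' \<subseteq> carrier G \<times> UNIV" using sub x by (auto simp: M'_def)
      fix y s z t assume "(y, s) \<in> M' \<and> (z, t) \<in> M'"
      then obtain y' s' k z' t' l where e: "(y', s') \<in> M" "(z', t') \<in> M" "y = y' \<otimes> x [^] (k::int)"
        "s = s' + real_of_int k * r" "z = z' \<otimes> x [^] (l::int)" "t = t' + real_of_int l * r"
        unfolding M'_def by auto
      then have c: "y' \<in> carrier G" "z' \<in> carrier G" using sub by blast+
      have "y \<otimes> z = (y' \<otimes> z') \<otimes> x [^] (k + l)" using c x e by (simp add: int_pow_mult m_ac)
      moreover have "s + t = (s' + t') + real_of_int (k + l) * r" using e by (simp add: algebra_simps)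
      ultimately show "(y \<otimes> z, s + t) \<in> M'" using M'I[OF plus[OF e(1,2)], of "k + l"] by simp
    next
      fix y s assume "(y, s) \<in> M'"
      then obtain y' s' k where e: "(y', s') \<in> M" "y = y' \<otimes> x [^] (k::int)" "s = s' + real_of_int k * r"
        unfolding M'_def by auto
      then have c: "y' \<in> carrier G" using sub by blast
      have "inv y = inv y' \<otimes> x [^] (- k)" using c x e by (simp add: inv_mult int_pow_neg)
      moreover have "- s = - s' + real_of_int (- k) * r" using e by simp
      ultimately show "(inv y, - s) \<in> M'" using M'I[OF uminus[OF e(1)]] by metis
    next
      fix t assume "(\<one>, t) \<in> M'"
      then obtain y s k where e: "(y, s) \<in> M" "\<one> = y \<otimes> x [^] (k::int)" "t = s + real_of_int k * r"
        unfolding M'_def by auto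
      then have "y \<in> carrier G" using sub by blast
      then have "inv y = x [^] k" using e x by (metis inv_equality int_pow_closed m_comm)
      then have "- s = real_of_int k * r" using r uminus[OF e(1)] by simp
      then show "t = 0" using e by simp
    next
      show "(a, 1) \<in> M'" using M'I[OF a1, of 0] a by simp
    qed
    moreover have "M \<subseteq> M'"
    proof
      fix p assume p: "p \<in> M"
      then have "fst p \<in> carrier G" using sub by auto
      then show "p \<in> M'" using M'I[of "fst p" "snd p" 0] p by simp
    qed
    ultimately have "M' = M" by (rule max)
    moreover have "(x, r) \<in> M'" using M'I[OF one, of 1] x by simp
    ultimately show ?thesis by blast
  qed
  define h where "h = (\<lambda>x. THE t. (x, t) \<in> M)"
  have h: "h x = t" if "(x, t) \<in> M" for x t
    unfolding h_def using that single by blast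
  show ?thesis
  proof (intro exI[of _ h] conjI ballI)
    fix x y assume "x \<in> carrier G" "y \<in> carrier G"
    then obtain s t where "(x, s) \<in> M" "(y, t) \<in> M" using total by blast
    then show "h (x \<otimes> y) = h x + h y" using plus[of x s y t] h by metis
  qed (rule h[OF a1])
qed

text \<open>The circle has no small subgroups. As long as the real part stays between 0 and 1,
  squaring at least doubles its distance from 1, so a nonzero distance eventually exceeds 1 and the
  real part becomes negative.\<close>

lemma eq_one_if_powers_Re_pos:
  fixes z :: complex
  assumes z: "norm z = 1" and pos: "\<And>n. Re (z ^ n) > 0"
  shows "z = 1"
proof -
  define c where "c = (\<lambda>k. Re (z ^ (2 ^ k)))"
  have c1: "c k \<le> 1" for k
    unfolding c_def using complex_Re_le_cmod[of "z ^ 2 ^ k"] z by (simp add: norm_power)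
  have step: "1 - c (Suc k) \<ge> 2 * (1 - c k)" for k
  proof -
    let ?w = "z ^ (2 ^ k)"
    have n: "(Re ?w)\<^sup>2 + (Im ?w)\<^sup>2 = 1"
      using cmod_power2[of ?w] z by (simp add: norm_power)
    have "z ^ (2 ^ Suc k) = ?w ^ 2" by (simp add: power_mult mult.commute flip: power_mult)
    then have "c (Suc k) = (Re ?w)\<^sup>2 - (Im ?w)\<^sup>2" by (simp add: c_def power2_eq_square)
    then have "1 - c (Suc k) = 2 * (1 - (c k)\<^sup>2)" using n by (simp add: c_def)
    moreover have "(c k)\<^sup>2 \<le> c k"
      using c1[of k] pos[of "2 ^ k"] by (simp add: c_def power2_eq_square mult_left_le)
    ultimately show ?thesis by simp
  qed
  have bound: "1 - c k \<ge> 2 ^ k * (1 - c 0)" for k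
  proof (induction k)
    case (Suc k)
    then show ?case using step[of k] by simp
  qed simp
  have "c 0 = 1"
  proof (rule ccontr)
    assume "c 0 \<noteq> 1"
    then have p: "1 - c 0 > 0" using c1[of 0] by simp
    obtain k where "1 / (1 - c 0) < 2 ^ k" using real_arch_pow[of 2] by auto
    then have "1 < 2 ^ k * (1 - c 0)" using p by (simp add: divide_less_eq)
    then show False using bound[of k] pos[of "2 ^ k"] by (simp add: c_def)
  qed
  then have "Re z = 1" by (simp add: c_def)
  moreover have "(Re z)\<^sup>2 + (Im z)\<^sup>2 = 1" using cmod_power2[of z] z by simp
  ultimately show ?thesis by (simp add: complex_eq_iff)
qed

section \<open>The character group: orthogonality, separation of points, orders\<close>

context compact_comm_group
begin

lemma charactersD:
  assumes "\<omega> \<in> characters"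
  shows "cont \<omega>" "\<omega> \<in> extensional (carrier G)" "x \<in> carrier G \<Longrightarrow> norm (\<omega> x) = 1"
    "x \<in> carrier G \<Longrightarrow> y \<in> carrier G \<Longrightarrow> \<omega> (x \<otimes> y) = \<omega> x * \<omega> y"
  using assms by (auto simp: characters_def)

lemma character_cnj: "\<omega> \<in> characters \<Longrightarrow> x \<in> carrier G \<Longrightarrow> \<omega> x * cnj (\<omega> x) = 1"
  using charactersD(3)[of \<omega> x] complex_norm_square[of "\<omega> x"] by simp

lemma character_nonzero: "\<omega> \<in> characters \<Longrightarrow> x \<in> carrier G \<Longrightarrow> \<omega> x \<noteq> 0"
  using charactersD(3)[of \<omega> x] by auto

lemma character_one: assumes "\<omega> \<in> characters" shows "\<omega> \<one> = 1"
  using charactersD(4)[OF assms one_closed one_closed] character_nonzero[OF assms one_closed] by simp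

lemma character_pow: "\<omega> \<in> characters \<Longrightarrow> x \<in> carrier G \<Longrightarrow> \<omega> (x [^] (n::nat)) = \<omega> x ^ n"
  by (induction n) (auto simp: character_one charactersD)

text \<open>The Pontryagin dual as an abstract group, to which \<open>ex_real_hom\<close>
  applies.\<close>

definition char_group :: "('g \<Rightarrow> complex) monoid" where
  "char_group = \<lparr>carrier = characters, monoid.mult = (\<lambda>\<omega> \<psi>. \<lambda>x\<in>carrier G. \<omega> x * \<psi> x), one = (\<lambda>x\<in>carrier G. 1)\<rparr>"

lemma cont_restrict: "cont f \<Longrightarrow> cont (restrict f (carrier G))"
  by (rule continuous_map_eq) auto

lemma one_character: "(\<lambda>x\<in>carrier G. 1) \<in> characters"
  unfolding characters_def by (auto intro!: cont_restrict)

lemma mult_character: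
  assumes "\<omega> \<in> characters" "\<psi> \<in> characters"
  shows "(\<lambda>x\<in>carrier G. \<omega> x * \<psi> x) \<in> characters"
proof -
  have "cont (\<lambda>x\<in>carrier G. \<omega> x * \<psi> x)"
    by (intro cont_restrict continuous_map_mult_complex charactersD assms)
  then show ?thesis using charactersD(3,4)[OF assms(1)] charactersD(3,4)[OF assms(2)]
    by (auto simp: characters_def norm_mult)
qed

lemma cnj_character:
  assumes "\<omega> \<in> characters" shows "(\<lambda>x\<in>carrier G. cnj (\<omega> x)) \<in> characters"
proof -
  have "cont (\<lambda>x\<in>carrier G. cnj (\<omega> x))"
    by (intro cont_restrict continuous_map_cnj charactersD assms)
  then show ?thesis using charactersD(3,4)[OF assms] by (auto simp: characters_def)
qed

lemma comm_group_char_group: "comm_group char_group"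
proof (rule comm_groupI)
  fix \<omega> assume w: "\<omega> \<in> carrier char_group"
  then have w': "\<omega> \<in> characters" by (simp add: char_group_def)
  show "\<one>\<^bsub>char_group\<^esub> \<otimes>\<^bsub>char_group\<^esub> \<omega> = \<omega>"
    using charactersD(2)[OF w'] by (auto simp: char_group_def fun_eq_iff extensional_def)
  show "\<exists>\<psi>\<in>carrier char_group. \<psi> \<otimes>\<^bsub>char_group\<^esub> \<omega> = \<one>\<^bsub>char_group\<^esub>"
    using cnj_character[OF w'] character_cnj[OF w']
    by (intro bexI[of _ "\<lambda>x\<in>carrier G. cnj (\<omega> x)"])
      (auto simp: char_group_def fun_eq_iff mult.commute)
qed (auto simp: char_group_def mult_character one_character mult_ac fun_eq_iff)

lemma char_group_pow:
  "\<omega> \<in> characters \<Longrightarrow> \<omega> [^]\<^bsub>char_group\<^esub> (n::nat) = (\<lambda>x\<in>carrier G. \<omega> x ^ n)"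
  by (induction n) (auto simp: nat_pow_def char_group_def fun_eq_iff mult.commute)

text \<open>Translation by an element \<open>g\<close> where the characters differ multiplies the
  mean by a factor other than 1, while invariance keeps it fixed.\<close>

lemma mean_character_orthogonal:
  assumes w: "\<omega> \<in> characters" and p: "\<psi> \<in> characters"
  shows "\<mu> (\<lambda>x. \<omega> x * cnj (\<psi> x)) = (if \<omega> = \<psi> then 1 else 0)"
proof (cases "\<omega> = \<psi>")
  case True
  have "\<mu> (\<lambda>x. \<omega> x * cnj (\<psi> x)) = \<mu> (\<lambda>x. 1)"
    using True w p by (intro \<mu>.cong cont_bounded ctsI charactersD) (auto simp: character_cnj)
  then show ?thesis using True by simp
next
  case False
  then obtain g where g: "g \<in> carrier G" "\<omega> g \<noteq> \<psi> g"
    using extensionalityI[OF charactersD(2)[OF w] charactersD(2)[OF p]] by blast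
  let ?f = "\<lambda>x. \<omega> x * cnj (\<psi> x)"
  have f: "cont ?f" using w p by (intro ctsI charactersD)
  have "\<mu> ?f = \<mu> (\<lambda>x. ?f (g \<otimes> x))" using mean_translate[OF f g(1)] by simp
  also have "\<dots> = \<mu> (\<lambda>x. ?f g * ?f x)"
    using g w p by (intro \<mu>.cong cont_bounded cont_translate[OF f]) (auto simp: charactersD)
  also have "\<dots> = ?f g * \<mu> ?f" using f by (intro \<mu>.scale cont_bounded)
  finally have "(1 - ?f g) * \<mu> ?f = 0" by (simp add: left_diff_distrib)
  moreover have "?f g \<noteq> 1"
  proof
    assume "?f g = 1"
    then have "?f g * \<psi> g = \<psi> g" by simp
    then have "\<omega> g = \<psi> g" using character_cnj[OF p g(1)] by (simp add: mult.assoc mult.commute[of "cnj (\<psi> g)"])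
    then show False using g by simp
  qed
  ultimately show ?thesis using False by simp
qed

lemma mean_character_combination:
  assumes S: "finite S" "S \<subseteq> characters" and p: "\<psi> \<in> characters"
  shows "\<mu> (\<lambda>x. (\<Sum>\<omega>\<in>S. c \<omega> * \<omega> x) * cnj (\<psi> x)) = (if \<psi> \<in> S then c \<psi> else 0)"
proof -
  have ct: "cont (\<lambda>x. \<omega> x * cnj (\<psi> x))" if "\<omega> \<in> S" for \<omega>
    using that S p by (intro ctsI charactersD) auto
  have "(\<lambda>x. (\<Sum>\<omega>\<in>S. c \<omega> * \<omega> x) * cnj (\<psi> x)) = (\<lambda>x. \<Sum>\<omega>\<in>S. c \<omega> * (\<omega> x * cnj (\<psi> x)))"
    by (simp add: sum_distrib_right mult.assoc)
  then have "\<mu> (\<lambda>x. (\<Sum>\<omega>\<in>S. c \<omega> * \<omega> x) * cnj (\<psi> x)) = (\<Sum>\<omega>\<in>S. \<mu> (\<lambda>x. c \<omega> * (\<omega> x * cnj (\<psi> x))))"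
    using ct by (simp add: \<mu>.sum bounded_image_scale cont_bounded)
  also have "\<dots> = (\<Sum>\<omega>\<in>S. if \<omega> = \<psi> then c \<omega> else 0)"
  proof (rule sum.cong[OF refl])
    fix \<omega> assume "\<omega> \<in> S"
    then show "\<mu> (\<lambda>x. c \<omega> * (\<omega> x * cnj (\<psi> x))) = (if \<omega> = \<psi> then c \<omega> else 0)"
      using mean_character_orthogonal[of \<omega> \<psi>] \<mu>.scale[OF cont_bounded[OF ct], of \<omega> "c \<omega>"] S p by auto
  qed
  finally show ?thesis using S by simp
qed

lemma characters_independent:
  assumes "finite S" "S \<subseteq> characters" "\<And>x. x \<in> carrier G \<Longrightarrow> (\<Sum>\<omega>\<in>S. c \<omega> * \<omega> x) = 0" "\<psi> \<in> S"
  shows "c \<psi> = 0"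
proof -
  have "c \<psi> = \<mu> (\<lambda>x. (\<Sum>\<omega>\<in>S. c \<omega> * \<omega> x) * cnj (\<psi> x))"
    using mean_character_combination[OF assms(1,2), of \<psi> c] assms(2,4) by auto
  also have "\<dots> = \<mu> (\<lambda>x. 0)" by (rule \<mu>.cong[symmetric]) (auto simp: assms(3))
  finally show ?thesis by simp
qed

text \<open>Urysohn's lemma gives a continuous \<open>f\<close> that separates \<open>x\<close> and
  \<open>y\<close>. With \<open>g = y \<otimes> inv x\<close>, the difference \<open>?u\<close> of
  \<open>f\<close> and its translate by \<open>g\<close> is nonzero at \<open>x\<close>, so some
  character has nonzero mean against it; a character with value 1 at \<open>g\<close> would have
  mean 0.\<close>

lemma ex_character_separating:
  assumes x: "x \<in> carrier G" and y: "y \<in> carrier G" and "x \<noteq> y"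
  obtains \<omega> where "\<omega> \<in> characters" "\<omega> x \<noteq> \<omega> y"
proof -
  have "normal_space T"
    using compact Hausdorff by (simp add: compact_Hausdorff_or_regular_imp_normal_space)
  moreover have "closedin T {x}" "closedin T {y}" "disjnt {x} {y}"
    using Hausdorff x y \<open>x \<noteq> y\<close> by (simp_all add: closedin_Hausdorff_sing_eq)
  ultimately obtain f0 where f0: "continuous_map T euclideanreal f0" "f0 ` {x} \<subseteq> {0}" "f0 ` {y} \<subseteq> {1}"
    using Urysohn_lemma_alt[of T "{x}" "{y}" 0 1] by metis
  define f where "f = (\<lambda>z. complex_of_real (f0 z))"
  have f: "cont f" "f x \<noteq> f y"
    using f0 unfolding f_def by (auto intro!: continuous_map_comp_euclidean[OF f0(1)] continuous_intros)
  define g where "g = y \<otimes> inv x"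
  have g: "g \<in> carrier G" "g \<otimes> x = y" using x y by (auto simp: g_def m_assoc)
  let ?u = "\<lambda>z. f z - f (g \<otimes> z)"
  have fg: "cont (\<lambda>z. f (g \<otimes> z))" by (intro cont_translate f g)
  have "cont ?u" "?u x \<noteq> 0" using f g fg by (auto intro: ctsI)
  then obtain \<omega> where w: "\<omega> \<in> characters" and nz: "\<mu> (\<lambda>z. ?u z * cnj (\<omega> z)) \<noteq> 0"
    using ex_character_mean_nonzero[of ?u x] x by metis
  have cw: "cont (\<lambda>z. f z * cnj (\<omega> z))" by (intro ctsI f charactersD w)
  have "\<omega> g \<noteq> 1"
  proof
    assume wg: "\<omega> g = 1"
    have "\<mu> (\<lambda>z. ?u z * cnj (\<omega> z)) = \<mu> (\<lambda>z. f z * cnj (\<omega> z)) - \<mu> (\<lambda>z. f (g \<otimes> z) * cnj (\<omega> z))"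
      unfolding left_diff_distrib by (intro \<mu>.diff cont_bounded ctsI f fg charactersD w)
    also have "\<mu> (\<lambda>z. f (g \<otimes> z) * cnj (\<omega> z)) = \<mu> (\<lambda>z. f (g \<otimes> z) * cnj (\<omega> (g \<otimes> z)))"
      using wg g charactersD(4)[OF w] by (intro \<mu>.cong cont_bounded ctsI fg charactersD w) auto
    also have "\<dots> = \<mu> (\<lambda>z. f z * cnj (\<omega> z))" using mean_translate[OF cw g(1)] by simp
    finally show False using nz by simp
  qed
  moreover have "\<omega> y = \<omega> g * \<omega> x" using charactersD(4)[OF w g(1) x] g by simp
  ultimately have "\<omega> x \<noteq> \<omega> y" using character_nonzero[OF w x] by auto
  then show thesis using w that by blast
qed

text \<open>The component of \<open>\<one>\<close> is a point, so \<open>\<one>\<close> has a clopen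
  neighbourhood \<open>U\<close> on which the real part of \<open>\<omega>\<close> is positive. By
  the tube lemma some neighbourhood \<open>N\<close> of \<open>\<one>\<close> multiplies
  \<open>U\<close> into itself; powers of its elements stay in \<open>U\<close>, so
  \<open>\<omega>\<close> is 1 on \<open>N\<close>. Finitely many translates of \<open>N\<close>
  cover the group, so \<open>\<omega>\<close> has a finite image, closed under powers.\<close>

lemma character_finite_order:
  assumes td: "totally_disconnected T" and w: "\<omega> \<in> characters"
  obtains N :: nat where "N > 0" "\<And>x. x \<in> carrier G \<Longrightarrow> \<omega> x ^ N = 1"
proof -
  define W where "W = {x \<in> topspace T. \<omega> x \<in> {z. Re z > 0}}"
  have W: "openin T W" unfolding W_def
    by (rule openin_continuous_map_preimage[OF charactersD(1)[OF w]]) (simp add: open_halfspace_Re_gt)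
  have comp: "connected_component_of_set T \<one> \<in> connected_components_of T"
    by (simp add: connected_components_of_def)
  then obtain x where "connected_component_of_set T \<one> = {x}"
    using td unfolding totally_disconnected_def by blast
  moreover have "\<one> \<in> connected_component_of_set T \<one>" by (simp add: connected_component_of_refl)
  ultimately have "connected_component_of_set T \<one> = {\<one>}" by auto
  then have C: "{\<one>} \<in> connected_components_of T" using comp by simp
  have "{\<one>} \<subseteq> W" using character_one[OF w] by (simp add: W_def)
  from wilder_locally_compact_component_thm[OF compact_imp_locally_compact_space[OF compact] Hausdorff C _ W this]
  obtain U V where UV: "openin T U" "openin T V" "disjnt U V" "U \<union> V = carrier G" "\<one> \<in> U" "U \<subseteq> W"
    by (auto simp: finite_imp_compactin)
  have "U = topspace T - V" using UV openin_subset[OF UV(1)] by (auto simp: disjnt_iff)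
  then have "closedin T U" using closedin_diff[OF closedin_topspace UV(2)] by simp
  then have cU: "compactin T U" using compact closedin_compact_space by blast
  have mult_cont: "continuous_map (prod_topology T T) T (\<lambda>p. fst p \<otimes> snd p)" by (intro ctsI)
  have op: "openin (prod_topology T T) {p \<in> topspace (prod_topology T T). fst p \<otimes> snd p \<in> U}"
    by (rule openin_continuous_map_preimage[OF mult_cont UV(1)])
  have "U \<subseteq> carrier G" using UV by blast
  then have "{\<one>} \<times> U \<subseteq> {p \<in> topspace (prod_topology T T). fst p \<otimes> snd p \<in> U}" by auto
  from tube_lemma_right[OF op cU _ this] obtain N N' where N: "openin T N" "\<one> \<in> N" "U \<subseteq> N'"
    "N \<times> N' \<subseteq> {p \<in> topspace (prod_topology T T). fst p \<otimes> snd p \<in> U}" by auto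
  have NU: "g \<otimes> v \<in> U" if "g \<in> N" "v \<in> U" for g v using N that by fastforce
  have NG: "N \<subseteq> carrier G" using openin_subset[OF N(1)] by simp
  have w1: "\<omega> g = 1" if g: "g \<in> N" for g
  proof (rule eq_one_if_powers_Re_pos)
    have gG: "g \<in> carrier G" using g NG by blast
    then show "norm (\<omega> g) = 1" using charactersD(3)[OF w] by simp
    fix n :: nat
    have "g [^] n \<in> U"
    proof (induction n)
      case (Suc n)
      then show ?case using NU[OF g Suc.IH] gG by (simp add: m_comm)
    qed (use UV in simp)
    then have "g [^] n \<in> W" using UV by blast
    then show "Re (\<omega> g ^ n) > 0" using character_pow[OF w gG, of n] by (simp add: W_def)
  qed
  define B where "B = (\<lambda>a. {y \<in> topspace T. inv a \<otimes> y \<in> N})"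
  have B: "openin T (B a)" if "a \<in> carrier G" for a
    unfolding B_def using that N(1) by (intro openin_continuous_map_preimage[of T T] ctsI) auto
  have "carrier G \<subseteq> \<Union>(B ` carrier G)"
  proof
    fix x assume "x \<in> carrier G"
    then have "x \<in> B x" using N(2) by (simp add: B_def)
    then show "x \<in> \<Union>(B ` carrier G)" using \<open>x \<in> carrier G\<close> by blast
  qed
  from finite_subcover[OF B this] obtain D where D: "finite D" "D \<subseteq> carrier G" "carrier G \<subseteq> \<Union>(B ` D)"
    by blast
  have "\<omega> ` carrier G \<subseteq> \<omega> ` D"
  proof (rule image_subsetI)
    fix y assume y: "y \<in> carrier G"
    then obtain a where a: "a \<in> D" "y \<in> B a" using D by blast
    then have aG: "a \<in> carrier G" and "inv a \<otimes> y \<in> N" using D by (auto simp: B_def)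
    then have "\<omega> (inv a \<otimes> y) = 1" by (intro w1)
    moreover have "\<omega> (a \<otimes> (inv a \<otimes> y)) = \<omega> a * \<omega> (inv a \<otimes> y)"
      using charactersD(4)[OF w] aG y by simp
    moreover have "a \<otimes> (inv a \<otimes> y) = y" using aG y by (simp add: m_assoc[symmetric])
    ultimately show "\<omega> y \<in> \<omega> ` D" using a by simp
  qed
  then have fin: "finite (\<omega> ` carrier G)" using D finite_subset by blast
  have "\<exists>k>0. z ^ k = 1" if z: "z \<in> \<omega> ` carrier G" for z
  proof -
    obtain x where x: "x \<in> carrier G" "z = \<omega> x" using z by blast
    have "range (\<lambda>n::nat. z ^ n) \<subseteq> \<omega> ` carrier G"
    proof (rule image_subsetI)
      fix n :: nat
      have "z ^ n = \<omega> (x [^] n)" using character_pow[OF w x(1), of n] x(2) by simp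
      then show "z ^ n \<in> \<omega> ` carrier G" using x(1) by (intro image_eqI[of _ _ "x [^] n"]) auto
    qed
    then have "finite (range (\<lambda>n::nat. z ^ n))" using fin finite_subset by blast
    then have "\<not> inj (\<lambda>n::nat. z ^ n)" using finite_imageD infinite_UNIV_nat by blast
    then obtain i j where "i < j" "z ^ i = z ^ j" unfolding inj_def by (metis linorder_neqE_nat)
    moreover have "z \<noteq> 0" using character_nonzero[OF w x(1)] x by simp
    ultimately have "z ^ (j - i) = 1" by (simp add: power_diff)
    then show ?thesis using \<open>i < j\<close> by (intro exI[of _ "j - i"]) simp
  qed
  then obtain k where k: "\<And>z. z \<in> \<omega> ` carrier G \<Longrightarrow> k z > 0 \<and> z ^ k z = 1" by metis
  show thesis
  proof (rule that)
    \<comment> \<open>A common exponent: the product of exponents for the finitely many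
      values.\<close>
    show "(\<Prod>z\<in>\<omega> ` carrier G. k z) > 0" using k by (simp add: prod_pos)
    fix x assume x: "x \<in> carrier G"
    then have "k (\<omega> x) dvd (\<Prod>z\<in>\<omega> ` carrier G. k z)" by (intro dvd_prodI fin) simp
    then show "\<omega> x ^ (\<Prod>z\<in>\<omega> ` carrier G. k z) = 1"
      using k[of "\<omega> x"] x by (auto simp: dvd_def power_mult)
  qed
qed

text \<open>If its \<open>N\<close>-th power were trivial, the separating character would map a
  connected set with two points to a connected, hence one-point, subset of the finitely many roots
  of unity.\<close>

lemma ex_character_infinite_order:
  assumes "\<not> totally_disconnected T"
  obtains \<omega> where "\<omega> \<in> characters" "\<And>N::nat. N > 0 \<Longrightarrow> \<exists>x\<in>carrier G. \<omega> x ^ N \<noteq> 1"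
proof -
  obtain C where C: "C \<in> connected_components_of T" "\<nexists>x. C = {x}"
    using assms by (auto simp: totally_disconnected_def)
  have conn: "connectedin T C" and "C \<noteq> {}" "C \<subseteq> carrier G"
    using C connectedin_connected_components_of nonempty_connected_components_of
      connected_components_of_subset by fastforce+
  with C obtain x y where xy: "x \<in> C" "y \<in> C" "x \<noteq> y" by blast
  then obtain \<omega> where w: "\<omega> \<in> characters" "\<omega> x \<noteq> \<omega> y"
    using ex_character_separating[of x y] \<open>C \<subseteq> carrier G\<close> by (metis subsetD)
  have "connectedin euclidean (\<omega> ` C)"
    using connectedin_continuous_map_image[OF charactersD(1)[OF w(1)] conn] .
  then have conn': "connected (\<omega> ` C)" by simp
  show thesis
  proof (rule that[OF w(1)], rule ccontr)
    fix N :: nat assume N: "N > 0" "\<not> (\<exists>x\<in>carrier G. \<omega> x ^ N \<noteq> 1)"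
    then have "\<omega> ` C \<subseteq> {z. z ^ N = 1}" using \<open>C \<subseteq> carrier G\<close> by auto
    moreover have "finite {z::complex. z ^ N = 1}" using N by (intro finite_roots_unity) simp
    ultimately have "finite (\<omega> ` C)" using finite_subset by blast
    then have "\<omega> ` C = {} \<or> (\<exists>a. \<omega> ` C = {a})" using conn' connected_finite_iff_sing by blast
    then obtain a where "\<omega> ` C = {a}" using xy by blast
    then have "\<omega> x = a" "\<omega> y = a" using xy by blast+
    then show False using w(2) by simp
  qed
qed

lemma ex_nonunitary_char_group_hom:
  assumes "\<not> totally_disconnected T"
  obtains h :: "('g \<Rightarrow> complex) \<Rightarrow> real" and \<omega>\<^sub>0 where "\<omega>\<^sub>0 \<in> characters" "h \<omega>\<^sub>0 = 1"
    "\<And>\<omega> \<psi>. \<omega> \<in> characters \<Longrightarrow> \<psi> \<in> characters \<Longrightarrow> h (\<lambda>x\<in>carrier G. \<omega> x * \<psi> x) = h \<omega> + h \<psi>"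
proof -
  interpret C: comm_group char_group by (rule comm_group_char_group)
  obtain \<omega>\<^sub>0 where w: "\<omega>\<^sub>0 \<in> characters" "\<And>N::nat. N > 0 \<Longrightarrow> \<exists>x\<in>carrier G. \<omega>\<^sub>0 x ^ N \<noteq> 1"
    using ex_character_infinite_order[OF assms] by metis
  have "\<omega>\<^sub>0 [^]\<^bsub>char_group\<^esub> n \<noteq> \<one>\<^bsub>char_group\<^esub>" if n: "n > 0" for n :: nat
  proof
    assume "\<omega>\<^sub>0 [^]\<^bsub>char_group\<^esub> n = \<one>\<^bsub>char_group\<^esub>"
    then have "(\<lambda>x\<in>carrier G. \<omega>\<^sub>0 x ^ n) = (\<lambda>x\<in>carrier G. 1)"
      using char_group_pow[OF w(1)] by (simp add: char_group_def)
    then have "\<forall>x\<in>carrier G. \<omega>\<^sub>0 x ^ n = 1" by (metis restrict_apply')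
    then show False using w(2)[OF n] by blast
  qed
  then obtain h :: "('g \<Rightarrow> complex) \<Rightarrow> real" where
    "\<forall>\<omega>\<in>carrier char_group. \<forall>\<psi>\<in>carrier char_group. h (\<omega> \<otimes>\<^bsub>char_group\<^esub> \<psi>) = h \<omega> + h \<psi>" "h \<omega>\<^sub>0 = 1"
    using C.ex_real_hom[of \<omega>\<^sub>0] w(1) by (auto simp: char_group_def)
  then show thesis using that[OF w(1), of h] by (simp add: char_group_def)
qed

end

section \<open>Matrix coefficients of weakly complete algebras\<close>

text \<open>Gaussian elimination with pivot \<open>i0\<close>. Arbitrary finite index sets allow the
  unknowns to be numbered vectors as well as characters.\<close>

lemma homogeneous_system_nontrivial:
  fixes M :: "'a \<Rightarrow> 'b \<Rightarrow> complex"
  assumes "finite B" "finite I" "card B < card I"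
  shows "\<exists>v. (\<exists>i\<in>I. v i \<noteq> 0) \<and> (\<forall>b\<in>B. (\<Sum>i\<in>I. v i * M i b) = 0)"
  using assms
proof (induction B arbitrary: I M rule: finite_induct)
  case empty
  then have "I \<noteq> {}" by auto
  then show ?case by (intro exI[of _ "\<lambda>_. 1"]) auto
next
  case (insert b B)
  show ?case
  proof (cases "\<exists>i\<in>I. M i b \<noteq> 0")
    case False
    have "card B < card I" using insert by simp
    from insert.IH[OF insert.prems(1) this, of M] obtain v where v: "\<exists>i\<in>I. v i \<noteq> 0"
      "\<forall>b\<in>B. (\<Sum>i\<in>I. v i * M i b) = 0" by blast
    moreover have "(\<Sum>i\<in>I. v i * M i b) = 0" using False by (intro sum.neutral) auto
    ultimately show ?thesis by blast
  next
    case True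
    then obtain i0 where i0: "i0 \<in> I" "M i0 b \<noteq> 0" by blast
    have "card B < card (I - {i0})" using insert i0 by simp
    from insert.IH[OF _ this, of "\<lambda>i b'. M i b' - M i b / M i0 b * M i0 b'"] insert.prems
    obtain v where v: "\<exists>i\<in>I - {i0}. v i \<noteq> 0"
      "\<forall>b'\<in>B. (\<Sum>i\<in>I - {i0}. v i * (M i b' - M i b / M i0 b * M i0 b')) = 0" by blast
    define w where "w = v(i0 := - (\<Sum>i\<in>I - {i0}. v i * M i b) / M i0 b)"
    have sum_w: "(\<Sum>i\<in>I. w i * M i b') = (\<Sum>i\<in>I - {i0}. v i * M i b') - (\<Sum>i\<in>I - {i0}. v i * M i b) / M i0 b * M i0 b'" for b'
    proof -
      have "(\<Sum>i\<in>I. w i * M i b') = w i0 * M i0 b' + (\<Sum>i\<in>I - {i0}. w i * M i b')"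
        using insert.prems i0 by (simp add: sum.remove)
      also have "(\<Sum>i\<in>I - {i0}. w i * M i b') = (\<Sum>i\<in>I - {i0}. v i * M i b')"
        by (intro sum.cong) (auto simp: w_def)
      finally show ?thesis by (simp add: w_def)
    qed
    have "(\<Sum>i\<in>I. w i * M i b') = 0" if "b' \<in> insert b B" for b'
    proof (cases "b' = b")
      case True then show ?thesis using sum_w[of b] i0 by simp
    next
      case False
      then have "b' \<in> B" using that by simp
      then have "(\<Sum>i\<in>I - {i0}. v i * (M i b' - M i b / M i0 b * M i0 b')) = 0" using v by blast
      moreover have "(\<Sum>i\<in>I - {i0}. v i * (M i b' - M i b / M i0 b * M i0 b')) = (\<Sum>i\<in>I. w i * M i b')"
        unfolding sum_w by (simp add: right_diff_distrib sum_subtractf sum_distrib_right sum_divide_distrib mult.assoc)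
      ultimately show ?thesis by simp
    qed
    moreover have "\<exists>i\<in>I. w i \<noteq> 0" using v(1) by (auto simp: w_def)
    ultimately show ?thesis by blast
  qed
qed

section \<open>Continuous functionals and coordinates\<close>

definition linear_functional :: "(complex, 'a, 'm) module_scheme \<Rightarrow> ('a \<Rightarrow> complex) \<Rightarrow> bool" where
  "linear_functional V \<phi> \<longleftrightarrow>
     (\<forall>x\<in>carrier V. \<forall>y\<in>carrier V. \<phi> (x \<oplus>\<^bsub>V\<^esub> y) = \<phi> x + \<phi> y) \<and>
     (\<forall>a. \<forall>x\<in>carrier V. \<phi> (a \<odot>\<^bsub>V\<^esub> x) = a * \<phi> x)"

lemma linear_map_complex_algebra: "linear_map V complex_algebra \<phi> \<longleftrightarrow> linear_functional V \<phi>"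
  by (simp add: linear_map_def linear_functional_def complex_algebra_def)

text \<open>The members of the dual without the extensionality required by
  \<open>dual_space\<close>, so that plain abstractions qualify.\<close>

definition functional :: "'a topological_module \<Rightarrow> ('a \<Rightarrow> complex) \<Rightarrow> bool" where
  "functional V \<phi> \<longleftrightarrow> linear_functional V \<phi> \<and> continuous_map (topo V) euclidean \<phi>"

locale wc_algebra =
  fixes A :: "'a topological_module" (structure)
  assumes wc_algebra: "weakly_complete_algebra A"
begin

sublocale ring A using wc_algebra by (simp add: weakly_complete_algebra_def)

lemma wc: "weakly_complete A" and bilinear: "bilinear_map A A A (\<lambda>(x, y). x \<otimes> y)"
  and cont_mult: "continuous_map (prod_topology (topo A) (topo A)) (topo A) (\<lambda>(x, y). x \<otimes> y)"
  using wc_algebra by (auto simp: weakly_complete_algebra_def)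

lemma tvs: "topological_vector_space A" using wc by (simp add: weakly_complete_def)

lemma topspace_topo [simp]: "topspace (topo A) = carrier A"
  using tvs by (simp add: topological_vector_space_def)

lemma smult_closed [simp]: "x \<in> carrier A \<Longrightarrow> a \<odot> x \<in> carrier A"
proof -
  have "Module.module complex_field A" using tvs by (simp add: topological_vector_space_def)
  then show "x \<in> carrier A \<Longrightarrow> a \<odot> x \<in> carrier A"
    using module.smult_closed[of complex_field A a x] by (simp add: ring_of_type_algebra_def)
qed

lemma mult_smult:
  "x \<in> carrier A \<Longrightarrow> y \<in> carrier A \<Longrightarrow> x \<otimes> (a \<odot> y) = a \<odot> (x \<otimes> y)"
  "x \<in> carrier A \<Longrightarrow> y \<in> carrier A \<Longrightarrow> (a \<odot> x) \<otimes> y = a \<odot> (x \<otimes> y)"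
  using bilinear by (auto simp: bilinear_map_def linear_map_def)

lemma functional_plus: "linear_functional A \<phi> \<Longrightarrow> x \<in> carrier A \<Longrightarrow> y \<in> carrier A \<Longrightarrow> \<phi> (x \<oplus> y) = \<phi> x + \<phi> y"
  and functional_smult: "linear_functional A \<phi> \<Longrightarrow> x \<in> carrier A \<Longrightarrow> \<phi> (a \<odot> x) = a * \<phi> x"
  by (auto simp: linear_functional_def)

lemma functional_zero: assumes "linear_functional A \<phi>" shows "\<phi> \<zero> = 0"
  using functional_plus[OF assms zero_closed zero_closed] by simp

lemma linear_functional_mult_left:
  "linear_functional A \<phi> \<Longrightarrow> a \<in> carrier A \<Longrightarrow> linear_functional A (\<lambda>x. \<phi> (a \<otimes> x))"
  by (simp add: linear_functional_def r_distr mult_smult)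

lemma linear_functional_mult_right:
  "linear_functional A \<phi> \<Longrightarrow> a \<in> carrier A \<Longrightarrow> linear_functional A (\<lambda>x. \<phi> (x \<otimes> a))"
  by (simp add: linear_functional_def l_distr mult_smult)

lemma functional_mult_left:
  assumes \<phi>: "functional A \<phi>" and a: "a \<in> carrier A" shows "functional A (\<lambda>x. \<phi> (a \<otimes> x))"
proof -
  have "continuous_map (topo A) (prod_topology (topo A) (topo A)) (\<lambda>x. (a, x))"
    using a by (intro continuous_map_pairedI) (auto simp: continuous_map_id[unfolded id_def])
  from continuous_map_compose[OF continuous_map_compose[OF this cont_mult], of euclidean \<phi>]
  have "continuous_map (topo A) euclidean (\<lambda>x. \<phi> (a \<otimes> x))" using \<phi> by (simp add: functional_def o_def)
  then show ?thesis using \<phi> a by (simp add: functional_def linear_functional_mult_left)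
qed

lemma functional_mult_right:
  assumes \<phi>: "functional A \<phi>" and a: "a \<in> carrier A" shows "functional A (\<lambda>x. \<phi> (x \<otimes> a))"
proof -
  have "continuous_map (topo A) (prod_topology (topo A) (topo A)) (\<lambda>x. (x, a))"
    using a by (intro continuous_map_pairedI) (auto simp: continuous_map_id[unfolded id_def])
  from continuous_map_compose[OF continuous_map_compose[OF this cont_mult], of euclidean \<phi>]
  have "continuous_map (topo A) euclidean (\<lambda>x. \<phi> (x \<otimes> a))" using \<phi> by (simp add: functional_def o_def)
  then show ?thesis using \<phi> a by (simp add: functional_def linear_functional_mult_right)
qed

text \<open>Linear combinations in \<open>A\<close> are used only through their values under
  functionals, which avoids finite sums in the algebra itself.\<close>

lemma ex_linear_combination:
  assumes "finite I" "\<And>i. i \<in> I \<Longrightarrow> x i \<in> carrier A"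
  shows "\<exists>z\<in>carrier A. \<forall>\<phi>. linear_functional A \<phi> \<longrightarrow> \<phi> z = (\<Sum>i\<in>I. v i * \<phi> (x i))"
  using assms
proof (induction I rule: finite_induct)
  case empty
  then show ?case using functional_zero by (intro bexI[of _ \<zero>]) auto
next
  case (insert i I)
  then obtain z where z: "z \<in> carrier A" "\<forall>\<phi>. linear_functional A \<phi> \<longrightarrow> \<phi> z = (\<Sum>i\<in>I. v i * \<phi> (x i))"
    by auto
  then show ?case using insert
    by (intro bexI[of _ "(v i \<odot> x i) \<oplus> z"]) (auto simp: functional_plus functional_smult)
qed

definition coordinates :: "'a set \<times> ('a \<Rightarrow> 'a \<Rightarrow> complex)" where
  "coordinates = (SOME p. linear_map A (complex_power (fst p)) (snd p) \<and>
     homeomorphic_map (topo A) (topo (complex_power (fst p))) (snd p))"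

abbreviation "J \<equiv> fst coordinates"
abbreviation "co \<equiv> snd coordinates"

lemma coordinates: "linear_map A (complex_power J) co"
  "homeomorphic_map (topo A) (product_topology (\<lambda>j. euclidean) J) co"
proof -
  have "\<exists>p :: 'a set \<times> ('a \<Rightarrow> 'a \<Rightarrow> complex). linear_map A (complex_power (fst p)) (snd p) \<and>
     homeomorphic_map (topo A) (topo (complex_power (fst p))) (snd p)"
    using wc unfolding weakly_complete_def by auto
  from someI_ex[OF this] show "linear_map A (complex_power J) co"
    "homeomorphic_map (topo A) (product_topology (\<lambda>j. euclidean) J) co"
    by (simp_all add: coordinates_def complex_power_def)
qed

lemma co_extensional: "x \<in> carrier A \<Longrightarrow> co x \<in> extensional J"
  using coordinates(1) by (auto simp: linear_map_def complex_power_def Pi_iff PiE_def)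

lemma co_inj: "x \<in> carrier A \<Longrightarrow> y \<in> carrier A \<Longrightarrow> (\<And>j. j \<in> J \<Longrightarrow> co x j = co y j) \<Longrightarrow> x = y"
  using homeomorphic_imp_injective_map[OF coordinates(2)] co_extensional
  by (metis extensionalityI inj_on_def topspace_topo)

lemma co_surj: "f \<in> extensional J \<Longrightarrow> \<exists>x\<in>carrier A. co x = f"
proof -
  assume "f \<in> extensional J"
  then have "f \<in> topspace (product_topology (\<lambda>j. euclidean :: complex topology) J)" by (simp add: PiE_def)
  then have "f \<in> co ` topspace (topo A)"
    by (simp only: homeomorphic_imp_surjective_map[OF coordinates(2)])
  then show ?thesis by auto
qed

lemma co_functional: assumes j: "j \<in> J" shows "functional A (\<lambda>x. co x j)"
proof -
  have "continuous_map (topo A) euclidean (\<lambda>x. co x j)"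
    using homeomorphic_imp_continuous_map[OF coordinates(2)] j
    by (simp add: continuous_map_componentwise)
  then show ?thesis using coordinates(1) j
    by (auto simp: functional_def linear_functional_def linear_map_def complex_power_def)
qed

text \<open>A basic open set of a product restricts only finitely many coordinates.\<close>

lemma neighbourhood_of_zero:
  assumes U: "openin (topo A) U" "\<zero> \<in> U"
  obtains F where "finite F" "F \<subseteq> J" "\<And>x. x \<in> carrier A \<Longrightarrow> (\<forall>j\<in>F. co x j = 0) \<Longrightarrow> x \<in> U"
proof -
  have "openin (product_topology (\<lambda>j. euclidean) J) (co ` U)"
    using homeomorphic_imp_open_map[OF coordinates(2)] U(1) by (simp add: open_map_def)
  moreover have "co \<zero> \<in> co ` U" using U(2) by simp
  ultimately have "\<exists>V. finite {i \<in> J. V i \<noteq> topspace (euclidean :: complex topology)} \<and>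
      (\<forall>i\<in>J. openin euclidean (V i)) \<and> co \<zero> \<in> Pi\<^sub>E J V \<and> Pi\<^sub>E J V \<subseteq> co ` U"
    unfolding openin_product_topology_alt by (rule bspec)
  then obtain V where V: "finite {i \<in> J. V i \<noteq> (UNIV :: complex set)}" "co \<zero> \<in> Pi\<^sub>E J V" "Pi\<^sub>E J V \<subseteq> co ` U"
    unfolding topspace_euclidean by (elim exE conjE)
  have "x \<in> U" if x: "x \<in> carrier A" "\<forall>j\<in>{i \<in> J. V i \<noteq> UNIV}. co x j = 0" for x
  proof -
    have "co x j \<in> V j" if j: "j \<in> J" for j
    proof (cases "V j = UNIV")
      case False
      then have "co x j = 0" using x j by simp
      also have "\<dots> = co \<zero> j"
        using functional_zero[of "\<lambda>x. co x j"] co_functional[OF j] by (simp add: functional_def)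
      finally show ?thesis using V(2) j by auto
    qed simp
    then have "co x \<in> co ` U" using co_extensional[OF x(1)] V(3) by (auto simp: PiE_def)
    then obtain y where "y \<in> U" "co x = co y" by blast
    moreover have "y \<in> carrier A" using \<open>y \<in> U\<close> openin_subset[OF U(1)] by auto
    ultimately show ?thesis using co_inj[of x y] x by simp
  qed
  with V(1) show thesis by (intro that[of "{i \<in> J. V i \<noteq> UNIV}"]) auto
qed

lemma eq_0_if_scaling_bounded:
  fixes z :: complex assumes "\<And>t. norm (t * z) < 1" shows "z = 0"
  using assms[of "1 / z"] by (cases "z = 0") auto

text \<open>The subspace where the coordinates in \<open>F\<close> vanish lies in the set where
  \<open>\<phi>\<close> has modulus below 1, and a functional bounded on a subspace is 0
  there.\<close>

lemma functional_finite_support: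
  assumes \<phi>: "functional A \<phi>"
  obtains F where "finite F" "F \<subseteq> J" "\<And>x. x \<in> carrier A \<Longrightarrow> (\<forall>j\<in>F. co x j = 0) \<Longrightarrow> \<phi> x = 0"
proof -
  have l: "linear_functional A \<phi>" using \<phi> by (simp add: functional_def)
  let ?U = "{x \<in> topspace (topo A). dist (\<phi> x) 0 < 1}"
  have op: "openin (topo A) ?U" using \<phi> by (intro continuous_map_open_ball) (simp add: functional_def)
  have "\<zero> \<in> ?U" using functional_zero[OF l] by simp
  then obtain F where F: "finite F" "F \<subseteq> J" "\<And>x. x \<in> carrier A \<Longrightarrow> (\<forall>j\<in>F. co x j = 0) \<Longrightarrow> x \<in> ?U"
    by (rule neighbourhood_of_zero[OF op]) (rule that; blast)
  have "\<phi> x = 0" if x: "x \<in> carrier A" "\<forall>j\<in>F. co x j = 0" for x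
  proof (rule eq_0_if_scaling_bounded)
    fix t
    have "co (t \<odot> x) j = 0" if "j \<in> F" for j
      using functional_smult[of "\<lambda>x. co x j" x t] co_functional[of j] F that x by (auto simp: functional_def)
    then have "t \<odot> x \<in> ?U" using F(3)[of "t \<odot> x"] x by simp
    then show "norm (t * \<phi> x) < 1" using functional_smult[OF l x(1)] by simp
  qed
  with F show thesis by (intro that[of F]) auto
qed

text \<open>The same argument for the bilinear form obtained from \<open>\<phi>\<close> and the
  product, scaling one of the two factors.\<close>

lemma mult_functional_finite_support:
  assumes \<phi>: "functional A \<phi>"
  obtains F where "finite F" "F \<subseteq> J" "\<And>x y. x \<in> carrier A \<Longrightarrow> y \<in> carrier A \<Longrightarrow>
           (\<forall>j\<in>F. co x j = 0) \<Longrightarrow> (\<forall>j\<in>F. co y j = 0) \<Longrightarrow> \<phi> (x \<otimes> y) = 0"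
proof -
  have l: "linear_functional A \<phi>" using \<phi> by (simp add: functional_def)
  let ?P = "prod_topology (topo A) (topo A)"
  have c: "continuous_map ?P euclidean (\<lambda>p. \<phi> (fst p \<otimes> snd p))"
    using continuous_map_compose[OF cont_mult, of euclidean \<phi>] \<phi>
    by (simp add: functional_def o_def case_prod_unfold)
  have "openin ?P {p \<in> topspace ?P. dist (\<phi> (fst p \<otimes> snd p)) 0 < 1}" (is "openin _ ?W")
    by (rule continuous_map_open_ball[OF c])
  moreover have "(\<zero>, \<zero>) \<in> ?W" using functional_zero[OF l] by simp
  ultimately obtain U V where UV: "openin (topo A) U" "openin (topo A) V" "\<zero> \<in> U" "\<zero> \<in> V" "U \<times> V \<subseteq> ?W"
    unfolding openin_prod_topology_alt by (elim allE[of _ \<zero>] impE) (assumption, elim exE conjE)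
  obtain F where F: "finite F" "F \<subseteq> J" "\<And>x. x \<in> carrier A \<Longrightarrow> (\<forall>j\<in>F. co x j = 0) \<Longrightarrow> x \<in> U"
    by (rule neighbourhood_of_zero[OF UV(1,3)]) (rule that; blast)
  obtain F' where F': "finite F'" "F' \<subseteq> J" "\<And>x. x \<in> carrier A \<Longrightarrow> (\<forall>j\<in>F'. co x j = 0) \<Longrightarrow> x \<in> V"
    by (rule neighbourhood_of_zero[OF UV(2,4)]) (rule that; blast)
  have "\<phi> (x \<otimes> y) = 0" if x: "x \<in> carrier A" "\<forall>j\<in>F \<union> F'. co x j = 0"
    and y: "y \<in> carrier A" "\<forall>j\<in>F \<union> F'. co y j = 0" for x y
  proof (rule eq_0_if_scaling_bounded)
    fix t
    have "co (t \<odot> x) j = 0" if "j \<in> F" for j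
      using functional_smult[of "\<lambda>x. co x j" x t] co_functional[of j] F that x by (auto simp: functional_def)
    then have "t \<odot> x \<in> U" using F(3)[of "t \<odot> x"] x by simp
    moreover have "y \<in> V" using F'(3) y by simp
    ultimately have "(t \<odot> x, y) \<in> ?W" using UV(5) by blast
    then have "norm (\<phi> ((t \<odot> x) \<otimes> y)) < 1" by simp
    then show "norm (t * \<phi> (x \<otimes> y)) < 1" using functional_smult[OF l, of "x \<otimes> y" t] x y by (simp add: mult_smult)
  qed
  with F F' show thesis by (intro that[of "F \<union> F'"]) auto
qed

lemma ex_unit_vectors:
  obtains e where "\<And>j. j \<in> J \<Longrightarrow> e j \<in> carrier A" "\<And>i j. i \<in> J \<Longrightarrow> j \<in> J \<Longrightarrow> co (e j) i = (if i = j then 1 else 0)"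
proof -
  define e where "e = (\<lambda>j. SOME x. x \<in> carrier A \<and> co x = (\<lambda>i\<in>J. if i = j then 1 else 0))"
  have "e j \<in> carrier A \<and> co (e j) = (\<lambda>i\<in>J. if i = j then 1 else 0)" for j
    unfolding e_def by (rule someI_ex) (use co_surj in \<open>simp add: Bex_def\<close>)
  then show thesis by (intro that[of e]) auto
qed

lemma ex_reduced:
  assumes e: "\<And>j. j \<in> J \<Longrightarrow> e j \<in> carrier A" "\<And>i j. i \<in> J \<Longrightarrow> j \<in> J \<Longrightarrow> co (e j) i = (if i = j then 1 else 0)"
    and F: "finite F" "F \<subseteq> J" and x: "x \<in> carrier A"
  obtains x' where "x' \<in> carrier A" "\<forall>j\<in>F. co x' j = 0"
    "\<forall>\<phi>. linear_functional A \<phi> \<longrightarrow> \<phi> x' = \<phi> x - (\<Sum>j\<in>F. co x j * \<phi> (e j))"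
proof -
  have "\<And>i. i \<in> F \<Longrightarrow> e i \<in> carrier A" using e F by blast
  from ex_linear_combination[OF F(1) this, where v = "\<lambda>j. - co x j"]
  obtain z where z: "z \<in> carrier A" "\<forall>\<phi>. linear_functional A \<phi> \<longrightarrow> \<phi> z = (\<Sum>j\<in>F. - co x j * \<phi> (e j))" ..
  note z = z(1) z(2)[rule_format]
  have *: "\<phi> (x \<oplus> z) = \<phi> x - (\<Sum>j\<in>F. co x j * \<phi> (e j))" if "linear_functional A \<phi>" for \<phi>
    using z(2)[OF that] functional_plus[OF that x z(1)] by (simp add: sum_negf)
  have "co (x \<oplus> z) j = 0" if "j \<in> F" for j
  proof -
    have j: "j \<in> J" using F that by blast
    have "(\<Sum>i\<in>F. co x i * co (e i) j) = (\<Sum>i\<in>F. if i = j then co x i else 0)"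
      using F e(2)[OF j] by (intro sum.cong) auto
    also have "\<dots> = co x j" using F that by simp
    finally show ?thesis using *[of "\<lambda>x. co x j"] co_functional[OF j] by (simp add: functional_def)
  qed
  then show thesis using * x z by (intro that[of "x \<oplus> z"]) auto
qed

lemma functional_expansion:
  assumes \<phi>: "functional A \<phi>"
    and e: "\<And>j. j \<in> J \<Longrightarrow> e j \<in> carrier A" "\<And>i j. i \<in> J \<Longrightarrow> j \<in> J \<Longrightarrow> co (e j) i = (if i = j then 1 else 0)"
  shows "\<exists>F. finite F \<and> F \<subseteq> J \<and> (\<forall>x\<in>carrier A. \<phi> x = (\<Sum>j\<in>F. co x j * \<phi> (e j)))"
proof -
  obtain F where F: "finite F" "F \<subseteq> J" "\<And>x. x \<in> carrier A \<Longrightarrow> (\<forall>j\<in>F. co x j = 0) \<Longrightarrow> \<phi> x = 0"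
    by (rule functional_finite_support[OF \<phi>]) (rule that; blast)
  have "\<phi> x = (\<Sum>j\<in>F. co x j * \<phi> (e j))" if x: "x \<in> carrier A" for x
  proof -
    obtain x' where x': "x' \<in> carrier A" "\<forall>j\<in>F. co x' j = 0"
      "\<forall>\<phi>. linear_functional A \<phi> \<longrightarrow> \<phi> x' = \<phi> x - (\<Sum>j\<in>F. co x j * \<phi> (e j))"
      by (rule ex_reduced[OF e F(1,2) x])
    have "\<phi> x' = \<phi> x - (\<Sum>j\<in>F. co x j * \<phi> (e j))"
      by (rule x'(3)[rule_format]) (use \<phi> in \<open>simp add: functional_def\<close>)
    then show ?thesis using F(3)[OF x'(1,2)] by simp
  qed
  with F show ?thesis by blast
qed

text \<open>The form sending \<open>x\<close> and \<open>y\<close> to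
  \<open>\<phi> (x \<otimes> y)\<close> vanishes when both have zero coordinates in
  \<open>F\<close>, so its rank is at most \<open>2 * card F\<close>. With more vectors some
  combination \<open>z\<close> of the \<open>x i\<close> has zero coordinates in \<open>F\<close>
  and is orthogonal to the unit vectors of \<open>F\<close>; it is then orthogonal to every
  \<open>y i\<close>, against duality.\<close>

lemma dual_systems_bounded:
  assumes \<phi>: "functional A \<phi>"
  shows "\<exists>N. \<forall>n (x :: nat \<Rightarrow> 'a) y. (\<forall>i<n. x i \<in> carrier A \<and> y i \<in> carrier A) \<longrightarrow>
     (\<forall>i<n. \<forall>j<n. \<phi> (x i \<otimes> y j) = (if i = j then 1 else 0)) \<longrightarrow> n \<le> N"
proof -
  have l: "linear_functional A \<phi>" using \<phi> by (simp add: functional_def)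
  obtain e where e: "\<And>j. j \<in> J \<Longrightarrow> e j \<in> carrier A" "\<And>i j. i \<in> J \<Longrightarrow> j \<in> J \<Longrightarrow> co (e j) i = (if i = j then 1 else 0)"
    by (rule ex_unit_vectors) (rule that; blast)
  obtain F where F: "finite F" "F \<subseteq> J" "\<And>x y. x \<in> carrier A \<Longrightarrow> y \<in> carrier A \<Longrightarrow>
           (\<forall>j\<in>F. co x j = 0) \<Longrightarrow> (\<forall>j\<in>F. co y j = 0) \<Longrightarrow> \<phi> (x \<otimes> y) = 0"
    by (rule mult_functional_finite_support[OF \<phi>]) (rule that; blast)
  have "n \<le> 2 * card F" if xy: "\<forall>i<n. x i \<in> carrier A \<and> y i \<in> carrier A"
    and dual: "\<forall>i<n. \<forall>j<n. \<phi> (x i \<otimes> y j) = (if i = j then 1 else 0)" for n and x y :: "nat \<Rightarrow> 'a"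
  proof (rule ccontr)
    assume "\<not> n \<le> 2 * card F"
    \<comment> \<open>Each element of \<open>F\<close> imposes two equations on the coefficients,
      told apart by a Boolean.\<close>
    then have "card (F \<times> (UNIV :: bool set)) < card {..<n}" by (simp add: card_cartesian_product mult.commute)
    from homogeneous_system_nontrivial[OF _ _ this, of "\<lambda>i (j, b). if b then co (x i) j else \<phi> (x i \<otimes> e j)"] F(1)
    obtain v i0 where v: "i0 < n" "v i0 \<noteq> 0"
      and eq: "\<forall>p\<in>F \<times> UNIV. (\<Sum>i<n. v i * (case p of (j, b) \<Rightarrow> if b then co (x i) j else \<phi> (x i \<otimes> e j))) = 0" by auto
    have 0: "(\<Sum>i<n. v i * co (x i) j) = 0" "(\<Sum>i<n. v i * \<phi> (x i \<otimes> e j)) = 0" if "j \<in> F" for j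
    proof -
      show "(\<Sum>i<n. v i * co (x i) j) = 0" using bspec[OF eq, of "(j, True)"] that by simp
      show "(\<Sum>i<n. v i * \<phi> (x i \<otimes> e j)) = 0" using bspec[OF eq, of "(j, False)"] that by simp
    qed
    have "\<And>i. i \<in> {..<n} \<Longrightarrow> x i \<in> carrier A" using xy by simp
    from ex_linear_combination[OF finite_lessThan this, where v = v]
    obtain z where z: "z \<in> carrier A" "\<forall>\<phi>. linear_functional A \<phi> \<longrightarrow> \<phi> z = (\<Sum>i<n. v i * \<phi> (x i))" ..
    note z = z(1) z(2)[rule_format]
    have zF: "co z j = 0" if "j \<in> F" for j
      using 0(1)[OF that] z(2)[of "\<lambda>x. co x j"] co_functional[of j] F that by (auto simp: functional_def)
    have ze: "\<phi> (z \<otimes> e j) = 0" if "j \<in> F" for j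
      using 0(2)[OF that] z(2)[OF linear_functional_mult_right[OF l, of "e j"]] e F that by auto
    have y0: "y i0 \<in> carrier A" using xy v by simp
    obtain y' where y': "y' \<in> carrier A" "\<forall>j\<in>F. co y' j = 0"
      "\<forall>\<phi>. linear_functional A \<phi> \<longrightarrow> \<phi> y' = \<phi> (y i0) - (\<Sum>j\<in>F. co (y i0) j * \<phi> (e j))"
      by (rule ex_reduced[OF e F(1,2) y0])
    have "\<phi> (z \<otimes> y') = \<phi> (z \<otimes> y i0) - (\<Sum>j\<in>F. co (y i0) j * \<phi> (z \<otimes> e j))"
      by (rule y'(3)[rule_format, OF linear_functional_mult_left[OF l z(1)]])
    moreover have "\<phi> (z \<otimes> y') = 0" using z y' zF by (intro F(3)) auto
    ultimately have "\<phi> (z \<otimes> y i0) = 0" using ze by simp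
    moreover have "\<phi> (z \<otimes> y i0) = (\<Sum>i<n. v i * \<phi> (x i \<otimes> y i0))"
      by (rule z(2)[OF linear_functional_mult_right[OF l y0]])
    moreover have "\<dots> = (\<Sum>i<n. if i = i0 then v i else 0)"
      using dual v by (intro sum.cong) auto
    ultimately show False using v by simp
  qed
  then show ?thesis by blast
qed

section \<open>Matrix representations behind a functional\<close>

definition matrix_rep :: "nat \<Rightarrow> ('a \<Rightarrow> nat \<Rightarrow> nat \<Rightarrow> complex) \<Rightarrow> bool" where
  "matrix_rep n r \<longleftrightarrow> (\<forall>i<n. \<forall>j<n. functional A (\<lambda>a. r a i j) \<and> r \<one> i j = (if i = j then 1 else 0) \<and>
     (\<forall>a\<in>carrier A. \<forall>b\<in>carrier A. r (a \<otimes> b) i j = (\<Sum>k<n. r a i k * r b k j)))"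

text \<open>A dual system of maximal length reproduces the bilinear form \<open>(a, b) \<mapsto> \<phi> (a \<otimes> b)\<close>, since
  otherwise it could be extended by one more pair.\<close>

lemma ex_matrix_rep:
  assumes \<phi>: "functional A \<phi>"
  shows "\<exists>n r \<alpha> \<beta>. matrix_rep n r \<and> (\<forall>a\<in>carrier A. \<phi> a = (\<Sum>i<n. \<Sum>j<n. \<alpha> i * r a i j * \<beta> j))"
proof -
  have l: "linear_functional A \<phi>" using \<phi> by (simp add: functional_def)
  define P where "P = (\<lambda>n. \<exists>x y :: nat \<Rightarrow> 'a. (\<forall>i<n. x i \<in> carrier A \<and> y i \<in> carrier A) \<and>
     (\<forall>i<n. \<forall>j<n. \<phi> (x i \<otimes> y j) = (if i = j then 1 else 0)))"
  obtain N where N: "\<And>n. P n \<Longrightarrow> n \<le> N" using dual_systems_bounded[OF \<phi>] unfolding P_def by blast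
  have "P 0" by (simp add: P_def)
  then have "P (Greatest P)" using N by (rule GreatestI_nat)
  define n where "n = Greatest P"
  have notP: "\<not> P (Suc n)" using Greatest_le_nat[of P "Suc n" N] N by (auto simp: n_def)
  obtain x y :: "nat \<Rightarrow> 'a" where xA: "\<And>i. i < n \<Longrightarrow> x i \<in> carrier A" and yA: "\<And>i. i < n \<Longrightarrow> y i \<in> carrier A"
    and dual: "\<And>i j. i < n \<Longrightarrow> j < n \<Longrightarrow> \<phi> (x i \<otimes> y j) = (if i = j then 1 else 0)"
  proof -
    have "P n" using \<open>P (Greatest P)\<close> by (simp add: n_def)
    then obtain x y :: "nat \<Rightarrow> 'a" where "\<forall>i<n. x i \<in> carrier A \<and> y i \<in> carrier A"
      "\<forall>i<n. \<forall>j<n. \<phi> (x i \<otimes> y j) = (if i = j then 1 else 0)"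
      unfolding P_def by (elim exE conjE)
    then show ?thesis by (intro that[of x y]) simp_all
  qed
  have delta: "(\<Sum>i<n. c i * \<phi> (x i \<otimes> y k)) = c k" "(\<Sum>i<n. c i * \<phi> (x k \<otimes> y i)) = c k" if "k < n" for k c
  proof -
    have "(\<Sum>i<n. c i * \<phi> (x i \<otimes> y k)) = (\<Sum>i<n. if i = k then c i else 0)"
      using that dual by (intro sum.cong) auto
    then show "(\<Sum>i<n. c i * \<phi> (x i \<otimes> y k)) = c k" using that by simp
    have "(\<Sum>i<n. c i * \<phi> (x k \<otimes> y i)) = (\<Sum>i<n. if i = k then c i else 0)"
      using that dual by (intro sum.cong) auto
    then show "(\<Sum>i<n. c i * \<phi> (x k \<otimes> y i)) = c k" using that by simp
  qed
  have main: "\<phi> (a \<otimes> b) = (\<Sum>i<n. \<phi> (a \<otimes> y i) * \<phi> (x i \<otimes> b))" if a: "a \<in> carrier A" and b: "b \<in> carrier A" for a b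
  proof (rule ccontr)
    assume ne: "\<phi> (a \<otimes> b) \<noteq> (\<Sum>i<n. \<phi> (a \<otimes> y i) * \<phi> (x i \<otimes> b))"
    define R where "R = \<phi> (a \<otimes> b) - (\<Sum>i<n. \<phi> (a \<otimes> y i) * \<phi> (x i \<otimes> b))"
    have R: "R \<noteq> 0" using ne by (simp add: R_def)
    have xyn: "i \<in> {..<n} \<Longrightarrow> x i \<in> carrier A" "i \<in> {..<n} \<Longrightarrow> y i \<in> carrier A" for i using xA yA by auto
    from ex_linear_combination[OF finite_lessThan xyn(1), where v = "\<lambda>i. - \<phi> (a \<otimes> y i)"]
    obtain za where za: "za \<in> carrier A" "\<forall>\<psi>. linear_functional A \<psi> \<longrightarrow> \<psi> za = (\<Sum>i<n. - \<phi> (a \<otimes> y i) * \<psi> (x i))" ..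
    note za = za(1) za(2)[rule_format]
    from ex_linear_combination[OF finite_lessThan xyn(2), where v = "\<lambda>i. - \<phi> (x i \<otimes> b)"]
    obtain zb where zb: "zb \<in> carrier A" "\<forall>\<psi>. linear_functional A \<psi> \<longrightarrow> \<psi> zb = (\<Sum>i<n. - \<phi> (x i \<otimes> b) * \<psi> (y i))" ..
    note zb = zb(1) zb(2)[rule_format]
    \<comment> \<open>\<open>a'\<close> and \<open>b'\<close> are \<open>a\<close> and
      \<open>b\<close> without their components along the dual system. The value of the form at the
      remainders is \<open>R\<close>, which the factor \<open>1 / R\<close> in \<open>b'\<close>
      normalises to 1.\<close>
    define a' where "a' = a \<oplus> za"
    define b' where "b' = (1 / R) \<odot> (b \<oplus> zb)"
    have a'A: "a' \<in> carrier A" and b'A: "b' \<in> carrier A" using a b za zb by (auto simp: a'_def b'_def)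
    have left: "\<psi> a' = \<psi> a - (\<Sum>i<n. \<phi> (a \<otimes> y i) * \<psi> (x i))" if "linear_functional A \<psi>" for \<psi>
      using functional_plus[OF that a za(1)] za(2)[OF that] by (simp add: a'_def sum_negf)
    have right: "\<psi> b' = (\<psi> b - (\<Sum>i<n. \<phi> (x i \<otimes> b) * \<psi> (y i))) / R" if "linear_functional A \<psi>" for \<psi>
      using functional_smult[OF that, of "b \<oplus> zb" "1 / R"] functional_plus[OF that b zb(1)] zb(1) zb(2)[OF that] b
      by (simp add: b'_def sum_negf)
    have 1: "\<phi> (a' \<otimes> y k) = 0" if "k < n" for k
      using left[OF linear_functional_mult_right[OF l yA[OF that]]] delta(1)[OF that, of "\<lambda>i. \<phi> (a \<otimes> y i)"] by simp
    have 2: "\<phi> (x k \<otimes> b') = 0" if "k < n" for k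
      using right[OF linear_functional_mult_left[OF l xA[OF that]]] delta(2)[OF that, of "\<lambda>i. \<phi> (x i \<otimes> b)"] by simp
    have "\<phi> (a' \<otimes> b) = R"
      using left[OF linear_functional_mult_right[OF l b]] by (simp add: R_def)
    then have 3: "\<phi> (a' \<otimes> b') = 1"
      using right[OF linear_functional_mult_left[OF l a'A]] 1 R by simp
    have "P (Suc n)"
      unfolding P_def
    proof (intro exI conjI allI impI)
      fix i assume "i < Suc n"
      then show "(x(n := a')) i \<in> carrier A" "(y(n := b')) i \<in> carrier A"
        using xA yA a'A b'A by (auto simp: less_Suc_eq)
    next
      fix i j assume "i < Suc n" "j < Suc n"
      then show "\<phi> ((x(n := a')) i \<otimes> (y(n := b')) j) = (if i = j then 1 else 0)"
        using dual 1 2 3 by (auto simp: less_Suc_eq)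
    qed
    then show False using notP by simp
  qed
  \<comment> \<open>The matrix of multiplication by \<open>a\<close> relative to the dual system.
    Its multiplicativity is the reproducing identity \<open>main\<close> with the cut between
    \<open>a\<close> and \<open>b\<close>.\<close>
  define r where "r = (\<lambda>a i j. \<phi> (x i \<otimes> a \<otimes> y j))"
  have "matrix_rep n r"
    unfolding matrix_rep_def
  proof (intro allI impI conjI ballI)
    fix i j assume ij: "i < n" "j < n"
    show "functional A (\<lambda>a. r a i j)"
      unfolding r_def using functional_mult_left[OF functional_mult_right[OF \<phi> yA[OF ij(2)]] xA[OF ij(1)]] .
    show "r \<one> i j = (if i = j then 1 else 0)" using ij xA yA dual by (simp add: r_def)
    fix a b assume ab: "a \<in> carrier A" "b \<in> carrier A"
    have "r (a \<otimes> b) i j = \<phi> ((x i \<otimes> a) \<otimes> (b \<otimes> y j))" using ab xA[OF ij(1)] yA[OF ij(2)] by (simp add: r_def m_assoc)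
    also have "\<dots> = (\<Sum>k<n. \<phi> (x i \<otimes> a \<otimes> y k) * \<phi> (x k \<otimes> (b \<otimes> y j)))"
      using ab xA[OF ij(1)] yA[OF ij(2)] by (intro main) auto
    also have "\<dots> = (\<Sum>k<n. r a i k * r b k j)"
      using ab xA yA[OF ij(2)] by (intro sum.cong) (auto simp: r_def m_assoc)
    finally show "r (a \<otimes> b) i j = (\<Sum>k<n. r a i k * r b k j)" .
  qed
  \<comment> \<open>The reproducing identity is used twice, with \<open>\<one>\<close> on the left
    and then on the right of \<open>a\<close>.\<close>
  moreover have "\<phi> a = (\<Sum>i<n. \<Sum>j<n. \<phi> (y i) * r a i j * \<phi> (x j))" if a: "a \<in> carrier A" for a
  proof -
    have "\<phi> a = \<phi> (\<one> \<otimes> a)" using a by simp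
    also have "\<dots> = (\<Sum>i<n. \<phi> (y i) * \<phi> (x i \<otimes> a))"
      unfolding main[OF one_closed a] using yA by (intro sum.cong) auto
    also have "\<dots> = (\<Sum>i<n. \<phi> (y i) * (\<Sum>j<n. r a i j * \<phi> (x j)))"
    proof (intro sum.cong refl arg_cong2[of _ _ _ _ "(*)"])
      fix i assume "i \<in> {..<n}"
      then have xi: "x i \<in> carrier A" using xA by simp
      have "\<phi> (x i \<otimes> a) = \<phi> ((x i \<otimes> a) \<otimes> \<one>)" using xi a by simp
      also have "\<dots> = (\<Sum>j<n. r a i j * \<phi> (x j))"
        unfolding main[OF m_closed[OF xi a] one_closed] using xA by (intro sum.cong) (auto simp: r_def)
      finally show "\<phi> (x i \<otimes> a) = (\<Sum>j<n. r a i j * \<phi> (x j))" .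
    qed
    finally show ?thesis by (simp add: sum_distrib_left mult.assoc)
  qed
  ultimately show ?thesis
    by (intro exI[of _ n] exI[of _ r] exI[of _ "\<lambda>i. \<phi> (y i)"] exI[of _ "\<lambda>j. \<phi> (x j)"] conjI ballI)
qed

end

section \<open>Matrix algebras as test algebras\<close>

lemma carrier_complex_power [simp]: "carrier (complex_power I) = (\<Pi>\<^sub>E j\<in>I. UNIV)"
  and zero_complex_power [simp]: "\<zero>\<^bsub>complex_power I\<^esub> = (\<lambda>j\<in>I. 0)"
  and add_complex_power [simp]: "x \<oplus>\<^bsub>complex_power I\<^esub> y = (\<lambda>j\<in>I. x j + y j)"
  and smult_complex_power [simp]: "a \<odot>\<^bsub>complex_power I\<^esub> x = (\<lambda>j\<in>I. a * x j)"
  and topo_complex_power [simp]: "topo (complex_power I) = product_topology (\<lambda>j. euclidean) I"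
  by (simp_all add: complex_power_def)

lemma continuous_map_complex_powerI:
  assumes "\<And>x. x \<in> topspace Z \<Longrightarrow> f x \<in> extensional I"
    and "\<And>k. k \<in> I \<Longrightarrow> continuous_map Z euclidean (\<lambda>x. f x k)"
  shows "continuous_map Z (product_topology (\<lambda>j. euclidean) I) f"
  using assms by (auto simp: continuous_map_componentwise)

text \<open>The fields for the product are left open, since \<open>matrix_algebra\<close> replaces
  those of the power.\<close>

lemma topological_vector_space_complex_power:
  fixes I :: "'i set" and m u
  defines "V \<equiv> (complex_power I)\<lparr>monoid.mult := m, one := u\<rparr>"
  shows "topological_vector_space V"
proof -
  have ag: "abelian_group V"
  proof (rule abelian_groupI)
    fix x assume "x \<in> carrier V"
    then show "\<exists>y\<in>carrier V. y \<oplus>\<^bsub>V\<^esub> x = \<zero>\<^bsub>V\<^esub>"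
      by (intro bexI[of _ "\<lambda>j\<in>I. - x j"]) (auto simp: V_def fun_eq_iff)
  qed (auto simp: V_def fun_eq_iff PiE_iff extensional_def)
  have "Module.module complex_field V"
  proof (rule moduleI[OF cring_from_type_algebra ag])
  qed (auto simp: V_def ring_of_type_algebra_def fun_eq_iff PiE_iff extensional_def algebra_simps)
  moreover have "continuous_map (prod_topology (topo V) (topo V)) (topo V) (\<lambda>(x, y). x \<oplus>\<^bsub>V\<^esub> y)"
  proof -
    have "continuous_map (prod_topology (topo V) (topo V)) euclidean (\<lambda>p. fst p k + snd p k)"
      if k: "k \<in> I" for k
    proof (intro continuous_map_add)
      have c: "continuous_map (topo V) euclidean (\<lambda>x. x k)"
        using continuous_map_product_projection[OF k, of "\<lambda>j. euclidean"] by (simp add: V_def)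
      show "continuous_map (prod_topology (topo V) (topo V)) euclidean (\<lambda>p. fst p k)"
        using continuous_map_compose[OF continuous_map_fst c] by (simp add: o_def)
      show "continuous_map (prod_topology (topo V) (topo V)) euclidean (\<lambda>p. snd p k)"
        using continuous_map_compose[OF continuous_map_snd c] by (simp add: o_def)
    qed
    then have "continuous_map (prod_topology (topo V) (topo V)) (product_topology (\<lambda>j. euclidean) I)
        (\<lambda>p. \<lambda>j\<in>I. fst p j + snd p j)"
      by (intro continuous_map_complex_powerI) auto
    then show ?thesis by (simp add: V_def case_prod_unfold)
  qed
  moreover have "continuous_map (prod_topology euclidean (topo V)) (topo V) (\<lambda>(a, x). a \<odot>\<^bsub>V\<^esub> x)"
  proof -
    have "continuous_map (prod_topology euclidean (topo V)) euclidean (\<lambda>p. fst p * snd p k)"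
      if k: "k \<in> I" for k
    proof (intro continuous_map_mult_complex)
      have c: "continuous_map (topo V) euclidean (\<lambda>x. x k)"
        using continuous_map_product_projection[OF k, of "\<lambda>j. euclidean"] by (simp add: V_def)
      show "continuous_map (prod_topology euclidean (topo V)) euclidean fst" by (rule continuous_map_fst)
      show "continuous_map (prod_topology euclidean (topo V)) euclidean (\<lambda>p. snd p k)"
        using continuous_map_compose[OF continuous_map_snd c] by (simp add: o_def)
    qed
    then have "continuous_map (prod_topology euclidean (topo V)) (product_topology (\<lambda>j. euclidean) I)
        (\<lambda>p. \<lambda>j\<in>I. fst p * snd p j)"
      by (intro continuous_map_complex_powerI) auto
    then show ?thesis by (simp add: V_def case_prod_unfold)
  qed
  ultimately show ?thesis by (simp add: topological_vector_space_def V_def)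
qed

text \<open>The definition asks for an index set inside the type of the vectors, so \<open>I\<close>
  is replaced by its image under the unit vectors \<open>e\<close>; \<open>f\<close> and
  \<open>g\<close> merely reindex.\<close>

lemma weakly_complete_complex_power:
  fixes I :: "'i set" and m u
  defines "V \<equiv> (complex_power I)\<lparr>monoid.mult := m, one := u\<rparr>"
  shows "weakly_complete V"
proof -
  define e :: "'i \<Rightarrow> 'i \<Rightarrow> complex" where "e = (\<lambda>p q. of_bool (q = p))"
  have inj: "inj_on e I"
  proof (rule inj_onI)
    fix p q assume "e p = e q"
    then have "e p p = e q p" by simp
    then show "p = q" by (simp add: e_def split: if_splits)
  qed
  define f :: "('i \<Rightarrow> complex) \<Rightarrow> ('i \<Rightarrow> complex) \<Rightarrow> complex" where
    "f = (\<lambda>x. \<lambda>j\<in>e ` I. x (inv_into I e j))"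
  define g :: "(('i \<Rightarrow> complex) \<Rightarrow> complex) \<Rightarrow> 'i \<Rightarrow> complex" where
    "g = (\<lambda>y. \<lambda>i\<in>I. y (e i))"
  have "linear_map V (complex_power (e ` I)) f"
    using inj by (auto simp: linear_map_def V_def f_def fun_eq_iff)
  moreover have "homeomorphic_maps (topo V) (topo (complex_power (e ` I))) f g"
    unfolding homeomorphic_maps_def
  proof (intro conjI ballI)
    have "continuous_map (product_topology (\<lambda>j. euclidean) I) euclidean (\<lambda>x :: 'i \<Rightarrow> complex. f x k)"
      if "k \<in> e ` I" for k
      using that continuous_map_product_projection[of "inv_into I e k" I "\<lambda>j. euclidean"]
      by (simp add: f_def inv_into_into)
    then show "continuous_map (topo V) (topo (complex_power (e ` I))) f"
      unfolding V_def by (simp, intro continuous_map_complex_powerI) (auto simp: f_def)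
    have "continuous_map (product_topology (\<lambda>j. euclidean) (e ` I)) euclidean (\<lambda>y :: _ \<Rightarrow> complex. g y k)"
      if "k \<in> I" for k
      using that continuous_map_product_projection[of "e k" "e ` I" "\<lambda>j. euclidean"]
      by (simp add: g_def)
    then show "continuous_map (topo (complex_power (e ` I))) (topo V) g"
      unfolding V_def by (simp, intro continuous_map_complex_powerI) (auto simp: g_def)
    show "g (f x) = x" if "x \<in> topspace (topo V)" for x
      using that inj by (auto simp: V_def f_def g_def fun_eq_iff PiE_iff extensional_def)
    show "f (g y) = y" if "y \<in> topspace (topo (complex_power (e ` I)))" for y
      using that inj by (auto simp: f_def g_def fun_eq_iff PiE_iff extensional_def inv_into_into f_inv_into_f)
  qed
  ultimately show ?thesis
    unfolding weakly_complete_def using topological_vector_space_complex_power[where I = I and m = m and u = u]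
    by (auto simp: V_def homeomorphic_map_maps)
qed

text \<open>Matrix positions are encoded as constant functions, which exist for every type \<^typ>\<open>'g\<close>; so
  matrix algebras of all sizes have copies in \<^typ>\<open>'g group_algebra_universe\<close>.\<close>

definition mat_index :: "nat \<Rightarrow> nat \<Rightarrow> 'g \<Rightarrow> complex" where
  "mat_index i j = (\<lambda>_. Complex (real i) (real j))"

text \<open>Any argument would do in place of \<open>undefined\<close>, as encoded positions are
  constant functions.\<close>

definition mat_row :: "('g \<Rightarrow> complex) \<Rightarrow> nat" where "mat_row p = nat \<lfloor>Re (p undefined)\<rfloor>"
definition mat_col :: "('g \<Rightarrow> complex) \<Rightarrow> nat" where "mat_col p = nat \<lfloor>Im (p undefined)\<rfloor>"

lemma mat_row_index [simp]: "mat_row (mat_index i j) = i"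
  and mat_col_index [simp]: "mat_col (mat_index i j) = j"
  by (simp_all add: mat_row_def mat_col_def mat_index_def)

definition mat_indices :: "nat \<Rightarrow> ('g \<Rightarrow> complex) set" where
  "mat_indices n = (\<lambda>(i, j). mat_index i j) ` ({..<n} \<times> {..<n})"

lemma mat_index_in [simp]: "i < n \<Longrightarrow> j < n \<Longrightarrow> mat_index i j \<in> mat_indices n"
  by (auto simp: mat_indices_def)

lemma mat_indicesE:
  assumes "p \<in> mat_indices n" obtains i j where "i < n" "j < n" "p = mat_index i j"
  using assms by (auto simp: mat_indices_def)

definition mat_of :: "nat \<Rightarrow> (nat \<Rightarrow> nat \<Rightarrow> complex) \<Rightarrow> 'g group_algebra_universe" where
  "mat_of n M = (\<lambda>p\<in>mat_indices n. M (mat_row p) (mat_col p))"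

lemma mat_of_entry [simp]: "i < n \<Longrightarrow> j < n \<Longrightarrow> mat_of n M (mat_index i j) = M i j"
  by (simp add: mat_of_def)

lemma mat_of_extensional [simp]: "mat_of n M \<in> extensional (mat_indices n)"
  by (simp add: mat_of_def)

lemma mat_eqI:
  assumes "x \<in> extensional (mat_indices n)" "y \<in> extensional (mat_indices n)"
    "\<And>i j. i < n \<Longrightarrow> j < n \<Longrightarrow> x (mat_index i j) = y (mat_index i j)"
  shows "x = y"
  using assms by (intro extensionalityI[of x "mat_indices n"]) (auto elim: mat_indicesE)

definition matrix_algebra :: "nat \<Rightarrow> 'g group_algebra_universe topological_module" where
  "matrix_algebra n = (complex_power (mat_indices n))
     \<lparr>monoid.mult := (\<lambda>x y. mat_of n (\<lambda>i j. \<Sum>k<n. x (mat_index i k) * y (mat_index k j))),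
      one := mat_of n (\<lambda>i j. if i = j then 1 else 0)\<rparr>"

lemma matrix_algebra_simps [simp]:
  "carrier (matrix_algebra n) = extensional (mat_indices n)"
  "x \<otimes>\<^bsub>matrix_algebra n\<^esub> y = mat_of n (\<lambda>i j. \<Sum>k<n. x (mat_index i k) * y (mat_index k j))"
  "\<one>\<^bsub>matrix_algebra n\<^esub> = mat_of n (\<lambda>i j. if i = j then 1 else 0)"
  "\<zero>\<^bsub>matrix_algebra n\<^esub> = (\<lambda>p\<in>mat_indices n. 0)"
  "x \<oplus>\<^bsub>matrix_algebra n\<^esub> y = (\<lambda>p\<in>mat_indices n. x p + y p)"
  "a \<odot>\<^bsub>matrix_algebra n\<^esub> x = (\<lambda>p\<in>mat_indices n. a * x p)"
  "topo (matrix_algebra n) = product_topology (\<lambda>j. euclidean) (mat_indices n)"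
  by (auto simp: matrix_algebra_def PiE_def)

lemma continuous_map_matrixI:
  assumes "\<And>x. x \<in> topspace Z \<Longrightarrow> f x \<in> extensional (mat_indices n)"
    and "\<And>i j. i < n \<Longrightarrow> j < n \<Longrightarrow> continuous_map Z euclidean (\<lambda>x. f x (mat_index i j))"
  shows "continuous_map Z (topo (matrix_algebra n)) f"
  unfolding matrix_algebra_simps
  using assms by (intro continuous_map_complex_powerI) (auto elim!: mat_indicesE)

lemma continuous_map_entry:
  "i < n \<Longrightarrow> j < n \<Longrightarrow> continuous_map (topo (matrix_algebra n)) euclidean (\<lambda>x. x (mat_index i j))"
  using continuous_map_product_projection[of "mat_index i j" "mat_indices n" "\<lambda>j. euclidean"] by simp

lemma sum_delta_mult:
  fixes f :: "nat \<Rightarrow> complex"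
  assumes "i < n"
  shows "(\<Sum>k<n. (if i = k then 1 else 0) * f k) = f i" "(\<Sum>k<n. f k * (if k = i then 1 else 0)) = f i"
proof -
  have "(\<Sum>k<n. (if i = k then 1 else 0) * f k) = (\<Sum>k<n. if i = k then f k else 0)"
    by (intro sum.cong) auto
  then show "(\<Sum>k<n. (if i = k then 1 else 0) * f k) = f i" using assms by simp
  have "(\<Sum>k<n. f k * (if k = i then 1 else 0)) = (\<Sum>k<n. if k = i then f k else 0)"
    by (intro sum.cong) auto
  then show "(\<Sum>k<n. f k * (if k = i then 1 else 0)) = f i" using assms by simp
qed

lemma weakly_complete_algebra_matrix_algebra: "weakly_complete_algebra (matrix_algebra n)"
proof -
  let ?B = "matrix_algebra n :: 'g group_algebra_universe topological_module"
  have wc: "weakly_complete ?B"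
    unfolding matrix_algebra_def by (rule weakly_complete_complex_power)
  then have "Module.module complex_field ?B"
    unfolding weakly_complete_def topological_vector_space_def by (elim conjE)
  then have ag: "abelian_group ?B" by (rule Module.module.axioms(2))
  have assoc: "x \<otimes>\<^bsub>?B\<^esub> y \<otimes>\<^bsub>?B\<^esub> z = x \<otimes>\<^bsub>?B\<^esub> (y \<otimes>\<^bsub>?B\<^esub> z)" for x y z
  proof (rule mat_eqI[of _ n])
    fix i j assume "i < n" "j < n"
    then have "(x \<otimes>\<^bsub>?B\<^esub> y \<otimes>\<^bsub>?B\<^esub> z) (mat_index i j) =
        (\<Sum>k<n. \<Sum>l<n. x (mat_index i l) * y (mat_index l k) * z (mat_index k j))"
      by (simp add: sum_distrib_right)
    also have "\<dots> = (\<Sum>l<n. \<Sum>k<n. x (mat_index i l) * y (mat_index l k) * z (mat_index k j))"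
      by (rule sum.swap)
    also have "\<dots> = (x \<otimes>\<^bsub>?B\<^esub> (y \<otimes>\<^bsub>?B\<^esub> z)) (mat_index i j)"
      using \<open>i < n\<close> \<open>j < n\<close> by (simp add: sum_distrib_left mult.assoc)
    finally show "(x \<otimes>\<^bsub>?B\<^esub> y \<otimes>\<^bsub>?B\<^esub> z) (mat_index i j) = (x \<otimes>\<^bsub>?B\<^esub> (y \<otimes>\<^bsub>?B\<^esub> z)) (mat_index i j)" .
  qed simp_all
  have mon: "monoid ?B"
  proof (rule monoidI)
    fix x assume x: "x \<in> carrier ?B"
    show "\<one>\<^bsub>?B\<^esub> \<otimes>\<^bsub>?B\<^esub> x = x"
      using x by (intro mat_eqI[of _ n]) (simp_all add: sum_delta_mult)
    show "x \<otimes>\<^bsub>?B\<^esub> \<one>\<^bsub>?B\<^esub> = x"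
      using x by (intro mat_eqI[of _ n]) (simp_all add: sum_delta_mult)
  qed (use assoc in simp_all)
  have "ring ?B"
  proof (rule ringI[OF ag mon])
    fix x y z
    show "(x \<oplus>\<^bsub>?B\<^esub> y) \<otimes>\<^bsub>?B\<^esub> z = x \<otimes>\<^bsub>?B\<^esub> z \<oplus>\<^bsub>?B\<^esub> y \<otimes>\<^bsub>?B\<^esub> z"
      by (rule mat_eqI[of _ n]) (simp_all add: distrib_right sum.distrib)
    show "z \<otimes>\<^bsub>?B\<^esub> (x \<oplus>\<^bsub>?B\<^esub> y) = z \<otimes>\<^bsub>?B\<^esub> x \<oplus>\<^bsub>?B\<^esub> z \<otimes>\<^bsub>?B\<^esub> y"
      by (rule mat_eqI[of _ n]) (simp_all add: distrib_left sum.distrib)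
  qed
  moreover have "bilinear_map ?B ?B ?B (\<lambda>(x, y). x \<otimes>\<^bsub>?B\<^esub> y)"
    unfolding bilinear_map_def linear_map_def
  proof (intro ballI conjI allI)
    fix x y z :: "'g group_algebra_universe" and a
    show "(case (x, y \<oplus>\<^bsub>?B\<^esub> z) of (x, y) \<Rightarrow> x \<otimes>\<^bsub>?B\<^esub> y) = (case (x, y) of (x, y) \<Rightarrow> x \<otimes>\<^bsub>?B\<^esub> y) \<oplus>\<^bsub>?B\<^esub> (case (x, z) of (x, y) \<Rightarrow> x \<otimes>\<^bsub>?B\<^esub> y)"
      unfolding prod.case by (rule mat_eqI[of _ n]) (simp_all add: distrib_left sum.distrib)
    show "(case (x, a \<odot>\<^bsub>?B\<^esub> y) of (x, y) \<Rightarrow> x \<otimes>\<^bsub>?B\<^esub> y) = a \<odot>\<^bsub>?B\<^esub> (case (x, y) of (x, y) \<Rightarrow> x \<otimes>\<^bsub>?B\<^esub> y)"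
      unfolding prod.case by (rule mat_eqI[of _ n]) (simp_all add: sum_distrib_left mult_ac)
    show "(case (y \<oplus>\<^bsub>?B\<^esub> z, x) of (x, y) \<Rightarrow> x \<otimes>\<^bsub>?B\<^esub> y) = (case (y, x) of (x, y) \<Rightarrow> x \<otimes>\<^bsub>?B\<^esub> y) \<oplus>\<^bsub>?B\<^esub> (case (z, x) of (x, y) \<Rightarrow> x \<otimes>\<^bsub>?B\<^esub> y)"
      unfolding prod.case by (rule mat_eqI[of _ n]) (simp_all add: distrib_right sum.distrib)
    show "(case (a \<odot>\<^bsub>?B\<^esub> y, x) of (x, y) \<Rightarrow> x \<otimes>\<^bsub>?B\<^esub> y) = a \<odot>\<^bsub>?B\<^esub> (case (y, x) of (x, y) \<Rightarrow> x \<otimes>\<^bsub>?B\<^esub> y)"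
      unfolding prod.case by (rule mat_eqI[of _ n]) (simp_all add: sum_distrib_left mult_ac)
  qed auto
  moreover have "continuous_map (prod_topology (topo ?B) (topo ?B)) (topo ?B) (\<lambda>p. fst p \<otimes>\<^bsub>?B\<^esub> snd p)"
  proof (rule continuous_map_matrixI)
    fix i j assume ij: "i < n" "j < n"
    have c1: "continuous_map (prod_topology (topo ?B) (topo ?B)) euclidean (\<lambda>p. fst p (mat_index i k))" if "k < n" for k
      using continuous_map_compose[OF continuous_map_fst continuous_map_entry[OF ij(1) that]] by (simp add: o_def)
    have c2: "continuous_map (prod_topology (topo ?B) (topo ?B)) euclidean (\<lambda>p. snd p (mat_index k j))" if "k < n" for k
      using continuous_map_compose[OF continuous_map_snd continuous_map_entry[OF that ij(2)]] by (simp add: o_def)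
    have "continuous_map (prod_topology (topo ?B) (topo ?B)) euclidean
        (\<lambda>p. \<Sum>k<n. fst p (mat_index i k) * snd p (mat_index k j))"
      by (intro continuous_map_sum continuous_map_mult_complex c1 c2) auto
    then show "continuous_map (prod_topology (topo ?B) (topo ?B)) euclidean
        (\<lambda>p. (fst p \<otimes>\<^bsub>?B\<^esub> snd p) (mat_index i j))"
      using ij by simp
  qed simp
  ultimately show ?thesis
    using wc by (simp add: weakly_complete_algebra_def case_prod_unfold del: matrix_algebra_simps)
qed

section \<open>Matrix representations as morphisms into matrix algebras\<close>

context wc_algebra
begin

lemma algebra_morphism_matrix_rep:
  assumes "matrix_rep n r"
  shows "algebra_morphism A (matrix_algebra n) (\<lambda>a\<in>carrier A. mat_of n (r a))"
proof -
  have lin: "functional A (\<lambda>a. r a i j)" if "i < n" "j < n" for i j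
    using assms that by (simp add: matrix_rep_def)
  then have lin': "linear_functional A (\<lambda>a. r a i j)" if "i < n" "j < n" for i j
    using that by (simp add: functional_def)
  let ?f = "\<lambda>a\<in>carrier A. mat_of n (r a)"
  have closed: "?f x \<in> carrier (matrix_algebra n)" if "x \<in> carrier A" for x using that by simp
  have add: "?f (x \<oplus> y) = ?f x \<oplus>\<^bsub>matrix_algebra n\<^esub> ?f y" if "x \<in> carrier A" "y \<in> carrier A" for x y
    using that functional_plus[OF lin'] by (intro mat_eqI[of _ n]) auto
  have smult: "?f (a \<odot> x) = a \<odot>\<^bsub>matrix_algebra n\<^esub> ?f x" if "x \<in> carrier A" for x a
    using that functional_smult[OF lin'] by (intro mat_eqI[of _ n]) auto
  have mult: "?f (x \<otimes> y) = ?f x \<otimes>\<^bsub>matrix_algebra n\<^esub> ?f y" if "x \<in> carrier A" "y \<in> carrier A" for x y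
    using that assms by (intro mat_eqI[of _ n]) (auto simp: matrix_rep_def)
  have one: "?f \<one> = \<one>\<^bsub>matrix_algebra n\<^esub>"
    using assms by (intro mat_eqI[of _ n]) (auto simp: matrix_rep_def)
  have "continuous_map (topo A) (topo (matrix_algebra n)) ?f"
  proof (rule continuous_map_matrixI)
    fix i j assume ij: "i < n" "j < n"
    have "continuous_map (topo A) euclidean (\<lambda>a. r a i j)" using lin[OF ij] by (simp add: functional_def)
    then show "continuous_map (topo A) euclidean (\<lambda>x. ?f x (mat_index i j))"
      by (rule continuous_map_eq) (use ij in simp)
  qed simp
  moreover have "?f \<in> ring_hom A (matrix_algebra n)"
    by (intro ring_hom_memI closed add mult one)
  moreover have "linear_map A (matrix_algebra n) ?f"
    unfolding linear_map_def by (intro conjI ballI allI Pi_I closed add smult)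
  ultimately show ?thesis by (simp add: algebra_morphism_def)
qed

lemma matrix_rep_algebra_morphism:
  assumes f: "algebra_morphism A (matrix_algebra n) f"
  shows "matrix_rep n (\<lambda>a i j. f a (mat_index i j))"
  unfolding matrix_rep_def
proof (intro allI impI conjI ballI)
  have l: "linear_map A (matrix_algebra n) f" and h: "f \<in> ring_hom A (matrix_algebra n)"
    and c: "continuous_map (topo A) (topo (matrix_algebra n)) f"
    using f by (auto simp: algebra_morphism_def)
  fix i j assume ij: "i < n" "j < n"
  have "continuous_map (topo A) euclidean (\<lambda>a. f a (mat_index i j))"
    using continuous_map_compose[OF c continuous_map_entry[OF ij]] by (simp add: o_def)
  then show "functional A (\<lambda>a. f a (mat_index i j))"
    using l ij by (simp add: functional_def linear_functional_def linear_map_def)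
  show "f \<one> (mat_index i j) = (if i = j then 1 else 0)"
    using ring_hom_one[OF h] ij by simp
  fix a b assume "a \<in> carrier A" "b \<in> carrier A"
  then show "f (a \<otimes> b) (mat_index i j) = (\<Sum>k<n. f a (mat_index i k) * f b (mat_index k j))"
    using ring_hom_mult[OF h] ij by simp
qed

end

section \<open>The dual of the group algebra\<close>

lemma ex1_unique: "\<exists>!x. P x \<Longrightarrow> P x \<Longrightarrow> P y \<Longrightarrow> x = y"
  by blast

lemma functional_add:
  "functional V \<phi> \<Longrightarrow> functional V \<psi> \<Longrightarrow> functional V (\<lambda>x. \<phi> x + \<psi> x)"
  by (simp add: functional_def linear_functional_def continuous_map_add distrib_left)

lemma functional_scale: "functional V \<phi> \<Longrightarrow> functional V (\<lambda>x. c * \<phi> x)"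
  by (simp add: functional_def linear_functional_def continuous_map_mult_complex distrib_left mult.left_commute)

lemma functional_sum:
  assumes "\<And>i. i \<in> I \<Longrightarrow> functional V (\<phi> i)" shows "functional V (\<lambda>x. \<Sum>i\<in>I. \<phi> i x)"
  using assms
proof (induction I rule: infinite_finite_induct)
  case (insert i I)
  then show ?case using functional_add[of V "\<phi> i" "\<lambda>x. \<Sum>i\<in>I. \<phi> i x"] by simp
qed (simp_all add: functional_def linear_functional_def)

locale compact_group_algebra = compact_comm_group G T + A: wc_algebra A
  for G :: "('g, 'm) monoid_scheme" (structure) and T :: "'g topology" and A :: "'a topological_module" +
  fixes \<eta> :: "'g \<Rightarrow> 'a"
  assumes group_algebra: "group_algebra G T A \<eta>"
begin

lemma eta_hom: "\<eta> \<in> hom G (units_of A)"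
  and eta_cont: "continuous_map T (topo A) \<eta>"
  using group_algebra
  by (auto simp: group_algebra_def unit_group_morphism_def continuous_map_in_subtopology)

lemma eta_closed [simp]: "g \<in> carrier G \<Longrightarrow> \<eta> g \<in> carrier A"
  using eta_hom by (auto simp: hom_def units_of_carrier Pi_iff)

lemma eta_mult: "g \<in> carrier G \<Longrightarrow> h \<in> carrier G \<Longrightarrow> \<eta> (g \<otimes> h) = \<eta> g \<otimes>\<^bsub>A\<^esub> \<eta> h"
  using eta_hom by (auto simp: hom_def units_of_mult)

lemma eta_one: "\<eta> \<one> = \<one>\<^bsub>A\<^esub>"
  using hom_one[OF eta_hom is_group A.units_group] by (simp add: units_of_one)

lemma functional_eta_cont: "functional A \<phi> \<Longrightarrow> cont (\<lambda>g. \<phi> (\<eta> g))"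
  using continuous_map_compose[OF eta_cont, of euclidean \<phi>] by (simp add: functional_def o_def)

lemma unit_group_morphism_matrix:
  fixes F :: "'g \<Rightarrow> nat \<Rightarrow> nat \<Rightarrow> complex"
  assumes c: "\<And>i j. i < n \<Longrightarrow> j < n \<Longrightarrow> cont (\<lambda>g. F g i j)"
    and one: "\<And>i j. i < n \<Longrightarrow> j < n \<Longrightarrow> F \<one> i j = (if i = j then 1 else 0)"
    and mult: "\<And>g h i j. g \<in> carrier G \<Longrightarrow> h \<in> carrier G \<Longrightarrow> i < n \<Longrightarrow> j < n \<Longrightarrow>
      F (g \<otimes> h) i j = (\<Sum>k<n. F g i k * F h k j)"
  shows "unit_group_morphism G T (matrix_algebra n :: 'g group_algebra_universe topological_module) (\<lambda>g. mat_of n (F g))"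
proof -
  let ?B = "matrix_algebra n :: 'g group_algebra_universe topological_module"
  have m: "mat_of n (F g) \<otimes>\<^bsub>?B\<^esub> mat_of n (F h) = mat_of n (F (g \<otimes> h))"
    if "g \<in> carrier G" "h \<in> carrier G" for g h
    using that mult by (intro mat_eqI[of _ n]) auto
  have o: "mat_of n (F \<one>) = \<one>\<^bsub>?B\<^esub>" using one by (intro mat_eqI[of _ n]) auto
  have u: "mat_of n (F g) \<in> Units ?B" if g: "g \<in> carrier G" for g
    unfolding Units_def
  proof (intro CollectI conjI bexI[of _ "mat_of n (F (inv g))"])
    show "mat_of n (F (inv g)) \<otimes>\<^bsub>?B\<^esub> mat_of n (F g) = \<one>\<^bsub>?B\<^esub>"
      unfolding m[OF inv_closed[OF g] g] using g o by simp
    show "mat_of n (F g) \<otimes>\<^bsub>?B\<^esub> mat_of n (F (inv g)) = \<one>\<^bsub>?B\<^esub>"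
      unfolding m[OF g inv_closed[OF g]] using g o by simp
  qed simp_all
  have "continuous_map T (topo ?B) (\<lambda>g. mat_of n (F g))"
    using c by (intro continuous_map_matrixI) simp_all
  then have "continuous_map T (subtopology (topo ?B) (Units ?B)) (\<lambda>g. mat_of n (F g))"
    unfolding continuous_map_in_subtopology using u by auto
  moreover have "(\<lambda>g. mat_of n (F g)) \<in> hom G (units_of ?B)"
    unfolding hom_def units_of_carrier units_of_mult using u m by (simp del: matrix_algebra_simps)
  ultimately show ?thesis by (simp add: unit_group_morphism_def)
qed

lemma matrix_rep_eta:
  assumes r: "A.matrix_rep n r"
  shows "\<And>i j. i < n \<Longrightarrow> j < n \<Longrightarrow> cont (\<lambda>g. r (\<eta> g) i j)"
    "\<And>i j. i < n \<Longrightarrow> j < n \<Longrightarrow> r (\<eta> \<one>) i j = (if i = j then 1 else 0)"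
    "\<And>g h i j. g \<in> carrier G \<Longrightarrow> h \<in> carrier G \<Longrightarrow> i < n \<Longrightarrow> j < n \<Longrightarrow>
      r (\<eta> (g \<otimes> h)) i j = (\<Sum>k<n. r (\<eta> g) i k * r (\<eta> h) k j)"
proof -
  fix i j assume "i < n" "j < n"
  then show "cont (\<lambda>g. r (\<eta> g) i j)"
    by (intro functional_eta_cont[of "\<lambda>a. r a i j"]) (use r in \<open>simp add: A.matrix_rep_def\<close>)
qed (use r in \<open>simp_all add: A.matrix_rep_def eta_one eta_mult\<close>)

lemma universal_property:
  fixes B :: "'g group_algebra_universe topological_module"
  assumes "weakly_complete_algebra B" "unit_group_morphism G T B f"
  shows "\<exists>!f'. f' \<in> extensional (carrier A) \<and> algebra_morphism A B f' \<and> (\<forall>g\<in>carrier G. f' (\<eta> g) = f g)"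
proof -
  have all: "\<forall>(B :: 'g group_algebra_universe topological_module) f.
      weakly_complete_algebra B \<and> unit_group_morphism G T B f \<longrightarrow>
      (\<exists>!f'. f' \<in> extensional (carrier A) \<and> algebra_morphism A B f' \<and> (\<forall>g\<in>carrier G. f' (\<eta> g) = f g))"
    using group_algebra unfolding group_algebra_def by (elim conjE)
  show ?thesis by (rule all[rule_format]) (simp add: assms)
qed

text \<open>Both representations extend the same morphism from \<open>G\<close> to the units of a
  matrix algebra, so the uniqueness half of the universal property identifies them.\<close>

lemma matrix_rep_unique:
  assumes r: "A.matrix_rep n r" and r': "A.matrix_rep n r'"
    and eq: "\<And>g i j. g \<in> carrier G \<Longrightarrow> i < n \<Longrightarrow> j < n \<Longrightarrow> r (\<eta> g) i j = r' (\<eta> g) i j"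
    and a: "a \<in> carrier A" and ij: "i < n" "j < n"
  shows "r a i j = r' a i j"
proof -
  let ?B = "matrix_algebra n :: 'g group_algebra_universe topological_module"
  let ?f = "\<lambda>r. \<lambda>a\<in>carrier A. mat_of n (r a) :: 'g group_algebra_universe"
  have ugm: "unit_group_morphism G T ?B (\<lambda>g. mat_of n (r (\<eta> g)))"
    by (rule unit_group_morphism_matrix[OF matrix_rep_eta[OF r]])
  have "mat_of n (r' (\<eta> g)) = (mat_of n (r (\<eta> g)) :: 'g group_algebra_universe)" if "g \<in> carrier G" for g
    using that eq by (intro mat_eqI[of _ n]) simp_all
  then have 1: "\<forall>g\<in>carrier G. ?f r (\<eta> g) = mat_of n (r (\<eta> g))" "\<forall>g\<in>carrier G. ?f r' (\<eta> g) = mat_of n (r (\<eta> g))"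
    by simp_all
  have "?f r = ?f r'"
    by (rule ex1_unique[OF universal_property[OF weakly_complete_algebra_matrix_algebra ugm]])
      (intro conjI restrict_extensional A.algebra_morphism_matrix_rep r r' 1)+
  then have "?f r a (mat_index i j) = ?f r' a (mat_index i j)" by simp
  then show ?thesis using a ij by simp
qed

text \<open>A character is a representation by matrices of size 1, to which the existence half of
  the universal property applies.\<close>

lemma ex_character_extension:
  assumes w: "\<omega> \<in> characters"
  shows "\<exists>\<phi>. functional A \<phi> \<and> \<phi> \<one>\<^bsub>A\<^esub> = 1 \<and> (\<forall>a\<in>carrier A. \<forall>b\<in>carrier A. \<phi> (a \<otimes>\<^bsub>A\<^esub> b) = \<phi> a * \<phi> b) \<and>
     (\<forall>g\<in>carrier G. \<phi> (\<eta> g) = \<omega> g)"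
proof -
  let ?F = "\<lambda>g (i::nat) (j::nat). \<omega> g"
  have "unit_group_morphism G T (matrix_algebra 1 :: 'g group_algebra_universe topological_module) (\<lambda>g. mat_of 1 (?F g))"
    using w by (intro unit_group_morphism_matrix) (auto simp: charactersD character_one)
  from universal_property[OF weakly_complete_algebra_matrix_algebra this]
  obtain f' :: "'a \<Rightarrow> 'g group_algebra_universe" where f': "algebra_morphism A (matrix_algebra 1) f'" "\<forall>g\<in>carrier G. f' (\<eta> g) = mat_of 1 (?F g)"
    by (elim ex1E conjE)
  have "A.matrix_rep 1 (\<lambda>a i j. f' a (mat_index i j))" by (rule A.matrix_rep_algebra_morphism[OF f'(1)])
  then show ?thesis using f'(2)
    by (intro exI[of _ "\<lambda>a. f' a (mat_index 0 0)"]) (auto simp: A.matrix_rep_def)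
qed

definition ext :: "('g \<Rightarrow> complex) \<Rightarrow> 'a \<Rightarrow> complex" where
  "ext \<omega> = (SOME \<phi>. functional A \<phi> \<and> \<phi> \<one>\<^bsub>A\<^esub> = 1 \<and> (\<forall>a\<in>carrier A. \<forall>b\<in>carrier A. \<phi> (a \<otimes>\<^bsub>A\<^esub> b) = \<phi> a * \<phi> b) \<and>
     (\<forall>g\<in>carrier G. \<phi> (\<eta> g) = \<omega> g))"

lemma ext:
  assumes "\<omega> \<in> characters"
  shows "functional A (ext \<omega>)" "ext \<omega> \<one>\<^bsub>A\<^esub> = 1"
    "a \<in> carrier A \<Longrightarrow> b \<in> carrier A \<Longrightarrow> ext \<omega> (a \<otimes>\<^bsub>A\<^esub> b) = ext \<omega> a * ext \<omega> b"
    "g \<in> carrier G \<Longrightarrow> ext \<omega> (\<eta> g) = \<omega> g"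
  using someI_ex[OF ex_character_extension[OF assms]] unfolding ext_def[symmetric] by blast+

text \<open>The Fourier coefficients of a matrix representation are pairwise orthogonal idempotents, so
  only finitely many are nonzero. By completeness of the characters they sum up the representation.\<close>

definition fourier :: "('a \<Rightarrow> nat \<Rightarrow> nat \<Rightarrow> complex) \<Rightarrow> ('g \<Rightarrow> complex) \<Rightarrow> nat \<Rightarrow> nat \<Rightarrow> complex" where
  "fourier r \<omega> i j = \<mu> (\<lambda>g. r (\<eta> g) i j * cnj (\<omega> g))"

section \<open>Fourier expansion of a matrix representation\<close>

context
  fixes n r assumes r: "A.matrix_rep n r"
begin

lemma cont_entry: "i < n \<Longrightarrow> j < n \<Longrightarrow> cont (\<lambda>g. r (\<eta> g) i j)"
  by (rule matrix_rep_eta(1)[OF r])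

lemma cont_fourier: "\<omega> \<in> characters \<Longrightarrow> i < n \<Longrightarrow> j < n \<Longrightarrow> cont (\<lambda>g. r (\<eta> g) i j * cnj (\<omega> g))"
  by (intro continuous_map_mult_complex continuous_map_cnj charactersD cont_entry)

text \<open>The matrix of \<open>h\<close> is absorbed into that of \<open>h \<otimes> g\<close>
  under the mean, and translating back by \<open>h\<close> releases the factor
  \<open>\<omega> h\<close>. So the columns of the Fourier coefficient are common
  eigenvectors.\<close>

lemma fourier_eigen:
  assumes w: "\<omega> \<in> characters" and h: "h \<in> carrier G" and ij: "i < n" "j < n"
  shows "(\<Sum>k<n. r (\<eta> h) i k * fourier r \<omega> k j) = \<omega> h * fourier r \<omega> i j"
proof -
  let ?f = "\<lambda>g. r (\<eta> g) i j * cnj (\<omega> g)"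
  have f: "cont ?f" by (rule cont_fourier[OF w ij])
  have b: "bounded ((\<lambda>g. r (\<eta> g) k j * cnj (\<omega> g)) ` carrier G)" if "k < n" for k
    using cont_fourier[OF w that ij(2)] by blast
  have "(\<Sum>k<n. r (\<eta> h) i k * fourier r \<omega> k j) = (\<Sum>k<n. \<mu> (\<lambda>g. r (\<eta> h) i k * (r (\<eta> g) k j * cnj (\<omega> g))))"
    unfolding fourier_def by (intro sum.cong refl \<mu>.scale[symmetric] b) simp
  also have "\<dots> = \<mu> (\<lambda>g. \<Sum>k<n. r (\<eta> h) i k * (r (\<eta> g) k j * cnj (\<omega> g)))"
    by (intro \<mu>.sum[symmetric] bounded_image_scale b) simp
  also have "\<dots> = \<mu> (\<lambda>g. \<omega> h * ?f (h \<otimes> g))"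
  proof (rule \<mu>.cong)
    show "bounded ((\<lambda>g. \<Sum>k<n. r (\<eta> h) i k * (r (\<eta> g) k j * cnj (\<omega> g))) ` carrier G)"
      by (intro bounded_image_sum bounded_image_scale b) simp
    fix g assume g: "g \<in> carrier G"
    have "r (\<eta> (h \<otimes> g)) i j = (\<Sum>k<n. r (\<eta> h) i k * r (\<eta> g) k j)"
      by (rule matrix_rep_eta(3)[OF r h g ij])
    moreover have "\<omega> h * cnj (\<omega> (h \<otimes> g)) = cnj (\<omega> g)"
      using character_cnj[OF w h] charactersD(4)[OF w h g] by (simp add: mult.assoc[symmetric])
    moreover have "\<omega> h * ?f (h \<otimes> g) = r (\<eta> (h \<otimes> g)) i j * (\<omega> h * cnj (\<omega> (h \<otimes> g)))"
      by (rule mult.left_commute)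
    ultimately have "\<omega> h * ?f (h \<otimes> g) = (\<Sum>k<n. r (\<eta> h) i k * r (\<eta> g) k j) * cnj (\<omega> g)"
      by (simp only:)
    then show "(\<Sum>k<n. r (\<eta> h) i k * (r (\<eta> g) k j * cnj (\<omega> g))) = \<omega> h * ?f (h \<otimes> g)"
      by (simp add: sum_distrib_right mult.assoc)
  qed
  also have "\<dots> = \<omega> h * \<mu> (\<lambda>g. ?f (h \<otimes> g))"
    by (intro \<mu>.scale cont_bounded cont_translate[OF f] h)
  also have "\<dots> = \<omega> h * fourier r \<omega> i j" using mean_translate[OF f h] by (simp add: fourier_def)
  finally show ?thesis .
qed

text \<open>\<open>fourier_eigen\<close> for \<open>\<psi>\<close>, averaged against
  \<open>cnj (\<omega> g)\<close>, reduces the matrix product to the orthogonality of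
  characters.\<close>

lemma fourier_orthogonal:
  assumes w: "\<omega> \<in> characters" and p: "\<psi> \<in> characters" and ij: "i < n" "j < n"
  shows "(\<Sum>k<n. fourier r \<omega> i k * fourier r \<psi> k j) = (if \<omega> = \<psi> then fourier r \<psi> i j else 0)"
proof -
  have b: "bounded ((\<lambda>g. r (\<eta> g) i k * cnj (\<omega> g)) ` carrier G)" if "k < n" for k
    using cont_fourier[OF w ij(1) that] by blast
  have c: "cont (\<lambda>g. \<psi> g * cnj (\<omega> g))" by (intro ctsI charactersD w p)
  have "(\<Sum>k<n. fourier r \<omega> i k * fourier r \<psi> k j) = (\<Sum>k<n. \<mu> (\<lambda>g. fourier r \<psi> k j * (r (\<eta> g) i k * cnj (\<omega> g))))"
  proof (intro sum.cong refl)
    fix k assume "k \<in> {..<n}"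
    then have "\<mu> (\<lambda>g. fourier r \<psi> k j * (r (\<eta> g) i k * cnj (\<omega> g))) = fourier r \<psi> k j * fourier r \<omega> i k"
      unfolding fourier_def[of r \<omega>] by (intro \<mu>.scale b) simp
    then show "fourier r \<omega> i k * fourier r \<psi> k j = \<mu> (\<lambda>g. fourier r \<psi> k j * (r (\<eta> g) i k * cnj (\<omega> g)))"
      by (simp only: mult.commute)
  qed
  also have "\<dots> = \<mu> (\<lambda>g. \<Sum>k<n. fourier r \<psi> k j * (r (\<eta> g) i k * cnj (\<omega> g)))"
    by (intro \<mu>.sum[symmetric] bounded_image_scale b) simp
  also have "\<dots> = \<mu> (\<lambda>g. fourier r \<psi> i j * (\<psi> g * cnj (\<omega> g)))"
  proof (rule \<mu>.cong)
    show "bounded ((\<lambda>g. \<Sum>k<n. fourier r \<psi> k j * (r (\<eta> g) i k * cnj (\<omega> g))) ` carrier G)"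
      by (intro bounded_image_sum bounded_image_scale b) simp
    fix g assume g: "g \<in> carrier G"
    have "(\<Sum>k<n. fourier r \<psi> k j * (r (\<eta> g) i k * cnj (\<omega> g))) = (\<Sum>k<n. r (\<eta> g) i k * fourier r \<psi> k j) * cnj (\<omega> g)"
      by (simp add: sum_distrib_left mult_ac)
    then show "(\<Sum>k<n. fourier r \<psi> k j * (r (\<eta> g) i k * cnj (\<omega> g))) = fourier r \<psi> i j * (\<psi> g * cnj (\<omega> g))"
      using fourier_eigen[OF p g ij] by (simp add: mult_ac)
  qed
  also have "\<dots> = fourier r \<psi> i j * \<mu> (\<lambda>g. \<psi> g * cnj (\<omega> g))" by (intro \<mu>.scale cont_bounded c)
  finally show ?thesis using mean_character_orthogonal[OF p w] by auto
qed

definition spectrum :: "('g \<Rightarrow> complex) set" where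
  "spectrum = {\<omega> \<in> characters. \<exists>i<n. \<exists>j<n. fourier r \<omega> i j \<noteq> 0}"

text \<open>Nonzero orthogonal idempotents are linearly independent, as multiplying a relation by
  one of them isolates its coefficient; there are therefore at most \<open>n * n\<close> of
  them.\<close>

lemma finite_spectrum: "finite spectrum"
proof (rule ccontr)
  assume "infinite spectrum"
  then obtain S where S: "finite S" "card S = Suc (n * n)" "S \<subseteq> spectrum"
    using infinite_arbitrarily_large by metis
  have "card ({..<n} \<times> {..<n}) < card S" using S by (simp add: card_cartesian_product)
  from homogeneous_system_nontrivial[OF _ S(1) this, of "\<lambda>\<omega> (i, j). fourier r \<omega> i j"]
  obtain v \<psi> where p: "\<psi> \<in> S" "v \<psi> \<noteq> 0"
    and v: "\<forall>b\<in>{..<n} \<times> {..<n}. (\<Sum>\<omega>\<in>S. v \<omega> * (case b of (i, j) \<Rightarrow> fourier r \<omega> i j)) = 0" by auto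
  have SC: "\<omega> \<in> characters" if "\<omega> \<in> S" for \<omega> using that S by (auto simp: spectrum_def)
  from p S obtain i j where ij: "i < n" "j < n" "fourier r \<psi> i j \<noteq> 0" by (auto simp: spectrum_def)
  have "0 = (\<Sum>k<n. (\<Sum>\<omega>\<in>S. v \<omega> * fourier r \<omega> i k) * fourier r \<psi> k j)"
  proof -
    have "(\<Sum>\<omega>\<in>S. v \<omega> * fourier r \<omega> i k) = 0" if "k < n" for k
      using bspec[OF v, of "(i, k)"] that ij by simp
    then show ?thesis by simp
  qed
  also have "\<dots> = (\<Sum>k<n. \<Sum>\<omega>\<in>S. v \<omega> * (fourier r \<omega> i k * fourier r \<psi> k j))"
    by (simp add: sum_distrib_right mult.assoc)
  also have "\<dots> = (\<Sum>\<omega>\<in>S. \<Sum>k<n. v \<omega> * (fourier r \<omega> i k * fourier r \<psi> k j))" by (rule sum.swap)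
  also have "\<dots> = (\<Sum>\<omega>\<in>S. v \<omega> * (\<Sum>k<n. fourier r \<omega> i k * fourier r \<psi> k j))"
    by (simp add: sum_distrib_left)
  also have "\<dots> = (\<Sum>\<omega>\<in>S. if \<omega> = \<psi> then v \<omega> * fourier r \<psi> i j else 0)"
    using fourier_orthogonal[OF SC SC[OF p(1)] ij(1,2)] by (intro sum.cong) auto
  also have "\<dots> = v \<psi> * fourier r \<psi> i j" using S(1) p(1) by simp
  finally show False using p ij by simp
qed

lemma spectrum_characters: "spectrum \<subseteq> characters" by (auto simp: spectrum_def)

text \<open>The difference of the two sides is continuous and has mean 0 against every character, so
  it vanishes by \<open>ex_character_mean_nonzero\<close>.\<close>

lemma fourier_expansion:
  assumes g: "g \<in> carrier G" and ij: "i < n" "j < n"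
  shows "r (\<eta> g) i j = (\<Sum>\<omega>\<in>spectrum. fourier r \<omega> i j * \<omega> g)"
proof (rule ccontr)
  let ?s = "\<lambda>g. \<Sum>\<omega>\<in>spectrum. fourier r \<omega> i j * \<omega> g"
  let ?u = "\<lambda>g. r (\<eta> g) i j - ?s g"
  assume "r (\<eta> g) i j \<noteq> ?s g"
  then have nz: "?u g \<noteq> 0" by simp
  have cs: "cont ?s"
  proof (intro continuous_map_sum finite_spectrum)
    fix \<omega> assume "\<omega> \<in> spectrum"
    then have "cont \<omega>" using spectrum_characters charactersD(1) by blast
    then show "cont (\<lambda>g. fourier r \<omega> i j * \<omega> g)" by (intro continuous_map_mult_complex) simp_all
  qed
  have cu: "cont ?u" by (intro continuous_map_diff cs cont_entry ij)
  obtain \<psi> where p: "\<psi> \<in> characters" "\<mu> (\<lambda>g. ?u g * cnj (\<psi> g)) \<noteq> 0"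
    by (rule ex_character_mean_nonzero[OF cu g nz]) (rule that)
  have cps: "cont (\<lambda>g. ?s g * cnj (\<psi> g))" 
    by (intro continuous_map_mult_complex continuous_map_cnj charactersD(1)[OF p(1)] cs)
  have "\<mu> (\<lambda>g. ?u g * cnj (\<psi> g)) = fourier r \<psi> i j - \<mu> (\<lambda>g. ?s g * cnj (\<psi> g))"
    unfolding left_diff_distrib fourier_def[of r \<psi>] by (intro \<mu>.diff cont_bounded cps cont_fourier p ij)
  also have "\<dots> = 0"
    unfolding mean_character_combination[OF finite_spectrum spectrum_characters p(1)]
    using p(1) ij by (auto simp: spectrum_def)
  finally show False using p by simp
qed

text \<open>The right side is itself a matrix representation, because the coefficients are
  orthogonal idempotents and each \<open>ext \<omega>\<close> is multiplicative. It agrees with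
  \<open>r\<close> on \<open>G\<close>, so uniqueness applies.\<close>

lemma matrix_rep_expansion:
  assumes a: "a \<in> carrier A" and ij: "i < n" "j < n"
  shows "r a i j = (\<Sum>\<omega>\<in>spectrum. fourier r \<omega> i j * ext \<omega> a)"
proof (rule matrix_rep_unique[OF r _ _ a ij])
  let ?r = "\<lambda>a i j. \<Sum>\<omega>\<in>spectrum. fourier r \<omega> i j * ext \<omega> a"
  have sp: "\<omega> \<in> characters" if "\<omega> \<in> spectrum" for \<omega> using that spectrum_characters by blast
  show "A.matrix_rep n ?r"
    unfolding A.matrix_rep_def
  proof (intro allI impI conjI ballI)
    fix i j assume ij: "i < n" "j < n"
    show "functional A (\<lambda>a. ?r a i j)" by (intro functional_sum functional_scale ext sp)
    have "?r \<one>\<^bsub>A\<^esub> i j = (\<Sum>\<omega>\<in>spectrum. fourier r \<omega> i j * \<omega> \<one>)"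
      by (intro sum.cong) (auto simp: ext sp character_one)
    also have "\<dots> = r (\<eta> \<one>) i j" using fourier_expansion[OF one_closed ij] by simp
    finally show "?r \<one>\<^bsub>A\<^esub> i j = (if i = j then 1 else 0)" using matrix_rep_eta(2)[OF r ij] by simp
    fix a b assume ab: "a \<in> carrier A" "b \<in> carrier A"
    have "(\<Sum>k<n. ?r a i k * ?r b k j) =
        (\<Sum>k<n. \<Sum>\<omega>\<in>spectrum. \<Sum>\<psi>\<in>spectrum. ext \<omega> a * ext \<psi> b * (fourier r \<omega> i k * fourier r \<psi> k j))"
      by (simp add: sum_product mult_ac)
    also have "\<dots> = (\<Sum>\<omega>\<in>spectrum. \<Sum>k<n. \<Sum>\<psi>\<in>spectrum. ext \<omega> a * ext \<psi> b * (fourier r \<omega> i k * fourier r \<psi> k j))"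
      by (rule sum.swap)
    also have "\<dots> = (\<Sum>\<omega>\<in>spectrum. \<Sum>\<psi>\<in>spectrum. \<Sum>k<n. ext \<omega> a * ext \<psi> b * (fourier r \<omega> i k * fourier r \<psi> k j))"
      by (intro sum.cong refl sum.swap)
    also have "\<dots> = (\<Sum>\<omega>\<in>spectrum. \<Sum>\<psi>\<in>spectrum. if \<psi> = \<omega> then ext \<omega> a * ext \<psi> b * fourier r \<psi> i j else 0)"
      using fourier_orthogonal[OF sp sp ij] by (intro sum.cong refl) (simp flip: sum_distrib_left)
    also have "\<dots> = (\<Sum>\<omega>\<in>spectrum. ext \<omega> a * ext \<omega> b * fourier r \<omega> i j)"
      using finite_spectrum by (intro sum.cong refl) simp
    also have "\<dots> = ?r (a \<otimes>\<^bsub>A\<^esub> b) i j"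
      using ab by (intro sum.cong refl) (simp add: ext sp)
    finally show "?r (a \<otimes>\<^bsub>A\<^esub> b) i j = (\<Sum>k<n. ?r a i k * ?r b k j)" ..
  qed
  fix g i j assume g: "g \<in> carrier G" and ij: "i < n" "j < n"
  have "?r (\<eta> g) i j = (\<Sum>\<omega>\<in>spectrum. fourier r \<omega> i j * \<omega> g)"
    using g by (intro sum.cong) (auto simp: ext sp)
  then show "r (\<eta> g) i j = ?r (\<eta> g) i j" using fourier_expansion[OF g ij] by simp
qed

end

section \<open>The extended characters as a basis of the dual\<close>

theorem functional_character_expansion:
  assumes \<phi>: "functional A \<phi>"
  shows "\<exists>S c. finite S \<and> S \<subseteq> characters \<and> (\<forall>a\<in>carrier A. \<phi> a = (\<Sum>\<omega>\<in>S. c \<omega> * ext \<omega> a))"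
proof -
  from A.ex_matrix_rep[OF \<phi>] obtain n r \<alpha> \<beta> where r: "A.matrix_rep n r"
    and eq: "\<forall>a\<in>carrier A. \<phi> a = (\<Sum>i<n. \<Sum>j<n. \<alpha> i * r a i j * \<beta> j)" by (elim exE conjE)
  let ?S = "spectrum n r"
  have "\<phi> a = (\<Sum>\<omega>\<in>?S. (\<Sum>i<n. \<Sum>j<n. \<alpha> i * fourier r \<omega> i j * \<beta> j) * ext \<omega> a)" if a: "a \<in> carrier A" for a
  proof -
    have "\<phi> a = (\<Sum>i<n. \<Sum>j<n. \<alpha> i * r a i j * \<beta> j)" using eq a by blast
    also have "\<dots> = (\<Sum>i<n. \<Sum>j<n. \<Sum>\<omega>\<in>?S. \<alpha> i * fourier r \<omega> i j * \<beta> j * ext \<omega> a)"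
      using matrix_rep_expansion[OF r a]
      by (intro sum.cong refl) (simp add: sum_distrib_left sum_distrib_right mult_ac)
    also have "\<dots> = (\<Sum>i<n. \<Sum>\<omega>\<in>?S. \<Sum>j<n. \<alpha> i * fourier r \<omega> i j * \<beta> j * ext \<omega> a)"
      by (intro sum.cong refl sum.swap)
    also have "\<dots> = (\<Sum>\<omega>\<in>?S. \<Sum>i<n. \<Sum>j<n. \<alpha> i * fourier r \<omega> i j * \<beta> j * ext \<omega> a)"
      by (rule sum.swap)
    finally show ?thesis by (simp add: sum_distrib_right)
  qed
  then show ?thesis using finite_spectrum[OF r] spectrum_characters[OF r]
    by (intro exI[of _ ?S] exI[of _ "\<lambda>\<omega>. \<Sum>i<n. \<Sum>j<n. \<alpha> i * fourier r \<omega> i j * \<beta> j"]) simp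
qed

text \<open>This is the density of the span of \<open>G\<close> in dual form: restricted to
  \<open>G\<close>, the expansion is a vanishing combination of independent characters, so all its
  coefficients are 0.\<close>

lemma functional_eq_0:
  assumes \<phi>: "functional A \<phi>" and 0: "\<And>g. g \<in> carrier G \<Longrightarrow> \<phi> (\<eta> g) = 0" and a: "a \<in> carrier A"
  shows "\<phi> a = 0"
proof -
  from functional_character_expansion[OF \<phi>] obtain S c where S: "finite S" "S \<subseteq> characters"
    and eq: "\<forall>a\<in>carrier A. \<phi> a = (\<Sum>\<omega>\<in>S. c \<omega> * ext \<omega> a)" by (elim exE conjE)
  have "(\<Sum>\<omega>\<in>S. c \<omega> * \<omega> g) = 0" if g: "g \<in> carrier G" for g
  proof -
    have "(\<Sum>\<omega>\<in>S. c \<omega> * \<omega> g) = (\<Sum>\<omega>\<in>S. c \<omega> * ext \<omega> (\<eta> g))"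
      using S g by (intro sum.cong refl) (auto simp: ext)
    then show ?thesis using eq 0[OF g] g by simp
  qed
  then have "c \<omega> = 0" if "\<omega> \<in> S" for \<omega> using characters_independent[OF S _ that, of c] by blast
  then show ?thesis using eq a by simp
qed

lemma functional_eqI:
  assumes \<phi>: "functional A \<phi>" and \<psi>: "functional A \<psi>"
    and eq: "\<And>g. g \<in> carrier G \<Longrightarrow> \<phi> (\<eta> g) = \<psi> (\<eta> g)" and a: "a \<in> carrier A"
  shows "\<phi> a = \<psi> a"
proof -
  have "functional A (\<lambda>x. \<phi> x + (-1) * \<psi> x)" by (intro functional_add functional_scale \<phi> \<psi>)
  from functional_eq_0[OF this _ a] eq show ?thesis by simp
qed

text \<open>The coordinates of \<open>A\<close> are functionals, hence combinations of extended
  characters.\<close>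

lemma ext_separates_points:
  assumes a: "a \<in> carrier A" and b: "b \<in> carrier A" and eq: "\<And>\<omega>. \<omega> \<in> characters \<Longrightarrow> ext \<omega> a = ext \<omega> b"
  shows "a = b"
proof (rule A.co_inj[OF a b])
  fix j assume j: "j \<in> A.J"
  from functional_character_expansion[OF A.co_functional[OF j]] obtain S c where "S \<subseteq> characters"
    and e: "\<forall>a\<in>carrier A. A.co a j = (\<Sum>\<omega>\<in>S. c \<omega> * ext \<omega> a)" by (elim exE conjE)
  then have "(\<Sum>\<omega>\<in>S. c \<omega> * ext \<omega> a) = (\<Sum>\<omega>\<in>S. c \<omega> * ext \<omega> b)"
    using eq by (intro sum.cong refl) auto
  then show "A.co a j = A.co b j" using e a b by simp
qed

text \<open>The characters form a basis of the dual, and a weakly complete space is the full algebraic dual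
  of its topological dual, so the values of the extended characters can be prescribed arbitrarily.\<close>

theorem ex_prescribed_values: "\<exists>a\<in>carrier A. \<forall>\<omega>\<in>characters. ext \<omega> a = h \<omega>"
proof -
  obtain e where e: "\<And>j. j \<in> A.J \<Longrightarrow> e j \<in> carrier A"
    "\<And>i j. i \<in> A.J \<Longrightarrow> j \<in> A.J \<Longrightarrow> A.co (e j) i = (if i = j then 1 else 0)"
    by (rule A.ex_unit_vectors) (rule that; blast)
  have "\<forall>j\<in>A.J. \<exists>S c. finite S \<and> S \<subseteq> characters \<and> (\<forall>a\<in>carrier A. A.co a j = (\<Sum>\<omega>\<in>S. c \<omega> * ext \<omega> a))"
    using functional_character_expansion[OF A.co_functional] by blast
  then obtain S c where Sc: "\<forall>j\<in>A.J. finite (S j) \<and> S j \<subseteq> characters \<and> (\<forall>a\<in>carrier A. A.co a j = (\<Sum>\<omega>\<in>S j. c j \<omega> * ext \<omega> a))"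
    unfolding bchoice_iff by (elim exE)
  have "(\<lambda>j\<in>A.J. \<Sum>\<omega>\<in>S j. c j \<omega> * h \<omega>) \<in> extensional A.J" by simp
  from A.co_surj[OF this] obtain a where a: "a \<in> carrier A" "A.co a = (\<lambda>j\<in>A.J. \<Sum>\<omega>\<in>S j. c j \<omega> * h \<omega>)" ..
  have "ext \<psi> a = h \<psi>" if p: "\<psi> \<in> characters" for \<psi>
  proof -
    have "\<exists>F. finite F \<and> F \<subseteq> A.J \<and> (\<forall>x\<in>carrier A. ext \<psi> x = (\<Sum>j\<in>F. A.co x j * ext \<psi> (e j)))"
      by (rule A.functional_expansion[OF ext(1)[OF p]]) (simp_all add: e)
    then obtain F where F: "finite F" "F \<subseteq> A.J" and exp: "\<forall>x\<in>carrier A. ext \<psi> x = (\<Sum>j\<in>F. A.co x j * ext \<psi> (e j))"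
      by (elim exE conjE)
    define U where "U = insert \<psi> (\<Union>j\<in>F. S j)"
    have SF: "finite (S j)" "S j \<subseteq> characters" "S j \<subseteq> U" if "j \<in> F" for j
      using Sc F that by (auto simp: U_def)
    have U: "finite U" "U \<subseteq> characters" using F SF p by (auto simp: U_def)
    \<comment> \<open>The coefficient of \<open>\<omega>\<close> when the expansions of the
      coordinates are substituted into the coordinate expansion of
      \<open>ext \<psi>\<close>.\<close>
    define d where "d = (\<lambda>\<omega>. \<Sum>j\<in>F. (if \<omega> \<in> S j then c j \<omega> else 0) * ext \<psi> (e j))"
    have key: "(\<Sum>j\<in>F. (\<Sum>\<omega>\<in>S j. c j \<omega> * f \<omega>) * ext \<psi> (e j)) = (\<Sum>\<omega>\<in>U. d \<omega> * f \<omega>)" for f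
    proof -
      have "(\<Sum>\<omega>\<in>S j. c j \<omega> * f \<omega>) = (\<Sum>\<omega>\<in>U. (if \<omega> \<in> S j then c j \<omega> else 0) * f \<omega>)" if "j \<in> F" for j
        using SF[OF that] U by (intro sum.mono_neutral_cong_left) auto
      then have "(\<Sum>j\<in>F. (\<Sum>\<omega>\<in>S j. c j \<omega> * f \<omega>) * ext \<psi> (e j)) =
          (\<Sum>j\<in>F. \<Sum>\<omega>\<in>U. (if \<omega> \<in> S j then c j \<omega> else 0) * ext \<psi> (e j) * f \<omega>)"
        by (intro sum.cong refl) (simp add: sum_distrib_left mult_ac)
      also have "\<dots> = (\<Sum>\<omega>\<in>U. \<Sum>j\<in>F. (if \<omega> \<in> S j then c j \<omega> else 0) * ext \<psi> (e j) * f \<omega>)"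
        by (rule sum.swap)
      finally show ?thesis by (simp add: d_def sum_distrib_right)
    qed
    have expG: "\<psi> g = (\<Sum>\<omega>\<in>U. d \<omega> * \<omega> g)" if g: "g \<in> carrier G" for g
    proof -
      have "\<psi> g = (\<Sum>j\<in>F. A.co (\<eta> g) j * ext \<psi> (e j))" using exp g ext(4)[OF p g] by simp
      also have "\<dots> = (\<Sum>j\<in>F. (\<Sum>\<omega>\<in>S j. c j \<omega> * \<omega> g) * ext \<psi> (e j))"
      proof (intro sum.cong refl arg_cong2[of _ _ _ _ "(*)"])
        fix j assume j: "j \<in> F"
        then have "A.co (\<eta> g) j = (\<Sum>\<omega>\<in>S j. c j \<omega> * ext \<omega> (\<eta> g))" using Sc F g by auto
        also have "\<dots> = (\<Sum>\<omega>\<in>S j. c j \<omega> * \<omega> g)"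
          using SF[OF j] g by (intro sum.cong refl) (auto simp: ext)
        finally show "A.co (\<eta> g) j = (\<Sum>\<omega>\<in>S j. c j \<omega> * \<omega> g)" .
      qed
      finally show ?thesis by (simp add: key)
    qed
    \<comment> \<open>On \<open>G\<close> the substituted combination is \<open>\<psi>\<close>
      itself, so independence leaves only its coefficient 1. Applied to the prescribed values, the
      same combination therefore returns \<open>h \<psi>\<close>.\<close>
    have "d \<omega> = (if \<omega> = \<psi> then 1 else 0)" if w: "\<omega> \<in> U" for \<omega>
    proof -
      have "(\<Sum>\<omega>\<in>U. (d \<omega> - (if \<omega> = \<psi> then 1 else 0)) * \<omega> g) = 0" if g: "g \<in> carrier G" for g
      proof -
        have "(\<Sum>\<omega>\<in>U. (if \<omega> = \<psi> then 1 else 0) * \<omega> g) = (\<Sum>\<omega>\<in>U. if \<omega> = \<psi> then \<omega> g else 0)"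
          by (intro sum.cong) auto
        also have "\<dots> = \<psi> g" using U by (simp add: U_def)
        finally show ?thesis using expG[OF g] by (simp add: left_diff_distrib sum_subtractf)
      qed
      then show ?thesis using characters_independent[OF U _ w, of "\<lambda>\<omega>. d \<omega> - (if \<omega> = \<psi> then 1 else 0)"] by simp
    qed
    then have "(\<Sum>\<omega>\<in>U. d \<omega> * h \<omega>) = (\<Sum>\<omega>\<in>U. if \<omega> = \<psi> then h \<omega> else 0)"
      by (intro sum.cong) auto
    also have "\<dots> = h \<psi>" using U by (simp add: U_def)
    finally have "h \<psi> = (\<Sum>j\<in>F. (\<Sum>\<omega>\<in>S j. c j \<omega> * h \<omega>) * ext \<psi> (e j))" using key[of h] by simp
    also have "\<dots> = (\<Sum>j\<in>F. A.co a j * ext \<psi> (e j))"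
      using a F by (intro sum.cong refl) auto
    also have "\<dots> = ext \<psi> a" using exp a by simp
    finally show ?thesis ..
  qed
  with a show ?thesis by blast
qed

end

section \<open>Grouplike elements\<close>

context wc_algebra
begin

lemma functional_dual_space: "\<phi> \<in> carrier (dual_space A) \<Longrightarrow> functional A \<phi>"
  by (simp add: dual_space_def functional_def linear_map_complex_algebra)

lemma restrict_dual_space:
  assumes \<phi>: "functional A \<phi>" shows "restrict \<phi> (carrier A) \<in> carrier (dual_space A)"
proof -
  have "continuous_map (topo A) euclidean \<phi>" using \<phi> by (simp add: functional_def)
  then have "continuous_map (topo A) euclidean (restrict \<phi> (carrier A))"
    by (rule continuous_map_eq) simp
  moreover have "linear_functional A (restrict \<phi> (carrier A))"
    using \<phi> by (simp add: functional_def linear_functional_def)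
  ultimately show ?thesis by (simp add: dual_space_def linear_map_complex_algebra)
qed

end

section \<open>Comultiplication and coidentity as families of functionals\<close>

locale compact_group_bialgebra = compact_group_algebra G T A \<eta>
  for G :: "('g, 'm) monoid_scheme" (structure) and T :: "'g topology"
    and A :: "'a topological_module" and \<eta> :: "'g \<Rightarrow> 'a" +
  fixes c :: "'a \<Rightarrow> ('a, 'a) tensor" and k :: "'a \<Rightarrow> complex"
  assumes comultiplication: "comultiplication G A \<eta> c" and coidentity: "coidentity G A \<eta> k"
begin

abbreviation "D \<equiv> carrier (dual_space A) \<times> carrier (dual_space A)"

lemma coidentity_functional: "functional A k" and coidentity_eta: "g \<in> carrier G \<Longrightarrow> k (\<eta> g) = 1"
  using coidentity
  by (auto simp: coidentity_def algebra_morphism_def functional_def linear_map_complex_algebra)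
    (simp add: complex_algebra_def)

lemma comultiplication_eta: "g \<in> carrier G \<Longrightarrow> c (\<eta> g) = elementary_tensor A A (\<eta> g) (\<eta> g)"
  using comultiplication by (simp add: comultiplication_def)

lemma comultiplication_extensional: assumes a: "a \<in> carrier A" shows "c a \<in> extensional D"
proof -
  have "linear_map A (tensor_algebra A A) c"
    using comultiplication by (simp add: comultiplication_def algebra_morphism_def)
  then have "c a \<in> carrier (tensor_algebra A A)" using a by (auto simp: linear_map_def)
  then show ?thesis by (simp add: tensor_algebra_def tensor_space_def Let_def)
qed

text \<open>Evaluation at \<open>d\<close> is a coordinate of the tensor space. It turns
  \<open>c\<close> into functionals on \<open>A\<close>, which are determined by their values on
  \<open>G\<close>.\<close>

lemma comultiplication_functional:
  assumes d: "d \<in> D" shows "functional A (\<lambda>a. c a d)"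
proof -
  have l: "linear_map A (tensor_algebra A A) c" and cont: "continuous_map (topo A) (topo (tensor_algebra A A)) c"
    using comultiplication by (auto simp: comultiplication_def algebra_morphism_def)
  have "c (x \<oplus>\<^bsub>A\<^esub> y) d = c x d + c y d" if "x \<in> carrier A" "y \<in> carrier A" for x y
  proof -
    have "c (x \<oplus>\<^bsub>A\<^esub> y) = (\<lambda>d\<in>D. c x d + c y d)"
      using l that by (simp add: linear_map_def tensor_algebra_def tensor_space_def Let_def)
    then show ?thesis using d by simp
  qed
  moreover have "c (s \<odot>\<^bsub>A\<^esub> x) d = s * c x d" if "x \<in> carrier A" for s x
  proof -
    have "c (s \<odot>\<^bsub>A\<^esub> x) = (\<lambda>d\<in>D. s * c x d)"
      using l that by (simp add: linear_map_def tensor_algebra_def tensor_space_def Let_def)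
    then show ?thesis using d by simp
  qed
  moreover have "continuous_map (topo A) (product_topology (\<lambda>d. euclidean) D) c"
    using cont by (simp add: tensor_algebra_def tensor_space_def Let_def continuous_map_in_subtopology)
  then have "continuous_map (topo A) euclidean (\<lambda>a. c a d)"
    using d by (simp only: continuous_map_componentwise)
  ultimately show ?thesis by (simp add: functional_def linear_functional_def)
qed

lemma grouplike_iff:
  "a \<in> grouplikes A c k \<longleftrightarrow> a \<in> carrier A \<and> k a = 1 \<and>
     (\<forall>\<phi>\<in>carrier (dual_space A). \<forall>\<psi>\<in>carrier (dual_space A). c a (\<phi>, \<psi>) = \<phi> a * \<psi> a)"
proof -
  have "c a = elementary_tensor A A a a \<longleftrightarrow>
      (\<forall>\<phi>\<in>carrier (dual_space A). \<forall>\<psi>\<in>carrier (dual_space A). c a (\<phi>, \<psi>) = \<phi> a * \<psi> a)"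
    if a: "a \<in> carrier A"
  proof
    assume "\<forall>\<phi>\<in>carrier (dual_space A). \<forall>\<psi>\<in>carrier (dual_space A). c a (\<phi>, \<psi>) = \<phi> a * \<psi> a"
    then show "c a = elementary_tensor A A a a"
      by (intro extensionalityI[OF comultiplication_extensional[OF a]])
        (auto simp: elementary_tensor_def)
  qed (simp add: elementary_tensor_def)
  then show ?thesis by (auto simp: grouplikes_def)
qed

lemma eta_grouplike: "\<eta> ` carrier G \<subseteq> grouplikes A c k"
  using comultiplication_eta coidentity_eta by (auto simp: grouplikes_def)

lemma comultiplication_eta_apply:
  assumes "g \<in> carrier G" "(\<phi>, \<psi>) \<in> D" shows "c (\<eta> g) (\<phi>, \<psi>) = \<phi> (\<eta> g) * \<psi> (\<eta> g)"
  using comultiplication_eta[OF assms(1)] assms(2) by (simp add: elementary_tensor_def)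

text \<open>The witness is \<open>c\<close> evaluated at the pair of restricted functionals. So the
  dual is closed under pointwise products on \<open>G\<close>, and a grouplike element is
  multiplicative for this product.\<close>

lemma ex_functional_product:
  assumes a: "a \<in> grouplikes A c k" and \<phi>: "functional A \<phi>" and \<psi>: "functional A \<psi>"
  shows "\<exists>\<rho>. functional A \<rho> \<and> (\<forall>g\<in>carrier G. \<rho> (\<eta> g) = \<phi> (\<eta> g) * \<psi> (\<eta> g)) \<and> \<rho> a = \<phi> a * \<psi> a"
proof -
  let ?d = "(restrict \<phi> (carrier A), restrict \<psi> (carrier A))"
  have d: "?d \<in> D" using A.restrict_dual_space \<phi> \<psi> by simp
  have "c (\<eta> g) ?d = \<phi> (\<eta> g) * \<psi> (\<eta> g)" if "g \<in> carrier G" for g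
    using comultiplication_eta_apply[OF that d] that by simp
  moreover have "c a ?d = \<phi> a * \<psi> a" using a d by (simp add: grouplike_iff)
  ultimately show ?thesis using comultiplication_functional[OF d] by (intro exI[of _ "\<lambda>a. c a ?d"]) simp
qed

lemma ex_functional_power:
  assumes a: "a \<in> grouplikes A c k" and w: "\<omega> \<in> characters"
  shows "\<exists>\<rho>. functional A \<rho> \<and> (\<forall>g\<in>carrier G. \<rho> (\<eta> g) = \<omega> g ^ n) \<and> \<rho> a = ext \<omega> a ^ n"
proof (induction n)
  case 0
  show ?case using coidentity_functional coidentity_eta a by (intro exI[of _ k]) (simp add: grouplike_iff)
next
  case (Suc n)
  then obtain \<rho> where \<rho>: "functional A \<rho>" "\<forall>g\<in>carrier G. \<rho> (\<eta> g) = \<omega> g ^ n" "\<rho> a = ext \<omega> a ^ n"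
    by (elim exE conjE)
  from ex_functional_product[OF a ext(1)[OF w] \<rho>(1)] show ?case
    using \<rho> ext(4)[OF w] by simp
qed

section \<open>Totally disconnected groups: grouplike elements are group elements\<close>

lemma geometric_sum_root_of_unity:
  fixes z :: complex assumes "z ^ N = 1" shows "(\<Sum>k<N. z ^ k) = (if z = 1 then of_nat N else 0)"
  using geometric_sum[of z N] assms by auto

text \<open>The \<open>N\<close>-th power of \<open>\<omega>\<close> agrees with \<open>k\<close> on
  \<open>G\<close>, so \<open>z = ext \<omega> a\<close> is a root of unity. The geometric sum of
  the powers of \<open>\<omega> / z\<close> vanishes at points of \<open>G\<close> with another
  value, and it equals \<open>N\<close> at \<open>a\<close>.\<close>

lemma ex_indicator_functional:
  assumes a: "a \<in> grouplikes A c k" and w: "\<omega> \<in> characters"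
    and N: "N > 0" "\<And>g. g \<in> carrier G \<Longrightarrow> \<omega> g ^ N = 1"
  shows "\<exists>\<rho>. functional A \<rho> \<and> (\<forall>g\<in>carrier G. \<omega> g \<noteq> ext \<omega> a \<longrightarrow> \<rho> (\<eta> g) = 0) \<and> \<rho> a \<noteq> 0"
proof -
  define z where "z = ext \<omega> a"
  have aA: "a \<in> carrier A" and ka: "k a = 1" using a by (auto simp: grouplike_iff)
  from ex_functional_power[OF a w, of N] obtain \<rho> where \<rho>: "functional A \<rho>"
    "\<forall>g\<in>carrier G. \<rho> (\<eta> g) = \<omega> g ^ N" "\<rho> a = ext \<omega> a ^ N" by (elim exE conjE)
  have "\<rho> a = k a"
    by (rule functional_eqI[OF \<rho>(1) coidentity_functional _ aA]) (simp add: \<rho>(2) N(2) coidentity_eta)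
  then have zN: "z ^ N = 1" using \<rho> ka by (simp add: z_def)
  then have z0: "z \<noteq> 0" using N by (metis power_0_left less_numeral_extra(3) zero_neq_one)
  have "\<forall>n. \<exists>\<rho>. functional A \<rho> \<and> (\<forall>g\<in>carrier G. \<rho> (\<eta> g) = \<omega> g ^ n) \<and> \<rho> a = z ^ n"
    unfolding z_def by (intro allI ex_functional_power a w)
  then obtain p where "\<forall>n. functional A (p n) \<and> (\<forall>g\<in>carrier G. p n (\<eta> g) = \<omega> g ^ n) \<and> p n a = z ^ n"
    unfolding choice_iff by (elim exE)
  then have p: "\<And>n. functional A (p n)" "\<And>n g. g \<in> carrier G \<Longrightarrow> p n (\<eta> g) = \<omega> g ^ n" "\<And>n. p n a = z ^ n"
    by simp_all
  let ?\<rho> = "\<lambda>x. \<Sum>n<N. (1 / z ^ n) * p n x"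
  have "functional A ?\<rho>" by (intro functional_sum functional_scale p)
  moreover have "?\<rho> (\<eta> g) = 0" if g: "g \<in> carrier G" "\<omega> g \<noteq> z" for g
  proof -
    have "?\<rho> (\<eta> g) = (\<Sum>n<N. (\<omega> g / z) ^ n)" using g p by (simp add: power_divide)
    also have "\<dots> = 0"
      using geometric_sum_root_of_unity[of "\<omega> g / z" N] N(2)[OF g(1)] zN g z0 by (simp add: power_divide)
    finally show ?thesis .
  qed
  moreover have "?\<rho> a = of_nat N" using p z0 by simp
  ultimately show ?thesis using N by (intro exI[of _ ?\<rho>]) (simp add: z_def)
qed

lemma ex_interpolating_point:
  assumes td: "totally_disconnected T" and a: "a \<in> grouplikes A c k" and \<Phi>: "finite \<Phi>" "\<Phi> \<subseteq> characters"
  shows "\<exists>g\<in>carrier G. \<forall>\<omega>\<in>\<Phi>. \<omega> g = ext \<omega> a"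
proof -
  have aA: "a \<in> carrier A" and ka: "k a = 1" using a by (auto simp: grouplike_iff)
  have "\<exists>\<rho>. functional A \<rho> \<and> (\<forall>g\<in>carrier G. (\<exists>\<omega>\<in>\<Phi>. \<omega> g \<noteq> ext \<omega> a) \<longrightarrow> \<rho> (\<eta> g) = 0) \<and> \<rho> a \<noteq> 0"
    using \<Phi>
  proof (induction \<Phi> rule: finite_induct)
    case empty
    show ?case using coidentity_functional ka by (intro exI[of _ k]) simp
  next
    case (insert \<omega> \<Phi>)
    then have w: "\<omega> \<in> characters" by simp
    from insert.prems have "\<Phi> \<subseteq> characters" by simp
    from insert.IH[OF this] obtain \<rho> where \<rho>: "functional A \<rho>"
      "\<forall>g\<in>carrier G. (\<exists>\<omega>\<in>\<Phi>. \<omega> g \<noteq> ext \<omega> a) \<longrightarrow> \<rho> (\<eta> g) = 0" "\<rho> a \<noteq> 0" by (elim exE conjE)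
    obtain N :: nat where N: "N > 0" "\<And>x. x \<in> carrier G \<Longrightarrow> \<omega> x ^ N = 1"
      using character_finite_order[OF td w] by metis
    have "\<exists>\<rho>. functional A \<rho> \<and> (\<forall>g\<in>carrier G. \<omega> g \<noteq> ext \<omega> a \<longrightarrow> \<rho> (\<eta> g) = 0) \<and> \<rho> a \<noteq> 0"
      by (rule ex_indicator_functional[OF a w N(1)]) (rule N(2))
    then obtain \<sigma> where \<sigma>: "functional A \<sigma>"
      "\<forall>g\<in>carrier G. \<omega> g \<noteq> ext \<omega> a \<longrightarrow> \<sigma> (\<eta> g) = 0" "\<sigma> a \<noteq> 0" by (elim exE conjE)
    from ex_functional_product[OF a \<sigma>(1) \<rho>(1)] obtain \<tau> where \<tau>: "functional A \<tau>"
      "\<forall>g\<in>carrier G. \<tau> (\<eta> g) = \<sigma> (\<eta> g) * \<rho> (\<eta> g)" "\<tau> a = \<sigma> a * \<rho> a" by (elim exE conjE)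
    show ?case using \<tau> \<sigma>(2,3) \<rho>(2,3) by (intro exI[of _ \<tau>]) auto
  qed
  then obtain \<rho> where \<rho>: "functional A \<rho>"
    "\<forall>g\<in>carrier G. (\<exists>\<omega>\<in>\<Phi>. \<omega> g \<noteq> ext \<omega> a) \<longrightarrow> \<rho> (\<eta> g) = 0" "\<rho> a \<noteq> 0" by (elim exE conjE)
  show ?thesis
  proof (rule ccontr)
    assume "\<not> ?thesis"
    then have "\<rho> (\<eta> g) = 0" if "g \<in> carrier G" for g using \<rho>(2) that by blast
    \<comment> \<open>A functional that vanishes on \<open>G\<close> vanishes on
      \<open>A\<close>.\<close>
    then have "\<rho> a = 0" by (rule functional_eq_0[OF \<rho>(1) _ aA])
    then show False using \<rho>(3) by simp
  qed
qed

lemma grouplike_in_eta: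
  assumes td: "totally_disconnected T" and a: "a \<in> grouplikes A c k"
  shows "a \<in> \<eta> ` carrier G"
proof -
  have aA: "a \<in> carrier A" using a by (simp add: grouplike_iff)
  define K where "K = (\<lambda>\<omega>. {g \<in> topspace T. \<omega> g \<in> {ext \<omega> a}})"
  have closedK: "closedin T (K \<omega>)" if "\<omega> \<in> characters" for \<omega>
    unfolding K_def by (rule closedin_continuous_map_preimage[OF charactersD(1)[OF that]]) simp
  have fip: "\<Inter>\<F> \<noteq> {}" if \<F>: "finite \<F>" "\<F> \<subseteq> K ` characters" for \<F>
  proof -
    obtain \<Phi> where "\<Phi> \<subseteq> characters" "finite \<Phi>" "\<F> = K ` \<Phi>" using \<F> by (meson finite_subset_image)
    then obtain g where "g \<in> carrier G" "\<forall>\<omega>\<in>\<Phi>. \<omega> g = ext \<omega> a"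
      using ex_interpolating_point[OF td a] by blast
    then have "g \<in> \<Inter>\<F>" using \<open>\<F> = K ` \<Phi>\<close> by (auto simp: K_def)
    then show ?thesis by blast
  qed
  have "\<Inter>(K ` characters) \<noteq> {}"
    using compact[unfolded compact_space_fip, rule_format, of "K ` characters"] closedK fip by auto
  then obtain g where g: "\<And>\<omega>. \<omega> \<in> characters \<Longrightarrow> g \<in> K \<omega>" by blast
  \<comment> \<open>The trivial character makes the family nonempty, which places \<open>g\<close>
    in the group.\<close>
  then have gG: "g \<in> carrier G" using one_character by (auto simp: K_def)
  have "a = \<eta> g"
  proof (rule ext_separates_points[OF aA eta_closed[OF gG]])
    fix \<omega> assume "\<omega> \<in> characters"
    then show "ext \<omega> a = ext \<omega> (\<eta> g)" using g[of \<omega>] gG by (simp add: K_def ext)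
  qed
  then show ?thesis using gG by simp
qed

text \<open>Expand both functionals in characters. On \<open>G\<close> the value of \<open>c\<close>
  is the corresponding combination of product characters, so this holds on \<open>A\<close>;
  multiplicativity of \<open>a\<close> then splits the double sum.\<close>

lemma grouplikeI:
  assumes a: "a \<in> carrier A" and one: "ext (\<lambda>x\<in>carrier G. 1) a = 1"
    and mult: "\<And>\<omega> \<psi>. \<omega> \<in> characters \<Longrightarrow> \<psi> \<in> characters \<Longrightarrow>
      ext (\<lambda>x\<in>carrier G. \<omega> x * \<psi> x) a = ext \<omega> a * ext \<psi> a"
  shows "a \<in> grouplikes A c k"
proof -
  have "k a = ext (\<lambda>x\<in>carrier G. 1) a"
    by (rule functional_eqI[OF coidentity_functional ext(1)[OF one_character] _ a])
      (simp add: coidentity_eta ext(4)[OF one_character])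
  moreover have "c a (\<phi>, \<psi>) = \<phi> a * \<psi> a" if d: "(\<phi>, \<psi>) \<in> D" for \<phi> \<psi>
  proof -
    have f: "functional A \<phi>" "functional A \<psi>" using d A.functional_dual_space by auto
    obtain S s where S: "finite S" "S \<subseteq> characters" "\<forall>a\<in>carrier A. \<phi> a = (\<Sum>\<omega>\<in>S. s \<omega> * ext \<omega> a)"
      using functional_character_expansion[OF f(1)] by (elim exE conjE)
    obtain R r where R: "finite R" "R \<subseteq> characters" "\<forall>a\<in>carrier A. \<psi> a = (\<Sum>\<omega>\<in>R. r \<omega> * ext \<omega> a)"
      using functional_character_expansion[OF f(2)] by (elim exE conjE)
    let ?p = "\<lambda>\<omega> \<theta>. \<lambda>x\<in>carrier G. \<omega> x * \<theta> x"
    let ?\<Phi> = "\<lambda>x. \<Sum>\<omega>\<in>S. \<Sum>\<theta>\<in>R. (s \<omega> * r \<theta>) * ext (?p \<omega> \<theta>) x"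
    have chars: "\<omega> \<in> characters" "\<theta> \<in> characters" "?p \<omega> \<theta> \<in> characters" if "\<omega> \<in> S" "\<theta> \<in> R" for \<omega> \<theta>
    proof -
      show w: "\<omega> \<in> characters" using that S by auto
      show t: "\<theta> \<in> characters" using that R by auto
      show "?p \<omega> \<theta> \<in> characters" by (rule mult_character[OF w t])
    qed
    have "functional A ?\<Phi>" using chars by (intro functional_sum functional_scale ext) auto
    then have "c a (\<phi>, \<psi>) = ?\<Phi> a"
    proof (rule functional_eqI[OF comultiplication_functional[OF d] _ _ a])
      fix g assume g: "g \<in> carrier G"
      have "c (\<eta> g) (\<phi>, \<psi>) = (\<Sum>\<omega>\<in>S. s \<omega> * ext \<omega> (\<eta> g)) * (\<Sum>\<theta>\<in>R. r \<theta> * ext \<theta> (\<eta> g))"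
        using comultiplication_eta_apply[OF g d] S R g by simp
      also have "\<dots> = ?\<Phi> (\<eta> g)"
        unfolding sum_product using chars g by (intro sum.cong refl) (simp add: ext mult_ac)
      finally show "c (\<eta> g) (\<phi>, \<psi>) = ?\<Phi> (\<eta> g)" .
    qed
    also have "\<dots> = (\<Sum>\<omega>\<in>S. s \<omega> * ext \<omega> a) * (\<Sum>\<theta>\<in>R. r \<theta> * ext \<theta> a)"
      unfolding sum_product using chars by (intro sum.cong refl) (simp add: mult mult_ac)
    also have "\<dots> = \<phi> a * \<psi> a" using S R a by simp
    finally show ?thesis .
  qed
  ultimately show ?thesis using a one by (simp add: grouplike_iff)
qed

section \<open>Groups that are not totally disconnected: a new grouplike element\<close>

lemma ex_grouplike_outside_eta:
  assumes "\<not> totally_disconnected T"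
  shows "\<exists>a\<in>grouplikes A c k. a \<notin> \<eta> ` carrier G"
proof (rule ex_nonunitary_char_group_hom[OF assms])
  fix h :: "('g \<Rightarrow> complex) \<Rightarrow> real" and \<omega>\<^sub>0 assume w: "\<omega>\<^sub>0 \<in> characters" "h \<omega>\<^sub>0 = 1"
    and h: "\<And>\<omega> \<psi>. \<omega> \<in> characters \<Longrightarrow> \<psi> \<in> characters \<Longrightarrow> h (\<lambda>x\<in>carrier G. \<omega> x * \<psi> x) = h \<omega> + h \<psi>"
  obtain a where a: "a \<in> carrier A" and val: "\<forall>\<omega>\<in>characters. ext \<omega> a = complex_of_real (exp (h \<omega>))"
    using ex_prescribed_values[of "\<lambda>\<omega>. complex_of_real (exp (h \<omega>))"] by blast
  have "a \<in> grouplikes A c k"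
  proof (rule grouplikeI[OF a])
    let ?e = "\<lambda>x\<in>carrier G. 1 :: complex"
    have "(\<lambda>x\<in>carrier G. ?e x * ?e x) = ?e" by auto
    then have "h ?e = 0" using h[OF one_character one_character] by simp
    then show "ext ?e a = 1" using val one_character by simp
    fix \<omega> \<psi> assume "\<omega> \<in> characters" "\<psi> \<in> characters"
    then show "ext (\<lambda>x\<in>carrier G. \<omega> x * \<psi> x) a = ext \<omega> a * ext \<psi> a"
      using val mult_character h by (simp add: exp_add)
  qed
  moreover have "a \<notin> \<eta> ` carrier G"
  proof
    assume "a \<in> \<eta> ` carrier G"
    then obtain g where g: "g \<in> carrier G" "a = \<eta> g" by blast
    \<comment> \<open>\<open>ext \<omega>\<^sub>0\<close> has the value \<open>exp 1\<close> at
      \<open>a\<close>, while it is unimodular on the image of \<open>G\<close>.\<close>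
    then have "norm (complex_of_real (exp 1)) = 1"
      using val w ext(4)[OF w(1) g(1)] charactersD(3)[OF w(1) g(1)] by auto
    then show False by simp
  qed
  ultimately show ?thesis by blast
qed

end

theorem mainTheorem3:
  fixes G :: "('g, 'm) monoid_scheme" and T :: "'g topology"
    and A :: "'a topological_module" and \<eta> :: "'g \<Rightarrow> 'a"
    and c :: "'a \<Rightarrow> ('a, 'a) tensor" and k :: "'a \<Rightarrow> complex"
  assumes "compact_group G T" and "comm_group G"
    and "group_algebra G T A \<eta>"
    and "comultiplication G A \<eta> c" and "coidentity G A \<eta> k"
  shows "\<eta> ` carrier G = grouplikes A c k \<longleftrightarrow> totally_disconnected T"
proof -
  have "wc_algebra A" using assms(3) by (simp add: wc_algebra_def group_algebra_def)
  then interpret compact_group_bialgebra G T A \<eta> c k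
    using assms
    by (simp add: compact_group_bialgebra_def compact_group_bialgebra_axioms_def compact_group_algebra_def
        compact_group_algebra_axioms_def compact_comm_group_def compact_comm_group_axioms_def)
  show ?thesis
    using eta_grouplike grouplike_in_eta ex_grouplike_outside_eta by blast
qed

end
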